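(* Let $d\ge 2$ and let $\bm X:\Omega\to\mathbb R^d$ be a random variable on a probability space $(\Omega,\mathcal A,P)$ whose distribution has a smooth density function $p_{\bm X}$, where $\operatorname{supp} p_{\bm X}=\mathbb X$ is a compact region in $\mathbb R^d$ and $p_{\bm X}$ is strictly positive in the interior of $\mathbb X$. Let $\Gamma:[0,\ell_\Gamma]\to\mathbb X$ be a smooth Jordan curve parameterized by arc-length for which the normal coordinate map $\nu_\Gamma$ is a diffeomorphism on $(\lambda_\Gamma^{-1}([0,\ell_\Gamma])\cap\mathbb X)\setminus\mathcal A_\Gamma$. Assume that $\Gamma$ can be represented by the spherical-coordinate frame, i.e. $\Gamma'(s)=T(\bm\zeta(s))$ with smooth $\bm\zeta=(\zeta_1,\dots,\zeta_{d-1})$, where $\zeta_k(s)\in[0,\pi]$ and $\zeta_k(s)\notin\{0,\pi\}$ for $k=1,\dots,d-2$ and $s\in[0,\ell_\Gamma]$, and $\zeta_{d-1}(s)\in[0,2\pi)$, the normal vectors of the frame being $N_i(\bm\zeta(s))$. Then $\Gamma$ is self-consistent with respect to $\bm X$ if and only if it is (together with $\bm\zeta$) a solution of the system of differential equations $$\begin{aligned}\Gamma'(s)&=T(\bm\zeta(s)),\\ \bm\zeta'(s)&=D^{-1}(s)\Big(\mathrm{cov}_\perp(s)+v_\perp(s)\,v_\perp(s)^{\mathrm T}\Big)^{-1}v_\perp(s),\end{aligned}$$ where $D(s):=\operatorname{diag}\big(\|T_{\zeta_1}(\bm\zeta(s))\|,\dots,\|T_{\zeta_{d-1}}(\bm\zeta(s))\|\big)$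 and $v_\perp(s)$, $\mathrm{cov}_\perp(s)$ are the mean and covariance matrix of the transverse density at $s$.
   Context: Curves: a smooth Jordan curve parameterized by arc-length is an injective map $\Gamma\in C^\infty([0,\ell_\Gamma],\mathbb R^d)$ with $\|\Gamma'(s)\|=1$ for all $s$ (Euclidean norm). Projection: $\bm x\in\mathbb R^d$ is an ambiguity point of $\Gamma$ if it has more than one closest point on $\Gamma$; $\mathcal A_\Gamma$ is the set of ambiguity points. The projection index is $\lambda_\Gamma(\bm x):=\sup\{s\in[0,\ell_\Gamma]:\|\bm x-\Gamma(s)\|=\inf_{t\in[0,\ell_\Gamma]}\|\bm x-\Gamma(t)\|\}$, and $\pi_\Gamma:=\Gamma\circ\lambda_\Gamma$. Self-consistency: $\Gamma$ is self-consistent with respect to $\bm X$ if $\mathbb E[\bm X\mid\lambda_\Gamma(\bm X)=s]=\Gamma(s)$ for $P_{\lambda_\Gamma(\bm X)}$-almost every $s\in[0,\ell_\Gamma]$, where $P_{\lambda_\Gamma(\bm X)}$ is the distribution of $\lambda_\Gamma(\bm X)$. Frame: for $\bm\zeta=(\zeta_1,\dots,\zeta_{d-1})$ with $\zeta_i\in[0,\pi]$ ($i\le d-2$) and $\zeta_{d-1}\in[0,2\pi)$, $T(\bm\zeta)\in\mathbb S^{d-1}$ is the vector of spherical coordinates whose $k$-th entry is $\sin\zeta_1\cdots\sin\zeta_{k-1}\cos\zeta_k$ for $k=1,\dots,d-1$ and whose $d$-th entry is $\sin\zeta_1\cdots\sin\zeta_{d-1}$. Put $T_{\zeta_i}:=\partial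 T/\partial\zeta_i$; one has $\|T_{\zeta_1}\|=1$ and $\|T_{\zeta_k}\|=\prod_{i=1}^{k-1}\sin\zeta_i$. If $\zeta_k\notin\{0,\pi\}$ for $k=1,\dots,d-2$, set $N_i(\bm\zeta):=T_{\zeta_i}(\bm\zeta)/\|T_{\zeta_i}(\bm\zeta)\|$, $i=1,\dots,d-1$; then $T,N_1,\dots,N_{d-1}$ is an orthonormal basis of $\mathbb R^d$. Write $N_i(s)=N_i(\bm\zeta(s))$. Normal coordinates: $\nu_\Gamma:[0,\ell_\Gamma]\times\mathbb R^{d-1}\to\mathbb R^d$, $\nu_\Gamma(s,\bm u):=\Gamma(s)+\sum_{i=1}^{d-1}u_iN_i(s)$, and $\mu_\Gamma:\mathbb X\to[0,\ell_\Gamma]\times\mathbb R^{d-1}$, $\mu_\Gamma(\bm x):=\big(\lambda_\Gamma(\bm x),\langle\bm x-\pi_\Gamma(\bm x),N_1(\lambda_\Gamma(\bm x))\rangle,\dots,\langle\bm x-\pi_\Gamma(\bm x),N_{d-1}(\lambda_\Gamma(\bm x))\rangle\big)$. That $\nu_\Gamma$ is a diffeomorphism on $S:=(\lambda_\Gamma^{-1}([0,\ell_\Gamma])\cap\mathbb X)\setminus\mathcal A_\Gamma$ means that $\nu_\Gamma\circ\mu_\Gamma=\mathrm{id}$ on $S$ and that $\mu_\Gamma$ and $\nu_\Gamma$ are differentiable on the related domains $S$ and $\mu_\Gamma(S)$ (so that $\nu_\Gamma:\mu_\Gamma(S)\to S$ is a diffeomorphism with inverse $\mu_\Gamma$). Transverse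 moments and density: for $s\in[0,\ell_\Gamma]$ let $\mathcal R(s)$ be the set of $\bm u\in\mathbb R^{d-1}$ such that $\lambda_\Gamma\big(\Gamma(s)+\sum_iu_iN_i(s)\big)=s$ and $\Gamma(s)+\sum_iu_iN_i(s)\notin\mathcal A_\Gamma$. For $\bm j\in\mathbb N_0^{d-1}$, $$\mu_{\bm j}(s):=\int_{\mathcal R(s)}u_1^{j_1}\cdots u_{d-1}^{j_{d-1}}\,p_{\bm X}\Big(\Gamma(s)+\sum_{i=1}^{d-1}u_iN_i(s)\Big)\,d\bm u.$$ The transverse density at $s$ is $p_\perp(\bm u,s):=p_{\bm X}\big(\Gamma(s)+\sum_iu_iN_i(s)\big)/\mu_{\bm 0}(s)$, $\bm u\in\mathcal R(s)$. With $\bm e_1,\dots,\bm e_{d-1}$ the canonical basis of $\mathbb R^{d-1}$, its mean and covariance matrix are $$v_\perp(s):=\Big(\tfrac{\mu_{\bm e_1}(s)}{\mu_{\bm 0}(s)},\dots,\tfrac{\mu_{\bm e_{d-1}}(s)}{\mu_{\bm 0}(s)}\Big)^{\mathrm T},\qquad \mathrm{cov}_\perp(s):=\Big(\tfrac{\mu_{\bm e_i+\bm e_j}(s)}{\mu_{\bm 0}(s)}\Big)_{i,j=1}^{d-1}-v_\perp(s)\,v_\perp(s)^{\mathrm T}.$$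
   Formalization: The density is smooth on all of R^d, so the transverse density is undefined (μ_0(s)=0) at the end points of Γ and possibly elsewhere; the equation for ζ' is required exactly at those s in [0,ℓ_Γ] where μ_0(s) ≠ 0. *)

theory Defs
  imports "HOL-Probability.Probability"
begin

text \<open>
  The normal coordinates live in \<open>real ^ 'n\<close> with \<open>CARD('n) = d - 1\<close>, where the linear order on
  \<open>'n\<close> gives the order of the angles. The ambient space of dimension \<open>d = CARD('n) + 1 \<ge> 2\<close> is
  \<open>real ^ ('n option)\<close>: the entries \<open>Some k\<close> are the first \<open>d - 1\<close> coordinates and the entry
  \<open>None\<close> is the last one.
\<close>

subsection \<open>Smooth functions and curves\<close>

text \<open>
  Only used for \<open>S = UNIV\<close> and for \<open>S\<close> a nondegenerate compact interval, where derivatives within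
  \<open>S\<close> are unique (one-sided at the end points of the interval).
\<close>

primrec Ck_on ::
  "nat \<Rightarrow> 'a::real_normed_vector set \<Rightarrow> ('a \<Rightarrow> 'b::real_normed_vector) \<Rightarrow> bool" where
  "Ck_on 0 S f \<longleftrightarrow> continuous_on S f"
| "Ck_on (Suc k) S f \<longleftrightarrow>
     (\<exists>f'. (\<forall>x\<in>S. (f has_derivative f' x) (at x within S)) \<and> (\<forall>v. Ck_on k S (\<lambda>x. f' x v)))"

definition smooth_on ::
  "'a::real_normed_vector set \<Rightarrow> ('a \<Rightarrow> 'b::real_normed_vector) \<Rightarrow> bool" where
  "smooth_on S f \<longleftrightarrow> (\<forall>k. Ck_on k S f)"

definition smooth_arclength_curve :: "(real \<Rightarrow> 'a::euclidean_space) \<Rightarrow> real \<Rightarrow> bool" where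
  "smooth_arclength_curve \<Gamma> L \<longleftrightarrow>
     0 < L \<and> inj_on \<Gamma> {0..L} \<and> smooth_on {0..L} \<Gamma> \<and>
     (\<forall>s\<in>{0..L}. norm (vector_derivative \<Gamma> (at s within {0..L})) = 1)"

definition compact_region :: "'a::euclidean_space set \<Rightarrow> bool" where
  "compact_region K \<longleftrightarrow> compact K \<and> connected K \<and> K \<noteq> {} \<and> closure (interior K) = K"

subsection \<open>Projection onto a curve\<close>

definition ambiguity_set :: "(real \<Rightarrow> 'a::euclidean_space) \<Rightarrow> real \<Rightarrow> 'a set" where
  "ambiguity_set \<Gamma> L =
     {x. \<exists>y\<in>\<Gamma> ` {0..L}. \<exists>z\<in>\<Gamma> ` {0..L}. y \<noteq> z \<and>
         dist x y = infdist x (\<Gamma> ` {0..L}) \<and> dist x z = infdist x (\<Gamma> ` {0..L})}"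

definition proj_index :: "(real \<Rightarrow> 'a::euclidean_space) \<Rightarrow> real \<Rightarrow> 'a \<Rightarrow> real" where
  "proj_index \<Gamma> L x = Sup {s\<in>{0..L}. dist x (\<Gamma> s) = infdist x (\<Gamma> ` {0..L})}"

definition proj_curve :: "(real \<Rightarrow> 'a::euclidean_space) \<Rightarrow> real \<Rightarrow> 'a \<Rightarrow> 'a" where
  "proj_curve \<Gamma> L x = \<Gamma> (proj_index \<Gamma> L x)"

subsection \<open>Self-consistency\<close>

text \<open>
  \<open>g\<close> is a version of \<open>s \<mapsto> E[Y | Z = s]\<close>, that is, \<open>g \<circ> Z\<close> is a version of the conditional
  expectation of \<open>Y\<close> (taken componentwise) given the sigma-algebra generated by \<open>Z\<close>. Such a \<open>g\<close>
  is unique up to null sets of the distribution of \<open>Z\<close>.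
\<close>

definition cond_exp_given ::
  "'w measure \<Rightarrow> ('w \<Rightarrow> real ^ 'm::finite) \<Rightarrow> ('w \<Rightarrow> real) \<Rightarrow> (real \<Rightarrow> real ^ 'm) \<Rightarrow> bool" where
  "cond_exp_given M Y Z g \<longleftrightarrow>
     g \<in> borel_measurable borel \<and>
     (\<forall>i. AE \<omega> in M.
        real_cond_exp M (vimage_algebra (space M) Z borel) (\<lambda>\<omega>. Y \<omega> $ i) \<omega> = g (Z \<omega>) $ i)"

definition self_consistent ::
  "'w measure \<Rightarrow> ('w \<Rightarrow> real ^ 'm::finite) \<Rightarrow> (real \<Rightarrow> real ^ 'm) \<Rightarrow> real \<Rightarrow> bool" where
  "self_consistent M X \<Gamma> L \<longleftrightarrow>
     (\<exists>g. cond_exp_given M X (\<lambda>\<omega>. proj_index \<Gamma> L (X \<omega>)) g \<and>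
          (AE s in distr M borel (\<lambda>\<omega>. proj_index \<Gamma> L (X \<omega>)). g s = \<Gamma> s))"

subsection \<open>The spherical coordinate frame\<close>

definition sph :: "real ^ 'n::{finite,linorder} \<Rightarrow> real ^ ('n option)" where
  "sph z = (\<chi> k. case k of
       Some k \<Rightarrow> (\<Prod>j\<in>{j. j < k}. sin (z $ j)) * cos (z $ k)
     | None \<Rightarrow> (\<Prod>j\<in>UNIV. sin (z $ j)))"

definition sph_partial :: "'n::{finite,linorder} \<Rightarrow> (real, 'n) vec \<Rightarrow> real ^ ('n option)" where
  "sph_partial i z = vector_derivative (\<lambda>t. sph (z + t *\<^sub>R axis i 1)) (at 0)"

definition sph_normal :: "'n::{finite,linorder} \<Rightarrow> (real, 'n) vec \<Rightarrow> real ^ ('n option)" where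
  "sph_normal i z = sph_partial i z /\<^sub>R norm (sph_partial i z)"

definition frame_angles :: "real ^ 'n::{finite,linorder} \<Rightarrow> bool" where
  "frame_angles z \<longleftrightarrow>
     (\<forall>k. k \<noteq> Max UNIV \<longrightarrow> z $ k \<in> {0..pi} \<and> z $ k \<notin> {0, pi}) \<and>
     z $ Max UNIV \<in> {0..<2 * pi}"

definition frame_diag :: "real ^ 'n::{finite,linorder} \<Rightarrow> ((real, 'n) vec, 'n) vec" where
  "frame_diag z = (\<chi> i j. if i = j then norm (sph_partial i z) else 0)"

subsection \<open>Normal coordinates\<close>

definition normal_map ::
  "(real \<Rightarrow> real ^ ('n::{finite,linorder} option)) \<Rightarrow> (real \<Rightarrow> (real, 'n) vec)
    \<Rightarrow> real \<times> (real, 'n) vec \<Rightarrow> real ^ ('n option)" where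
  "normal_map \<Gamma> \<zeta> = (\<lambda>(s, u). \<Gamma> s + (\<Sum>i\<in>UNIV. (u $ i) *\<^sub>R sph_normal i (\<zeta> s)))"

definition normal_coords ::
  "(real \<Rightarrow> real ^ ('n::{finite,linorder} option)) \<Rightarrow> real \<Rightarrow> (real \<Rightarrow> (real, 'n) vec)
    \<Rightarrow> real ^ ('n option) \<Rightarrow> real \<times> (real, 'n) vec" where
  "normal_coords \<Gamma> L \<zeta> x =
     (proj_index \<Gamma> L x,
      \<chi> i. (x - proj_curve \<Gamma> L x) \<bullet> sph_normal i (\<zeta> (proj_index \<Gamma> L x)))"

definition normal_map_diffeo_on ::
  "(real \<Rightarrow> real ^ ('n::{finite,linorder} option)) \<Rightarrow> real \<Rightarrow> (real \<Rightarrow> (real, 'n) vec)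
    \<Rightarrow> (real ^ ('n option)) set \<Rightarrow> bool" where
  "normal_map_diffeo_on \<Gamma> L \<zeta> S \<longleftrightarrow>
     (\<forall>x\<in>S. normal_map \<Gamma> \<zeta> (normal_coords \<Gamma> L \<zeta> x) = x) \<and>
     normal_coords \<Gamma> L \<zeta> differentiable_on S \<and>
     normal_map \<Gamma> \<zeta> differentiable_on (normal_coords \<Gamma> L \<zeta> ` S)"

subsection \<open>Moments of the transverse density\<close>

definition transverse_set ::
  "(real \<Rightarrow> real ^ ('n::{finite,linorder} option)) \<Rightarrow> real \<Rightarrow> (real \<Rightarrow> (real, 'n) vec)
    \<Rightarrow> real \<Rightarrow> (real, 'n) vec set" where
  "transverse_set \<Gamma> L \<zeta> s =
     {u. proj_index \<Gamma> L (normal_map \<Gamma> \<zeta> (s, u)) = s \<and> normal_map \<Gamma> \<zeta> (s, u) \<notin> ambiguity_set \<Gamma> L}"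

definition transverse_moment ::
  "(real ^ ('n::{finite,linorder} option) \<Rightarrow> real) \<Rightarrow> (real \<Rightarrow> real ^ ('n option)) \<Rightarrow> real
    \<Rightarrow> (real \<Rightarrow> (real, 'n) vec) \<Rightarrow> ('n \<Rightarrow> nat) \<Rightarrow> real \<Rightarrow> real" where
  "transverse_moment p \<Gamma> L \<zeta> j s =
     set_lebesgue_integral lborel (transverse_set \<Gamma> L \<zeta> s)
       (\<lambda>u. (\<Prod>i\<in>UNIV. (u $ i) ^ j i) * p (normal_map \<Gamma> \<zeta> (s, u)))"

definition unit_index :: "'n \<Rightarrow> 'n \<Rightarrow> nat" where
  "unit_index i = (\<lambda>k. if k = i then 1 else 0)"

definition transverse_mean ::
  "(real ^ ('n::{finite,linorder} option) \<Rightarrow> real) \<Rightarrow> (real \<Rightarrow> real ^ ('n option)) \<Rightarrow> real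
    \<Rightarrow> (real \<Rightarrow> (real, 'n) vec) \<Rightarrow> real \<Rightarrow> (real, 'n) vec" where
  "transverse_mean p \<Gamma> L \<zeta> s =
     (\<chi> i. transverse_moment p \<Gamma> L \<zeta> (unit_index i) s / transverse_moment p \<Gamma> L \<zeta> (\<lambda>_. 0) s)"

definition outer :: "real ^ 'n \<Rightarrow> real ^ 'n \<Rightarrow> real ^ 'n ^ 'n" where
  "outer v w = (\<chi> i j. v $ i * w $ j)"

definition transverse_cov ::
  "(real ^ ('n::{finite,linorder} option) \<Rightarrow> real) \<Rightarrow> (real \<Rightarrow> real ^ ('n option)) \<Rightarrow> real
    \<Rightarrow> (real \<Rightarrow> (real, 'n) vec) \<Rightarrow> real \<Rightarrow> ((real, 'n) vec, 'n) vec" where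
  "transverse_cov p \<Gamma> L \<zeta> s =
     (\<chi> i j. transverse_moment p \<Gamma> L \<zeta> (\<lambda>k. unit_index i k + unit_index j k) s
              / transverse_moment p \<Gamma> L \<zeta> (\<lambda>_. 0) s)
     - outer (transverse_mean p \<Gamma> L \<zeta> s) (transverse_mean p \<Gamma> L \<zeta> s)"

subsection \<open>The system of differential equations\<close>

text \<open>
  The transverse density at \<open>s\<close> exists only if its normalizing constant, the moment of order zero,
  is nonzero. It can vanish where the curve meets the boundary of the support of \<open>p\<close>, typically at
  the end points; there the right-hand side of the second equation is \<open>0 / 0\<close> (and would be \<open>0\<close>
  by the convention for division), so the second equation is imposed exactly at the parameters
  where the transverse density exists. Derivatives are one-sided at the end points.
\<close>

definition solves_system ::
  "(real ^ ('n::{finite,linorder} option) \<Rightarrow> real) \<Rightarrow> real \<Rightarrow> (real \<Rightarrow> real ^ ('n option))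
    \<Rightarrow> (real \<Rightarrow> (real, 'n) vec) \<Rightarrow> bool" where
  "solves_system p L \<Gamma> \<zeta> \<longleftrightarrow>
     (\<forall>s\<in>{0..L}. (\<Gamma> has_vector_derivative sph (\<zeta> s)) (at s within {0..L})) \<and>
     (\<forall>s\<in>{0..L}. transverse_moment p \<Gamma> L \<zeta> (\<lambda>_. 0) s \<noteq> 0 \<longrightarrow>
        (let v = transverse_mean p \<Gamma> L \<zeta> s; C = transverse_cov p \<Gamma> L \<zeta> s in
          (\<zeta> has_vector_derivative
             matrix_inv (frame_diag (\<zeta> s)) *v (matrix_inv (C + outer v v) *v v))
           (at s within {0..L})))"

end

theory Submission
  imports Defs
begin

text \<open>
  In the normal coordinates \<open>x = \<nu> (s, u)\<close> the volume element is \<open>(1 - u \<bullet> D \<zeta>') ds du\<close>, so the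
  conditional mean of \<open>X - \<Gamma> s\<close> given the projection index \<open>s\<close> vanishes iff
  \<open>\<integral> u\<^sub>i (1 - u \<bullet> D \<zeta>') p = 0\<close> for all \<open>i\<close>, that is, iff the matrix of second moments maps \<open>D \<zeta>'\<close> to
  the vector of first moments. This gives the equation for \<open>\<zeta>'\<close> at almost every \<open>s\<close>, and at every
  \<open>s\<close> because the moments depend continuously on \<open>s\<close>: ambiguity points form a null set, and
  differentiability of the projection index at a non-ambiguous interior point \<open>x\<close> of the support
  forces the Jacobian to be nonzero there, so that nearby points of the normal spaces project
  orthogonally. The same argument shows that such an \<open>x\<close> is never projected to an end point of the
  curve, so the transverse density does not exist there and the equation is void.
\<close>

section \<open>The spherical frame\<close>

text \<open>The obstacle is the domain of differentiability: \<open>K - amb\<close> need not be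
  open, so the derivative of the projection index is taken relative to a set that is only known to
  be dense in the interior of \<open>K\<close>. First-order conditions survive in every direction,
  because an inequality between continuous functions passes to the closure; this is how an identity
  on \<open>K - amb\<close> can be differentiated and how extrema of \<open>ix\<close> are
  exploited. Openness of the coordinate range \<open>tube\<close>, which the change of variables
  relies on, is a consequence and not an assumption.

  Both sides of the equivalence are compared with one condition, \<open>flux i s = 0\<close> for all
  \<open>s\<close> strictly between \<open>0\<close> and \<open>L\<close>. Unlike mean and
  covariance, the flux contains no division by the mass. It vanishes of itself where the mass is
  zero, just where the angle equation is not imposed, and limits of its zeros are again zeros.

  The frame makes the Jacobian explicit: the derivatives of \<nu> in the normal directions are
  orthonormal, so only the tangential part of the derivative along the curve enters the
  determinant.\<close>

lemma sum_option_UNIV: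
  fixes f :: "'n::finite option \<Rightarrow> 'a::comm_monoid_add"
  shows "sum f UNIV = f None + (\<Sum>k\<in>UNIV. f (Some k))"
proof -
  have "sum f UNIV = f None + sum f (range Some)"
    unfolding UNIV_option_conv by (subst sum.insert) auto
  then show ?thesis by (simp add: sum.reindex)
qed

lemma inner_option_vec:
  fixes x y :: "real ^ ('n::finite option)"
  shows "x \<bullet> y = x $ None * y $ None + (\<Sum>k\<in>UNIV. x $ Some k * y $ Some k)"
  by (simp add: inner_vec_def sum_option_UNIV)

lemma sph_nth:
  "sph z $ Some k = (\<Prod>j\<in>{j. j < k}. sin (z $ j)) * cos (z $ k)"
  "sph z $ None = (\<Prod>j\<in>UNIV. sin (z $ j))"
  by (simp_all add: sph_def)

text \<open>Stated for a finite set of indices to allow induction on the largest one: it occurs only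
  in its own entry and in the full product, and the squares of cosine and sine merge these two into
  the product over the rest.\<close>

lemma sum_spherical_squares:
  fixes f :: "'n::linorder \<Rightarrow> real"
  assumes "finite U"
  shows "(\<Sum>k\<in>U. ((\<Prod>j\<in>{j\<in>U. j < k}. sin (f j)) * cos (f k))\<^sup>2) + (\<Prod>j\<in>U. sin (f j))\<^sup>2 = 1"
  using assms
proof (induction rule: finite_linorder_max_induct)
  case empty
  then show ?case by simp
next
  case (insert b U)
  have b: "b \<notin> U" using insert.hyps by auto
  have "{j \<in> insert b U. j < k} = {j \<in> U. j < k}" if "k \<in> U" for k
    using that insert.hyps by auto
  moreover have "{j \<in> insert b U. j < b} = U"
    using insert.hyps by auto
  ultimately have "(\<Sum>k\<in>insert b U. ((\<Prod>j\<in>{j\<in>insert b U. j < k}. sin (f j)) * cos (f k))\<^sup>2)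
      + (\<Prod>j\<in>insert b U. sin (f j))\<^sup>2
    = ((\<Prod>j\<in>U. sin (f j)) * cos (f b))\<^sup>2
      + (\<Sum>k\<in>U. ((\<Prod>j\<in>{j\<in>U. j < k}. sin (f j)) * cos (f k))\<^sup>2)
      + (sin (f b) * (\<Prod>j\<in>U. sin (f j)))\<^sup>2"
    using b insert.hyps(1) by simp
  also have "\<dots> = (\<Sum>k\<in>U. ((\<Prod>j\<in>{j\<in>U. j < k}. sin (f j)) * cos (f k))\<^sup>2)
      + ((cos (f b))\<^sup>2 + (sin (f b))\<^sup>2) * (\<Prod>j\<in>U. sin (f j))\<^sup>2"
    by (simp only: power_mult_distrib) (simp only: algebra_simps)
  finally show ?case using insert.IH by simp
qed

lemma inner_sph_self: "sph z \<bullet> sph z = 1"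
  using sum_spherical_squares[of UNIV "\<lambda>j. z $ j"]
  by (simp add: inner_option_vec sph_nth power2_eq_square)

lemma differentiable_vec_lambda:
  fixes f :: "'a::real_normed_vector \<Rightarrow> real ^ 'm::finite"
  assumes "\<And>k. (\<lambda>x. f x $ k) differentiable (at x within S)"
  shows "f differentiable (at x within S)"
proof -
  obtain d where d: "\<And>k. ((\<lambda>x. f x $ k) has_derivative d k) (at x within S)"
    using assms unfolding differentiable_def by metis
  have "(f has_derivative (\<lambda>h. \<chi> k. d k h)) (at x within S)"
    using d by (subst has_derivative_componentwise_within)
      (auto simp: Basis_vec_def cart_eq_inner_axis [symmetric])
  then show ?thesis unfolding differentiable_def by blast
qed

lemma differentiable_prod_fun:
  fixes f :: "'i \<Rightarrow> 'a::real_normed_vector \<Rightarrow> real"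
  assumes "\<And>i. i \<in> I \<Longrightarrow> f i differentiable (at x within S)"
  shows "(\<lambda>x. \<Prod>i\<in>I. f i x) differentiable (at x within S)"
proof -
  obtain d where "\<And>i. i \<in> I \<Longrightarrow> (f i has_derivative d i) (at x within S)"
    using assms unfolding differentiable_def by metis
  then have "((\<lambda>x. \<Prod>i\<in>I. f i x) has_derivative
      (\<lambda>y. \<Sum>i\<in>I. d i y * (\<Prod>j\<in>I - {i}. f j x))) (at x within S)"
    by (intro has_derivative_prod) auto
  then show ?thesis unfolding differentiable_def by blast
qed

lemma differentiable_sph: "sph differentiable (at z within S)"
proof (rule differentiable_vec_lambda)
  fix k :: "'a option"
  have nth: "(\<lambda>z::(real,'a) vec. z $ j) differentiable (at z within S)" for j
    by (intro bounded_linear_imp_differentiable bounded_linear_vec_nth)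
  have s: "(\<lambda>z::(real,'a) vec. sin (z $ j)) differentiable (at z within S)" for j
    using nth[of j] has_derivative_sin unfolding differentiable_def by metis
  have c: "(\<lambda>z::(real,'a) vec. cos (z $ j)) differentiable (at z within S)" for j
    using nth[of j] has_derivative_cos unfolding differentiable_def by metis
  show "(\<lambda>z. sph z $ k) differentiable (at z within S)"
    by (cases k) (auto simp: sph_nth intro!: differentiable_mult differentiable_prod_fun s c)
qed

text \<open>Differentiability is known from the entries; the chain rule along coordinate lines then
  identifies the derivative, since \<open>sph_partial\<close> is defined by one-variable
  derivatives.\<close>

lemma has_derivative_sph:
  "(sph has_derivative (\<lambda>h. \<Sum>i\<in>UNIV. (h $ i) *\<^sub>R sph_partial i z)) (at z within S)"
proof -
  obtain d where d: "(sph has_derivative d) (at z)"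
    using differentiable_sph[of z UNIV] unfolding differentiable_def by blast
  then have lin: "linear d" by (rule has_derivative_linear)
  have partial: "sph_partial i z = d (axis i 1)" for i
  proof -
    have "((\<lambda>t. z + t *\<^sub>R axis i 1) has_derivative (\<lambda>t. t *\<^sub>R axis i 1)) (at (0::real))"
      by (auto intro!: derivative_eq_intros)
    moreover have "(sph has_derivative d) (at (z + 0 *\<^sub>R axis i 1))" using d by simp
    ultimately have "((\<lambda>t. sph (z + t *\<^sub>R axis i 1)) has_derivative (\<lambda>t. d (t *\<^sub>R axis i 1))) (at (0::real))"
      by (rule has_derivative_compose)
    then have "((\<lambda>t. sph (z + t *\<^sub>R axis i 1)) has_vector_derivative d (axis i 1)) (at (0::real))"
      unfolding has_vector_derivative_def by (simp add: linear_cmul[OF lin])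
    then show ?thesis unfolding sph_partial_def by (rule vector_derivative_at)
  qed
  have "d h = (\<Sum>i\<in>UNIV. (h $ i) *\<^sub>R sph_partial i z)" for h
  proof -
    have "h = (\<Sum>i\<in>UNIV. (h $ i) *\<^sub>R axis i 1)"
      by (simp add: basis_expansion flip: scalar_mult_eq_scaleR)
    then have "d h = d (\<Sum>i\<in>UNIV. (h $ i) *\<^sub>R axis i 1)" by (rule arg_cong)
    also have "\<dots> = (\<Sum>i\<in>UNIV. (h $ i) *\<^sub>R sph_partial i z)"
      by (simp only: linear_sum[OF lin] linear_cmul[OF lin] partial)
    finally show ?thesis .
  qed
  then have "d = (\<lambda>h. \<Sum>i\<in>UNIV. (h $ i) *\<^sub>R sph_partial i z)" by (rule ext)
  with d show ?thesis by (metis has_derivative_at_withinI)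
qed

text \<open>Shifting the \<open>i\<close>-th angle by a quarter turn differentiates the factor that contains it; the
  entries before the \<open>i\<close>-th one do not contain it.\<close>

lemma sph_partial_nth:
  "sph_partial i z $ k =
     (if k \<in> Some ` {..<i} then 0 else sph (z + axis i (pi / 2)) $ k)"
proof -
  have "((\<lambda>t. z + t *\<^sub>R axis i 1) has_derivative (\<lambda>t. t *\<^sub>R axis i 1)) (at (0::real))"
    by (auto intro!: derivative_eq_intros)
  from has_derivative_compose[OF this has_derivative_sph]
  have "((\<lambda>t. sph (z + t *\<^sub>R axis i 1)) has_derivative (\<lambda>t. t *\<^sub>R sph_partial i z)) (at (0::real))"
    by (simp add: axis_def if_distrib if_distribR cong: if_cong)
  then have "((\<lambda>t. sph (z + t *\<^sub>R axis i 1) $ k) has_derivative (\<lambda>t. (t *\<^sub>R sph_partial i z) $ k)) (at (0::real))"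
    by (rule bounded_linear.has_derivative[OF bounded_linear_vec_nth])
  then have D: "((\<lambda>t. sph (z + t *\<^sub>R axis i 1) $ k) has_real_derivative sph_partial i z $ k) (at 0)"
    by (simp add: has_field_derivative_def mult_commute_abs)
  have nth: "(z + t *\<^sub>R axis i 1) $ j = (if j = i then z $ i + t else z $ j)"
    "(z + axis i t) $ j = (if j = i then z $ i + t else z $ j)" for t j
    by (auto simp: axis_def)
  note [simp del] = vector_add_component vector_scaleR_component
  show ?thesis
  proof (cases k)
    case None
    define R where "R = (\<Prod>j\<in>UNIV - {i}. sin (z $ j))"
    have R: "(\<Prod>j\<in>UNIV. sin (if j = i then a else z $ j)) = sin a * R" for a
      unfolding R_def by (subst prod.remove[of _ i]) (auto intro!: prod.cong)
    have "((\<lambda>t. sin (z $ i + t) * R) has_real_derivative cos (z $ i) * R) (at 0)"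
      by (auto intro!: derivative_eq_intros)
    moreover have "(\<lambda>t. sph (z + t *\<^sub>R axis i 1) $ k) = (\<lambda>t. sin (z $ i + t) * R)"
      by (simp add: None sph_nth nth R)
    ultimately have "sph_partial i z $ k = cos (z $ i) * R" using D DERIV_unique by fastforce
    then show ?thesis using None by (simp add: sph_nth nth R sin_add)
  next
    case (Some m)
    consider "m < i" | "m = i" | "i < m" by fastforce
    then show ?thesis
    proof cases
      case 1
      have "(\<lambda>t. sph (z + t *\<^sub>R axis i 1) $ k) = (\<lambda>t. sph z $ k)"
        using 1 Some by (intro ext) (auto simp: sph_nth nth intro!: arg_cong2[where f="(*)"] prod.cong)
      then show ?thesis using DERIV_unique[OF D, of 0] Some 1 by auto
    next
      case 2
      define R where "R = (\<Prod>j\<in>{j. j < i}. sin (z $ j))"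
      have R: "(\<Prod>j\<in>{j. j < i}. sin (if j = i then a else z $ j)) = R" for a
        unfolding R_def by (auto intro!: prod.cong)
      have "((\<lambda>t. R * cos (z $ i + t)) has_real_derivative - R * sin (z $ i)) (at 0)"
        by (auto intro!: derivative_eq_intros)
      moreover have "(\<lambda>t. sph (z + t *\<^sub>R axis i 1) $ k) = (\<lambda>t. R * cos (z $ i + t))"
        by (simp add: Some 2 sph_nth nth R)
      ultimately have "sph_partial i z $ k = - R * sin (z $ i)" using D DERIV_unique by fastforce
      then show ?thesis using Some 2 by (auto simp add: sph_nth nth R cos_add)
    next
      case 3
      define R where "R = (\<Prod>j\<in>{j. j < m} - {i}. sin (z $ j))"
      have R: "(\<Prod>j\<in>{j. j < m}. sin (if j = i then a else z $ j)) = sin a * R" for a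
        unfolding R_def using 3 by (subst prod.remove[of _ i]) (auto intro!: prod.cong)
      have "((\<lambda>t. sin (z $ i + t) * R * cos (z $ m)) has_real_derivative cos (z $ i) * R * cos (z $ m)) (at 0)"
        by (auto intro!: derivative_eq_intros)
      moreover have "(\<lambda>t. sph (z + t *\<^sub>R axis i 1) $ k) = (\<lambda>t. sin (z $ i + t) * R * cos (z $ m))"
        using 3 by (auto simp: Some sph_nth nth R)
      ultimately have "sph_partial i z $ k = cos (z $ i) * R * cos (z $ m)" using D DERIV_unique by fastforce
      then show ?thesis using Some 3 by (auto simp add: sph_nth nth R sin_add)
    qed
  qed
qed

text \<open>By the quarter-turn formula each entry is either constantly zero or an entry of
  \<open>sph\<close> after a translation, so no second derivatives have to be computed.\<close>

lemma differentiable_sph_partial: "sph_partial i differentiable (at z within S)"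
proof (rule differentiable_vec_lambda)
  fix k :: "'a option"
  have "(sph \<circ> (\<lambda>z. z + axis i (pi / 2))) differentiable (at z within S)"
    by (intro differentiable_chain_within differentiable_sph derivative_intros)
  then have "(\<lambda>z. sph (z + axis i (pi / 2)) $ k) differentiable (at z within S)"
    unfolding differentiable_def o_def
    using bounded_linear.has_derivative[OF bounded_linear_vec_nth[of k]] by blast
  then show "(\<lambda>z. sph_partial i z $ k) differentiable (at z within S)"
    unfolding sph_partial_nth by (cases "k \<in> Some ` {..<i}") simp_all
qed

text \<open>Obtained by differentiating the constant \<open>sph x \<bullet> sph x\<close>.\<close>

lemma inner_sph_sph_partial: "sph z \<bullet> sph_partial i z = 0"
proof -
  have "((\<lambda>x. sph x \<bullet> sph x) has_derivative (\<lambda>h. sph z \<bullet> (\<Sum>i\<in>UNIV. (h $ i) *\<^sub>R sph_partial i z)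
      + (\<Sum>i\<in>UNIV. (h $ i) *\<^sub>R sph_partial i z) \<bullet> sph z)) (at z)"
    by (intro has_derivative_inner has_derivative_sph)
  then have "((\<lambda>x. 1::real) has_derivative (\<lambda>h. 2 * (sph z \<bullet> (\<Sum>i\<in>UNIV. (h $ i) *\<^sub>R sph_partial i z)))) (at z)"
    by (simp add: inner_sph_self inner_commute)
  then have "(\<lambda>h. 2 * (sph z \<bullet> (\<Sum>i\<in>UNIV. (h $ i) *\<^sub>R sph_partial i z))) = (\<lambda>h. 0)"
    using has_derivative_const by (rule has_derivative_unique)
  from fun_cong[OF this, of "axis i 1"] show ?thesis
    by (simp add: axis_def if_distrib if_distribR cong: if_cong)
qed

text \<open>An index below another one is not the last, and only the last angle may have a vanishing
  sine.\<close>

lemma frame_angles_sin_nonzero: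
  assumes "frame_angles z" "i < k"
  shows "sin (z $ i) \<noteq> 0"
proof -
  have "i \<noteq> Max UNIV" using assms(2) by (metis Max_ge UNIV_I finite leD)
  then have "0 < z $ i" "z $ i < pi" using assms(1) unfolding frame_angles_def by force+
  then show ?thesis using sin_gt_zero by force
qed

text \<open>Let \<open>i < l\<close>. The entries before \<open>l\<close> vanish in
  \<open>sph_partial l z\<close>; in the remaining ones the \<open>i\<close>-th angle enters through
  a sine, so there \<open>sin (z $ i)\<close> times \<open>sph_partial i z\<close> equals
  \<open>cos (z $ i)\<close> times \<open>sph z\<close>. This reduces the claim to the orthogonality
  of \<open>sph z\<close> and \<open>sph_partial l z\<close>.\<close>

lemma inner_sph_partial:
  assumes z: "frame_angles z" and "i \<noteq> l"
  shows "sph_partial i z \<bullet> sph_partial l z = 0"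
proof -
  have *: "sph_partial i z \<bullet> sph_partial l z = 0" if il: "i < l" for i l
  proof -
    have nz: "sin (z $ i) \<noteq> 0" using frame_angles_sin_nonzero[OF z il] .
    have nth: "(z + axis i t) $ j = (if j = i then z $ i + t else z $ j)" for t j
      by (auto simp: axis_def)
    note [simp del] = vector_add_component
    have "sin (z $ i) * (\<Prod>j\<in>I. sin ((z + axis i (pi/2)) $ j)) = cos (z $ i) * (\<Prod>j\<in>I. sin (z $ j))"
      if "i \<in> I" "finite I" for I
    proof -
      have "(\<Prod>j\<in>I - {i}. sin ((z + axis i (pi/2)) $ j)) = (\<Prod>j\<in>I - {i}. sin (z $ j))"
        by (auto simp: nth intro!: prod.cong)
      then show ?thesis using that by (simp add: prod.remove[of I i] nth sin_add)
    qed
    then have "sin (z $ i) * sph_partial i z $ k = cos (z $ i) * sph z $ k" if "k \<notin> Some ` {..<l}" for k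
      using that il by (cases k) (auto simp: sph_partial_nth sph_nth nth mult_ac image_iff)
    then have "sin (z $ i) * (sph_partial i z $ k * sph_partial l z $ k) = cos (z $ i) * (sph z $ k * sph_partial l z $ k)" for k
      by (cases "k \<in> Some ` {..<l}") (auto simp: sph_partial_nth[of l] simp flip: mult.assoc)
    then have "sin (z $ i) * (sph_partial i z \<bullet> sph_partial l z) = cos (z $ i) * (sph z \<bullet> sph_partial l z)"
      by (simp only: inner_vec_def inner_real_def sum_distrib_left)
    then show ?thesis using nz by (simp add: inner_sph_sph_partial)
  qed
  show ?thesis using assms(2) *[of i l] *[of l i] by (metis inner_commute neq_iff)
qed

text \<open>With \<open>P\<close> the nonzero product of the earlier sines, the entry
  \<open>Some i\<close> is \<open>- P * sin (z $ i)\<close>. It can vanish only for the last index,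
  and then the entry \<open>None\<close> is \<open>cos (z $ i) * P\<close>.\<close>

lemma sph_partial_nonzero:
  assumes z: "frame_angles z"
  shows "sph_partial i z \<noteq> 0"
proof
  assume 0: "sph_partial i z = 0"
  have nth: "(z + axis i t) $ j = (if j = i then z $ i + t else z $ j)" for t j
    by (auto simp: axis_def)
  define P where "P = (\<Prod>j\<in>{j. j < i}. sin (z $ j))"
  note [simp del] = vector_add_component
  have P: "P \<noteq> 0" unfolding P_def using frame_angles_sin_nonzero[OF z] by simp
  have "sph_partial i z $ Some i = - P * sin (z $ i)"
    by (auto simp: sph_partial_nth sph_nth nth cos_add P_def intro!: prod.cong)
  with 0 P have s: "sin (z $ i) = 0" by simp
  then have "i = Max UNIV" using frame_angles_sin_nonzero[OF z, of i "Max UNIV"]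
    by (metis Max_ge UNIV_I finite le_neq_trans)
  then have *: "UNIV - {i} = {j. j < i}" by (auto simp: order.strict_iff_order)
  have "sph_partial i z $ None = cos (z $ i) * P"
    unfolding P_def by (auto simp: sph_partial_nth sph_nth nth sin_add prod.remove[of UNIV i] * intro!: prod.cong)
  with 0 P have "cos (z $ i) = 0" by simp
  with s show False using sin_cos_squared_add[of "z $ i"] by simp
qed

lemma inner_sph_sph_normal: "sph z \<bullet> sph_normal i z = 0"
  by (simp add: sph_normal_def inner_sph_sph_partial)

lemma inner_sph_normal:
  assumes "frame_angles z"
  shows "sph_normal i z \<bullet> sph_normal j z = (if i = j then 1 else 0)"
  using inner_sph_partial[OF assms] sph_partial_nonzero[OF assms]
  by (auto simp: sph_normal_def dot_square_norm power2_eq_square divide_simps)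

lemma differentiable_sph_normal:
  assumes "frame_angles z"
  shows "sph_normal i differentiable (at z within S)"
proof -
  have "(norm \<circ> sph_partial i) differentiable (at z within S)"
    using sph_partial_nonzero[OF assms]
    by (intro differentiable_chain_within differentiable_sph_partial differentiable_norm_at[THEN differentiable_at_withinI])
  then have "(\<lambda>z. inverse (norm (sph_partial i z))) differentiable (at z within S)"
    using sph_partial_nonzero[OF assms] by (intro differentiable_inverse) (auto simp: o_def)
  then show ?thesis unfolding sph_normal_def
    by (intro differentiable_scaleR differentiable_sph_partial)
qed

section \<open>Points with several nearest points\<close>

text \<open>A point has one of its nearest points in \<open>C'\<close> iff its distances to
  \<open>C'\<close> and to \<open>C\<close> agree, an equality of continuous functions. Used both
  for the ambiguity set and for the measurability of the projection index.\<close>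

lemma closed_nearest_in:
  fixes C C' :: "'a::euclidean_space set"
  assumes C': "compact C'" and sub: "C' \<subseteq> C"
  shows "closed {x. \<exists>y\<in>C'. dist x y = infdist x C}"
proof (cases "C' = {}")
  case False
  have "(\<exists>y\<in>C'. dist x y = infdist x C) \<longleftrightarrow> infdist x C' = infdist x C" for x
  proof
    assume "\<exists>y\<in>C'. dist x y = infdist x C"
    then show "infdist x C' = infdist x C"
      by (metis False antisym infdist_le infdist_mono sub)
  next
    assume "infdist x C' = infdist x C"
    then show "\<exists>y\<in>C'. dist x y = infdist x C"
      using infdist_attains_inf[OF compact_imp_closed[OF C'] False, of x] by metis
  qed
  then show ?thesis by (simp add: closed_Collect_eq continuous_on_infdist)
qed simp

text \<open>Infinitely many translates of a bounded piece of \<open>F\<close>, by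
  \<open>b / (n + 1)\<close>, are disjoint, have equal measure and fit into one ball, so that
  measure is zero.\<close>

lemma negligible_of_disjoint_translates:
  fixes F :: "'a::euclidean_space set"
  assumes F: "closed F" and b: "\<And>x t. x \<in> F \<Longrightarrow> 0 < t \<Longrightarrow> x + t *\<^sub>R b \<notin> F"
  shows "negligible F"
proof (subst negligible_on_intervals, intro allI)
  fix l u :: 'a
  define G where "G = F \<inter> cbox l u"
  have "compact G" unfolding G_def by (intro closed_Int_compact F compact_cbox)
  then have bG: "bounded G" and mG: "G \<in> lmeasurable"
    by (auto intro: compact_imp_bounded lmeasurable_compact)
  define T where "T n = (+) (inverse (real (Suc n)) *\<^sub>R b) ` G" for n
  obtain r where r: "\<And>x. x \<in> G \<Longrightarrow> norm x \<le> r" using bG unfolding bounded_iff by blast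
  define B where "B = cball (0::'a) (r + norm b)"
  have T_sub: "T n \<subseteq> B" for n
  proof
    fix x assume "x \<in> T n"
    then obtain y where y: "y \<in> G" "x = inverse (real (Suc n)) *\<^sub>R b + y" unfolding T_def by blast
    have "norm (inverse (real (Suc n)) *\<^sub>R b) \<le> 1 * norm b"
      unfolding norm_scaleR by (rule mult_right_mono) (auto simp: field_simps)
    then show "x \<in> B" using r[OF y(1)] norm_triangle_ineq[of "inverse (real (Suc n)) *\<^sub>R b" y]
      unfolding B_def y(2) by simp
  qed
  have T_meas: "T n \<in> lmeasurable" "measure lebesgue (T n) = measure lebesgue G" for n
    unfolding T_def using mG by (simp_all add: measurable_translation measure_translation)
  have disj: "T m \<inter> T n = {}" if "m < n" for m n
  proof (rule ccontr)
    assume "T m \<inter> T n \<noteq> {}"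
    then obtain y z where yz: "y \<in> G" "z \<in> G"
      "inverse (real (Suc m)) *\<^sub>R b + y = inverse (real (Suc n)) *\<^sub>R b + z" unfolding T_def by blast
    define t where "t = inverse (real (Suc m)) - inverse (real (Suc n))"
    have "t > 0" unfolding t_def using that by simp
    moreover have "z = y + t *\<^sub>R b" unfolding t_def using yz(3) by (simp add: algebra_simps)
    ultimately show False using b yz unfolding G_def by blast
  qed
  then have disj': "disjoint_family_on T I" for I
    unfolding disjoint_family_on_def by (metis Int_commute nat_neq_iff)
  have "real N * measure lebesgue G \<le> measure lebesgue B" for N
  proof -
    have "measure lebesgue (\<Union>n<N. T n) = (\<Sum>n<N. measure lebesgue (T n))"
      using fmeasurableD[OF T_meas(1)] fmeasurableD2[OF T_meas(1), folded infinity_ennreal_def] disj'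
      by (intro measure_finite_Union) blast+
    moreover have "measure lebesgue (\<Union>n<N. T n) \<le> measure lebesgue B"
      using T_sub T_meas by (intro measure_mono_fmeasurable) (auto simp: B_def fmeasurableD)
    ultimately show ?thesis using T_meas by simp
  qed
  then have "measure lebesgue G = 0"
    by (meson measure_nonneg antisym_conv2 not_less reals_Archimedean3)
  then show "negligible (F \<inter> cbox l u)"
    using mG by (simp add: negligible_iff_measure G_def)
qed

text \<open>Moving along \<open>b\<close> increases the \<open>b\<close>-coordinate of the nearest points, so a line parallel to
  \<open>b\<close> has at most one point with nearest points on both sides of a slab \<open>q1 < y \<bullet> b < q2\<close>.\<close>

lemma two_nearest_points:
  fixes C :: "'a::euclidean_space set"
  assumes C: "compact C"
  defines "A \<equiv> {x. \<exists>y\<in>C. \<exists>z\<in>C. y \<noteq> z \<and> dist x y = infdist x C \<and> dist x z = infdist x C}"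
  shows borel_two_nearest_points: "A \<in> sets borel"
    and negligible_two_nearest_points: "negligible A"
proof -
  \<comment> \<open>Two different points differ in some coordinate, and two rationals fit strictly
    between these coordinates. Basis vectors and pairs of rationals thus cover the set by countably
    many closed pieces.\<close>
  define F where "F b p =
      {x. \<exists>y\<in>C \<inter> {y. y \<bullet> b \<le> real_of_rat (fst p)}. dist x y = infdist x C} \<inter>
      {x. \<exists>y\<in>C \<inter> {y. real_of_rat (snd p) \<le> y \<bullet> b}. dist x y = infdist x C}" for b p
  have clF: "closed (F b p)" for b p
    unfolding F_def using C
    by (intro closed_Int closed_nearest_in compact_Int_closed)
      (auto intro!: closed_Collect_le continuous_intros)
  have negF: "negligible (F b p)" if "fst p < snd p" for b p
  proof (rule negligible_of_disjoint_translates[OF clF])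
    fix x t assume x: "x \<in> F b p" and t: "0 < (t::real)"
    show "x + t *\<^sub>R b \<notin> F b p"
    proof
      assume x': "x + t *\<^sub>R b \<in> F b p"
      obtain z where z: "z \<in> C" "real_of_rat (snd p) \<le> z \<bullet> b" "dist x z = infdist x C"
        using x unfolding F_def by blast
      obtain y where y: "y \<in> C" "y \<bullet> b \<le> real_of_rat (fst p)" "dist (x + t *\<^sub>R b) y = infdist (x + t *\<^sub>R b) C"
        using x' unfolding F_def by blast
      have "dist x z \<le> dist x y" "dist (x + t *\<^sub>R b) y \<le> dist (x + t *\<^sub>R b) z"
        using y z by (simp_all add: infdist_le)
      then have "(x - z) \<bullet> (x - z) \<le> (x - y) \<bullet> (x - y)"
        "(x + t *\<^sub>R b - y) \<bullet> (x + t *\<^sub>R b - y) \<le> (x + t *\<^sub>R b - z) \<bullet> (x + t *\<^sub>R b - z)"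
        by (simp_all add: dist_norm norm_le)
      \<comment> \<open>In the sum of the two inequalities all squares cancel.\<close>
      then have "t * (z \<bullet> b) \<le> t * (y \<bullet> b)"
        by (simp add: inner_diff_left inner_diff_right inner_add_left inner_add_right inner_commute algebra_simps)
      then have "z \<bullet> b \<le> y \<bullet> b" using t by simp
      moreover have "real_of_rat (fst p) < real_of_rat (snd p)" using that by (simp add: of_rat_less)
      ultimately show False using y z by linarith
    qed
  qed
  define I where "I = (Basis :: 'a set) \<times> {p :: rat \<times> rat. fst p < snd p}"
  have "A = (\<Union>(b, p)\<in>I. F b p)"
  proof (intro equalityI subsetI)
    fix x assume "x \<in> A"
    then obtain y z where yz: "y \<in> C" "z \<in> C" "y \<noteq> z" "dist x y = infdist x C" "dist x z = infdist x C"
      unfolding A_def by blast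
    then obtain b where b: "b \<in> Basis" "y \<bullet> b \<noteq> z \<bullet> b" by (metis euclidean_eqI)
    have *: "\<exists>p. (b, p) \<in> I \<and> x \<in> F b p" if yz: "y \<in> C" "z \<in> C" "dist x y = infdist x C" "dist x z = infdist x C"
      and less: "y \<bullet> b < z \<bullet> b" for y z
    proof -
      obtain q1 where q1: "y \<bullet> b < of_rat q1" "of_rat q1 < z \<bullet> b" using of_rat_dense[OF less] by blast
      obtain q2 where q2: "real_of_rat q1 < of_rat q2" "of_rat q2 < z \<bullet> b" using of_rat_dense[OF q1(2)] by blast
      have "(b, (q1, q2)) \<in> I \<and> x \<in> F b (q1, q2)"
        using yz q1 q2 b(1) unfolding I_def F_def by (auto simp: of_rat_less less_imp_le)
      then show ?thesis by blast
    qed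
    then show "x \<in> (\<Union>(b, p)\<in>I. F b p)"
      using yz b *[of y z] *[of z y] by (cases "y \<bullet> b < z \<bullet> b") (fastforce simp: not_less)+
  next
    fix x assume "x \<in> (\<Union>(b, p)\<in>I. F b p)"
    then obtain b p where bp: "(b, p) \<in> I" "x \<in> F b p" by blast
    then have "real_of_rat (fst p) < real_of_rat (snd p)" by (simp add: of_rat_less I_def)
    moreover obtain y z where yz: "y \<in> C" "z \<in> C" "y \<bullet> b \<le> real_of_rat (fst p)" "real_of_rat (snd p) \<le> z \<bullet> b"
      "dist x y = infdist x C" "dist x z = infdist x C"
      using bp(2) unfolding F_def by blast
    ultimately have "y \<noteq> z" by auto
    with yz show "x \<in> A" unfolding A_def by blast
  qed
  moreover have cI: "countable I" unfolding I_def by (intro countable_SIGMA countable_finite[OF finite_Basis]) auto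
  ultimately show "A \<in> sets borel" "negligible A"
    using clF negF
    by (auto intro!: sets.countable_UN' negligible_countable_Union simp: I_def case_prod_unfold)
qed

section \<open>Change of variables\<close>

text \<open>A map that only permutes coordinates pulls boxes back to boxes of the same volume. It
  lets the product of the line with \<open>real ^ 'n\<close> be exchanged for a single vector space
  without changing integrals.\<close>

lemma distr_lborel_reindex:
  fixes \<phi> :: "'a::euclidean_space \<Rightarrow> 'b::euclidean_space"
  assumes \<pi>: "bij_betw \<pi> Basis Basis" and \<phi>: "\<And>x b. b \<in> Basis \<Longrightarrow> \<phi> x \<bullet> b = x \<bullet> \<pi> b"
  shows "distr lborel borel \<phi> = lborel"
proof (rule lborel_eqI[symmetric])
  have meas: "\<phi> \<in> borel_measurable borel"
    by (rule borel_measurable_euclidean_space[THEN iffD2]) (simp add: \<phi>)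
  fix l u :: 'b assume lu: "\<And>b. b \<in> Basis \<Longrightarrow> l \<bullet> b \<le> u \<bullet> b"
  \<comment> \<open>\<open>J\<close> transports the corners: the preimage of the box from
    \<open>l\<close> to \<open>u\<close> is the box from \<open>J l\<close> to
    \<open>J u\<close>.\<close>
  define J where "J w = (\<Sum>c\<in>Basis. (w \<bullet> inv_into Basis \<pi> c) *\<^sub>R c)" for w :: 'b
  have J: "J w \<bullet> \<pi> b = w \<bullet> b" if "b \<in> Basis" for w b
  proof -
    have "J w \<bullet> \<pi> b = (\<Sum>c\<in>Basis. if c = \<pi> b then w \<bullet> inv_into Basis \<pi> c else 0)"
      unfolding J_def inner_sum_left using bij_betwE[OF \<pi>] that
      by (intro sum.cong) (auto simp: inner_Basis)
    also have "\<dots> = w \<bullet> b"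
      using bij_betwE[OF \<pi>] bij_betw_imp_inj_on[OF \<pi>] that by simp
    finally show ?thesis .
  qed
  have ball: "(\<forall>c\<in>Basis. P c) \<longleftrightarrow> (\<forall>b\<in>Basis. P (\<pi> b))" for P
  proof -
    have "(\<forall>c\<in>\<pi> ` Basis. P c) \<longleftrightarrow> (\<forall>b\<in>Basis. P (\<pi> b))" by blast
    then show ?thesis by (simp only: bij_betw_imp_surj_on[OF \<pi>])
  qed
  have "\<phi> -` box l u = box (J l) (J u)"
    by (simp only: set_eq_iff vimage_eq mem_box ball) (simp add: \<phi> J)
  moreover have "(\<Prod>c\<in>Basis. (J u - J l) \<bullet> c) = (\<Prod>b\<in>Basis. (u - l) \<bullet> b)"
    by (rule prod.reindex_bij_betw[OF \<pi>, symmetric, THEN trans]) (auto simp: J inner_diff_left intro: prod.cong)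
  moreover have "\<forall>c\<in>Basis. J l \<bullet> c \<le> J u \<bullet> c"
    using lu by (simp only: ball) (simp add: J)
  ultimately show "emeasure (distr lborel borel \<phi>) (box l u) = (\<Prod>b\<in>Basis. (u - l) \<bullet> b)"
    using meas by (simp add: emeasure_distr emeasure_lborel_box)
qed simp

text \<open>\<open>g\<close> acts between different spaces, so its Jacobian is read off after
  conjugation with the coordinate relabellings \<open>\<phi>\<close> and \<open>\<psi>\<close>,
  which make it a map of one vector space into itself.\<close>

lemma change_of_variables_reindexed:
  fixes g :: "'a::euclidean_space \<Rightarrow> 'b::euclidean_space" and f :: "'b \<Rightarrow> real"
    and \<phi> :: "real ^ 'm::{finite,wellorder} \<Rightarrow> 'a" and \<psi> :: "'b \<Rightarrow> real ^ 'm::{finite,wellorder}"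
  assumes \<phi>: "bounded_linear \<phi>" "distr lborel borel \<phi> = lborel" "\<And>y. \<phi>' (\<phi> y) = y" "\<And>x. \<phi> (\<phi>' x) = x"
    and \<psi>: "bounded_linear \<psi>" "distr lborel borel \<psi> = lborel" "\<And>y. \<psi>' (\<psi> y) = y" "\<And>x. \<psi> (\<psi>' x) = x"
      "\<psi>' \<in> borel_measurable borel"
    and S: "S \<in> sets borel" and gS: "g ` S \<in> sets borel"
    and der: "\<And>x. x \<in> S \<Longrightarrow> (g has_derivative g' x) (at x within S)"
    and inj: "inj_on g S"
    and J: "\<And>x. x \<in> S \<Longrightarrow> \<bar>det (matrix (\<psi> \<circ> g' x \<circ> \<phi>))\<bar> = J x"
    and f: "f \<in> borel_measurable borel" "integrable lborel (\<lambda>x. indicator (g ` S) x * f x)"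
    and meas: "(\<lambda>x. indicator S x * (J x * f (g x))) \<in> borel_measurable borel"
  shows "integrable lborel (\<lambda>x. indicator S x * (J x * f (g x)))" (is ?int)
    and "(\<integral>x. indicator S x * (J x * f (g x)) \<partial>lborel) = (\<integral>x. indicator (g ` S) x * f x \<partial>lborel)" (is ?eq)
proof -
  define S' where "S' = \<phi> -` S"
  define h where "h = \<psi> \<circ> g \<circ> \<phi>"
  \<comment> \<open>The underlying change of variables is for vector-valued functions, so
    \<open>f\<close> is wrapped into a one-dimensional vector.\<close>
  define F where "F y = (vec (f (\<psi>' y)) :: real^1)" for y
  have bl: "bounded_linear \<phi>" "bounded_linear \<psi>" by fact+
  have [measurable]: "\<phi> \<in> borel_measurable borel" "\<psi> \<in> borel_measurable borel" "\<psi>' \<in> borel_measurable borel"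
    using \<psi>(5) bl by (auto intro!: borel_measurable_continuous_onI linear_continuous_on)
  have S'm: "S' \<in> sets borel" unfolding S'_def using S by (metis \<open>\<phi> \<in> borel_measurable borel\<close> measurable_sets_borel)
  have hS': "h ` S' = \<psi>' -` (g ` S)"
  proof -
    have "\<phi> ` S' = S" unfolding S'_def using \<phi>(4) by (intro surj_image_vimage_eq surjI)
    moreover have "\<psi> ` Y = \<psi>' -` Y" for Y
      by (rule set_eqI) (metis \<psi>(3,4) image_iff vimage_eq)
    ultimately show ?thesis unfolding h_def by (simp only: image_comp[symmetric])
  qed
  have hS'm: "h ` S' \<in> sets borel" unfolding hS' using gS by (metis \<open>\<psi>' \<in> borel_measurable borel\<close> measurable_sets_borel)
  have injh: "inj_on h S'"
    using inj \<phi>(3) \<psi>(3) unfolding h_def S'_def inj_on_def by (metis comp_apply vimageE)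
  have derh: "(h has_derivative (\<psi> \<circ> g' (\<phi> y) \<circ> \<phi>)) (at y within S')" if "y \<in> S'" for y
  proof -
    have "(\<phi> has_derivative \<phi>) (at y within S')" using bl(1) by (rule bounded_linear_imp_has_derivative)
    moreover have "(g has_derivative g' (\<phi> y)) (at (\<phi> y) within (\<phi> ` S'))"
      using that by (intro has_derivative_subset[OF der]) (auto simp: S'_def)
    ultimately have "(g \<circ> \<phi> has_derivative g' (\<phi> y) \<circ> \<phi>) (at y within S')"
      by (rule diff_chain_within)
    from bounded_linear.has_derivative[OF bl(2) this] show ?thesis
      by (simp add: h_def o_def)
  qed
  have cov: "(\<lambda>y. \<bar>det (matrix (\<psi> \<circ> g' (\<phi> y) \<circ> \<phi>))\<bar> *\<^sub>R F (h y)) absolutely_integrable_on S' \<and>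
      integral S' (\<lambda>y. \<bar>det (matrix (\<psi> \<circ> g' (\<phi> y) \<circ> \<phi>))\<bar> *\<^sub>R F (h y)) = b
    \<longleftrightarrow> F absolutely_integrable_on (h ` S') \<and> integral (h ` S') F = b" for b
    using S'm by (intro has_absolute_integral_change_of_variables derh injh) simp_all
  have lhs: "\<bar>det (matrix (\<psi> \<circ> g' (\<phi> y) \<circ> \<phi>))\<bar> *\<^sub>R F (h y) = vec (J (\<phi> y) * f (g (\<phi> y)))" if "y \<in> S'" for y
  proof -
    have "F (h y) = vec (f (g (\<phi> y)))" by (simp add: F_def h_def \<psi>(3))
    moreover have "\<bar>det (matrix (\<psi> \<circ> g' (\<phi> y) \<circ> \<phi>))\<bar> = J (\<phi> y)"
      using that by (intro J) (simp add: S'_def)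
    ultimately show ?thesis by (simp only: vec_eq_iff vector_scaleR_component vec_component real_scaleR_def simp_thms)
  qed
  \<comment> \<open>Passage from gauge integrals and the completed measure to integrals over
    \<open>lborel\<close>; Borel measurability of the integrand is what makes them agree.\<close>
  have ai: "k absolutely_integrable_on X \<and> integral X k = c \<longleftrightarrow>
      integrable lborel (\<lambda>y. indicator X y * k y) \<and> (\<integral>y. indicator X y * k y \<partial>lborel) = c"
    if "(\<lambda>y. indicator X y * k y) \<in> borel_measurable borel" "X \<in> sets borel" for k :: "(real, 'm) vec \<Rightarrow> real" and X c
  proof -
    have "k absolutely_integrable_on X \<longleftrightarrow> integrable lborel (\<lambda>y. indicator X y * k y)"
      using that by (simp add: set_integrable_def integrable_completion)
    moreover have "integral X k = (\<integral>y. indicator X y * k y \<partial>lborel)" if "k absolutely_integrable_on X"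
      using set_lebesgue_integral_eq_integral(2)[OF that] \<open>(\<lambda>y. indicator X y * k y) \<in> borel_measurable borel\<close>
      by (simp add: set_lebesgue_integral_def integral_completion)
    ultimately show ?thesis by (cases "k absolutely_integrable_on X") simp_all
  qed
  have vec1: "(\<lambda>y. vec (k y) :: real^1) absolutely_integrable_on X \<and> integral X (\<lambda>y. vec (k y) :: real^1) = vec c \<longleftrightarrow>
     k absolutely_integrable_on X \<and> integral X k = c" for k :: "(real, 'm) vec \<Rightarrow> real" and X c
    unfolding absolutely_integrable_on_1_iff integral_on_1_eq absolutely_integrable_on_def integrable_on_1_iff
    by (auto simp: vec_eq_iff)
  have 1: "(\<lambda>y. \<bar>det (matrix (\<psi> \<circ> g' (\<phi> y) \<circ> \<phi>))\<bar> *\<^sub>R F (h y)) absolutely_integrable_on S' \<and>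
      integral S' (\<lambda>y. \<bar>det (matrix (\<psi> \<circ> g' (\<phi> y) \<circ> \<phi>))\<bar> *\<^sub>R F (h y)) = vec c \<longleftrightarrow>
    integrable lborel (\<lambda>y. indicator S' y * (J (\<phi> y) * f (g (\<phi> y)))) \<and>
      (\<integral>y. indicator S' y * (J (\<phi> y) * f (g (\<phi> y))) \<partial>lborel) = c" for c
  proof -
    have "(\<lambda>y. \<bar>det (matrix (\<psi> \<circ> g' (\<phi> y) \<circ> \<phi>))\<bar> *\<^sub>R F (h y)) absolutely_integrable_on S' \<longleftrightarrow>
      (\<lambda>y. vec (J (\<phi> y) * f (g (\<phi> y))) :: real^1) absolutely_integrable_on S'"
      by (rule set_integrable_cong) (auto simp: lhs)
    moreover have "integral S' (\<lambda>y. \<bar>det (matrix (\<psi> \<circ> g' (\<phi> y) \<circ> \<phi>))\<bar> *\<^sub>R F (h y)) =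
        integral S' (\<lambda>y. vec (J (\<phi> y) * f (g (\<phi> y))))"
      by (rule Henstock_Kurzweil_Integration.integral_cong) (simp add: lhs)
    moreover have "(\<lambda>y. indicator S' y * (J (\<phi> y) * f (g (\<phi> y)))) \<in> borel_measurable borel"
      using measurable_compose[OF \<open>\<phi> \<in> borel_measurable borel\<close> meas] unfolding S'_def indicator_vimage by simp
    ultimately show ?thesis using vec1 ai[OF _ S'm] by (simp only:)
  qed
  have "(\<lambda>y. indicator (h ` S') y * f (\<psi>' y)) \<in> borel_measurable borel"
    using f(1) hS'm by measurable
  then have 2: "F absolutely_integrable_on (h ` S') \<and> integral (h ` S') F = vec c \<longleftrightarrow>
    integrable lborel (\<lambda>y. indicator (h ` S') y * f (\<psi>' y)) \<and>
      (\<integral>y. indicator (h ` S') y * f (\<psi>' y) \<partial>lborel) = c" for c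
    unfolding F_def vec1 by (rule ai[OF _ hS'm])
  have "(\<lambda>x. indicator (g ` S) x * f x) = (\<lambda>x. indicator (h ` S') (\<psi> x) * f (\<psi>' (\<psi> x)))"
    unfolding hS' by (simp add: indicator_def \<psi>)
  moreover have im: "(\<lambda>y. indicator (h ` S') y * f (\<psi>' y)) \<in> borel_measurable borel"
    using f(1) hS'm by measurable
  ultimately have i2: "integrable lborel (\<lambda>y. indicator (h ` S') y * f (\<psi>' y))"
    "(\<integral>y. indicator (h ` S') y * f (\<psi>' y) \<partial>lborel) = (\<integral>x. indicator (g ` S) x * f x \<partial>lborel)"
    using f(2) integrable_distr_eq[OF _ im, of \<psi> lborel] integral_distr[OF _ im, of \<psi> lborel] \<psi>(2) by simp_all
  have i1: "integrable lborel (\<lambda>y. indicator S' y * (J (\<phi> y) * f (g (\<phi> y))))"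
      "(\<integral>y. indicator S' y * (J (\<phi> y) * f (g (\<phi> y))) \<partial>lborel) = (\<integral>x. indicator (g ` S) x * f x \<partial>lborel)"
    using i2 1 2 cov by blast+
  have "(\<lambda>y. indicator S' y * (J (\<phi> y) * f (g (\<phi> y)))) = (\<lambda>y. (\<lambda>x. indicator S x * (J x * f (g x))) (\<phi> y))"
    unfolding S'_def by (simp add: indicator_def)
  then show ?int ?eq
    using i1 integrable_distr_eq[OF _ meas, of \<phi> lborel] integral_distr[OF _ meas, of \<phi> lborel] \<phi>(2) by simp_all
qed


text \<open>The library states the change of variables for index types with a well-order, so a finite
  index type is equipped with an arbitrary one.\<close>

typedef 'a widx = "UNIV :: 'a set" by simp

instance widx :: (finite) finite
proof
  have "(UNIV :: 'a widx set) = range Abs_widx"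
    by (metis Rep_widx_inverse UNIV_eq_I rangeI)
  moreover have "finite (range (Abs_widx :: 'a \<Rightarrow> 'a widx))"
    by (intro finite_imageI finite)
  ultimately show "finite (UNIV :: 'a widx set)" by (rule ssubst)
qed

instantiation widx :: (finite) wellorder
begin

definition less_eq_widx :: "'a widx \<Rightarrow> 'a widx \<Rightarrow> bool" where
  "x \<le> y \<longleftrightarrow> to_nat_on UNIV (Rep_widx x) \<le> to_nat_on UNIV (Rep_widx y)"

definition less_widx :: "'a widx \<Rightarrow> 'a widx \<Rightarrow> bool" where
  "x < y \<longleftrightarrow> to_nat_on UNIV (Rep_widx x) < to_nat_on UNIV (Rep_widx y)"

instance
proof
  fix x y :: "'a widx"
  have inj: "inj_on (to_nat_on (UNIV :: 'a set)) UNIV"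
    by (intro inj_on_to_nat_on countable_finite) simp
  show "x \<le> y \<Longrightarrow> y \<le> x \<Longrightarrow> x = y"
    unfolding less_eq_widx_def using injD[OF inj] by (metis Rep_widx_inject antisym)
next
  fix P :: "'a widx \<Rightarrow> bool" and a :: "'a widx"
  assume "\<And>x. (\<And>y. y < x \<Longrightarrow> P y) \<Longrightarrow> P x"
  then show "P a"
    unfolding less_widx_def
    by (rule measure_induct_rule[where f = "\<lambda>x. to_nat_on UNIV (Rep_widx x)"])
qed (auto simp: less_eq_widx_def less_widx_def)

end

lemma sum_widx: "(\<Sum>i\<in>UNIV. f (Rep_widx i)) = sum f (UNIV :: 'a::finite set)"
  by (rule sum.reindex_bij_witness[of _ Abs_widx Rep_widx])
    (auto simp: Rep_widx_inverse Abs_widx_inverse)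


text \<open>The derivative has the orthonormal columns \<open>N i s\<close> and the column
  \<open>W = T s + (\<Sum>i\<in>UNIV. (u $ i) *\<^sub>R N' i s)\<close>. The normal components of
  \<open>W\<close> do not affect the determinant, so up to sign it is
  \<open>T s \<bullet> W\<close>.\<close>

lemma change_of_variables_frame:
  fixes c :: "real \<Rightarrow> real ^ ('n::finite option)" and N :: "'n \<Rightarrow> real \<Rightarrow> real ^ ('n option)"
    and f :: "real ^ ('n option) \<Rightarrow> real"
  defines "g \<equiv> \<lambda>(s, u). c s + (\<Sum>i\<in>UNIV. (u $ i) *\<^sub>R N i s)"
  assumes S: "open S" and gS: "g ` S \<in> sets borel" and inj: "inj_on g S"
    and c: "\<And>s u. (s, u) \<in> S \<Longrightarrow> (c has_vector_derivative T s) (at s)"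
    and N: "\<And>s u i. (s, u) \<in> S \<Longrightarrow> (N i has_vector_derivative N' i s) (at s)"
    and TT: "\<And>s u. (s, u) \<in> S \<Longrightarrow> T s \<bullet> T s = 1"
    and TN: "\<And>s u i. (s, u) \<in> S \<Longrightarrow> T s \<bullet> N i s = 0"
    and NN: "\<And>s u i j. (s, u) \<in> S \<Longrightarrow> N i s \<bullet> N j s = (if i = j then 1 else 0)"
    and J: "\<And>s u. (s, u) \<in> S \<Longrightarrow> J (s, u) = 1 + (\<Sum>i\<in>UNIV. u $ i * (T s \<bullet> N' i s))"
    and J_nonneg: "\<And>y. y \<in> S \<Longrightarrow> 0 \<le> J y"
    and f: "f \<in> borel_measurable borel" "integrable lborel (\<lambda>x. indicator (g ` S) x * f x)"
    and meas: "(\<lambda>y. indicator S y * (J y * f (g y))) \<in> borel_measurable borel"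
  shows "integrable lborel (\<lambda>y. indicator S y * (J y * f (g y)))"
    and "(\<integral>y. indicator S y * (J y * f (g y)) \<partial>lborel) = (\<integral>x. indicator (g ` S) x * f x \<partial>lborel)"
proof -
  define n0 :: "'n option widx" where "n0 = Abs_widx None"
  define e :: "'n \<Rightarrow> 'n option widx" where "e k = Abs_widx (Some k)" for k
  note widx = Abs_widx_inverse[OF UNIV_I] Rep_widx_inverse
  define \<phi> where "\<phi> y = (y $ n0, \<chi> k. y $ e k)" for y :: "real ^ 'n option widx"
  define \<phi>' where "\<phi>' p = (\<chi> i. case Rep_widx i of None \<Rightarrow> fst p | Some k \<Rightarrow> snd p $ k)"
    for p :: "real \<times> (real, 'n) vec"
  define \<psi> where "\<psi> x = (\<chi> i. x $ Rep_widx i)" for x :: "real ^ 'n option"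
  define \<psi>' where "\<psi>' y = (\<chi> k. y $ Abs_widx k)" for y :: "real ^ 'n option widx"
  define g' where "g' p = (\<lambda>(h, k). h *\<^sub>R (T (fst p) + (\<Sum>i\<in>UNIV. (snd p $ i) *\<^sub>R N' i (fst p)))
      + (\<Sum>i\<in>UNIV. (k $ i) *\<^sub>R N i (fst p)))" for p :: "real \<times> (real, 'n) vec"
  have e: "e k = e k' \<longleftrightarrow> k = k'" "e k \<noteq> n0" "n0 \<noteq> e k" for k k'
    unfolding e_def n0_def by (metis widx(1) option.inject option.distinct(1))+
  have cases_widx: "i = n0 \<or> (\<exists>k. i = e k)" for i
    unfolding e_def n0_def by (metis widx(2) not_Some_eq)
  have "bounded_linear \<phi>" "bounded_linear \<psi>" "bounded_linear \<psi>'"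
    unfolding \<phi>_def \<psi>_def \<psi>'_def
    by (auto simp: linear_conv_bounded_linear[symmetric] linear_iff vec_eq_iff)
  have \<phi>\<phi>': "\<phi>' (\<phi> y) = y" "\<phi> (\<phi>' x) = x" for x y
  proof -
    show "\<phi>' (\<phi> y) = y"
      unfolding \<phi>_def \<phi>'_def vec_eq_iff
      using cases_widx by (auto simp: n0_def e_def widx split: option.split) (metis widx(2))+
    show "\<phi> (\<phi>' x) = x"
      unfolding \<phi>_def \<phi>'_def by (cases x) (simp add: vec_eq_iff n0_def e_def widx)
  qed
  have \<psi>\<psi>': "\<psi>' (\<psi> y) = y" "\<psi> (\<psi>' x) = x" for x y
    unfolding \<psi>_def \<psi>'_def by (simp_all add: vec_eq_iff widx)
  have d\<phi>: "distr lborel borel \<phi> = lborel"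
  proof (rule distr_lborel_reindex)
    \<comment> \<open>The matching of basis vectors: the curve direction \<open>(1, 0)\<close>,
      recognized by its first component, goes to the index \<open>n0\<close>, the
      \<open>k\<close>-th normal direction to \<open>e k\<close>.\<close>
    define \<pi> where "\<pi> b = (if fst b = 1 then axis n0 1 else \<Sum>k\<in>UNIV. (snd b $ k) *\<^sub>R axis (e k) 1 :: real ^ 'n option widx)"
      for b :: "real \<times> (real, 'n) vec"
    have \<pi>: "\<pi> (1, 0) = axis n0 1" "\<pi> (0, axis k 1) = axis (e k) 1" for k
      by (simp_all add: \<pi>_def axis_def[of k] if_distrib[of "\<lambda>c. c *\<^sub>R _"] cong: if_cong)
    have B: "(Basis :: (real \<times> (real, 'n) vec) set) = insert (1, 0) (range (\<lambda>k. (0, axis k 1)))"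
      unfolding Basis_prod_def by (auto simp: Basis_vec_def)
    have B': "(Basis :: (real ^ 'n option widx) set) = insert (axis n0 1) (range (\<lambda>k. axis (e k) 1))"
    proof -
      have "(Basis :: (real ^ 'n option widx) set) = (\<lambda>i. axis i 1) ` UNIV"
        by (auto simp: Basis_vec_def)
      also have "(UNIV :: 'n option widx set) = insert n0 (range e)"
        using cases_widx by blast
      finally show ?thesis by (simp only: image_insert image_image)
    qed
    have "inj_on \<pi> Basis"
      unfolding B inj_on_def by (auto simp: \<pi> axis_eq_axis e)
    moreover have "\<pi> ` Basis = Basis"
      unfolding B B' by (simp add: image_image \<pi>)
    ultimately show "bij_betw \<pi> Basis Basis" by (rule bij_betw_imageI)
    show "\<phi> x \<bullet> b = x \<bullet> \<pi> b" if "b \<in> Basis" for x b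
      using that unfolding B by (auto simp: \<pi> \<phi>_def inner_axis)
  qed
  have d\<psi>: "distr lborel borel \<psi> = lborel"
  proof (rule distr_lborel_reindex)
    have \<psi>'_axis: "\<psi>' (axis i 1) = axis (Rep_widx i) 1" for i
      unfolding \<psi>'_def by (auto simp: vec_eq_iff axis_def widx)
    show "bij_betw \<psi>' Basis Basis"
    proof (rule bij_betw_byWitness[where f' = \<psi>])
      have "\<psi> (axis k 1) = axis (Abs_widx k) 1" for k
        unfolding \<psi>_def by (auto simp: vec_eq_iff axis_def widx)
      then show "\<psi> ` Basis \<subseteq> Basis" by (auto simp: Basis_vec_def)
      show "\<psi>' ` Basis \<subseteq> Basis" by (auto simp: Basis_vec_def \<psi>'_axis)
    qed (simp_all add: \<psi>\<psi>')
    show "\<psi> x \<bullet> b = x \<bullet> \<psi>' b" if "b \<in> Basis" for x b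
      using that by (auto simp: Basis_vec_def \<psi>'_axis inner_axis) (simp add: \<psi>_def)
  qed
  have der: "(g has_derivative g' p) (at p within S)" if p: "p \<in> S" for p
  proof -
    obtain s u where su: "p = (s, u)" by (cases p)
    have fst: "(fst has_derivative fst) (at p within S)" and snd: "((\<lambda>q. snd q $ i) has_derivative (\<lambda>q. snd q $ i)) (at p within S)" for i
      by (auto intro!: derivative_eq_intros bounded_linear.has_derivative[OF bounded_linear_vec_nth])
    have c': "((\<lambda>q. c (fst q)) has_derivative (\<lambda>q. fst q *\<^sub>R T s)) (at p within S)"
      using has_derivative_compose[OF fst, of c "\<lambda>h. h *\<^sub>R T s"] c[of s u] p su
      by (simp add: has_vector_derivative_def)
    have N': "((\<lambda>q. N i (fst q)) has_derivative (\<lambda>q. fst q *\<^sub>R N' i s)) (at p within S)" for i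
      using has_derivative_compose[OF fst, of "N i" "\<lambda>h. h *\<^sub>R N' i s"] N[of s u i] p su
      by (simp add: has_vector_derivative_def)
    have "((\<lambda>q. c (fst q) + (\<Sum>i\<in>UNIV. (snd q $ i) *\<^sub>R N i (fst q))) has_derivative
        (\<lambda>q. fst q *\<^sub>R T s + (\<Sum>i\<in>UNIV. (snd p $ i) *\<^sub>R (fst q *\<^sub>R N' i s) + (snd q $ i) *\<^sub>R N i (fst p)))) (at p within S)"
      by (intro has_derivative_add has_derivative_sum has_derivative_scaleR c' N' snd)
    moreover have "(\<lambda>q. fst q *\<^sub>R T s + (\<Sum>i\<in>UNIV. (snd p $ i) *\<^sub>R (fst q *\<^sub>R N' i s) + (snd q $ i) *\<^sub>R N i (fst p))) = g' p"
      by (auto simp: g'_def su fun_eq_iff scaleR_right.sum sum.distrib scaleR_add_right mult.commute)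
    ultimately show ?thesis unfolding g_def by (simp add: case_prod_unfold)
  qed
  have det: "\<bar>det (matrix (\<psi> \<circ> g' p \<circ> \<phi>))\<bar> = J p" if p: "p \<in> S" for p
  proof -
    obtain s u where su: "p = (s, u)" by (cases p)
    have pS: "(s, u) \<in> S" using p su by simp
    define F where "F k = (case k of None \<Rightarrow> T s | Some k \<Rightarrow> N k s)" for k
    define A where "A = (\<chi> i j. F (Rep_widx j) $ Rep_widx i)"
    define W where "W = T s + (\<Sum>i\<in>UNIV. (u $ i) *\<^sub>R N' i s)"
    have "(transpose A ** A) $ i $ j = (mat 1 :: real ^ 'n option widx ^ 'n option widx) $ i $ j" for i j
    proof -
      have "(transpose A ** A) $ i $ j = F (Rep_widx i) \<bullet> F (Rep_widx j)"
        by (simp add: matrix_matrix_mult_def transpose_def A_def inner_vec_def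
            sum_widx[of "\<lambda>k. F (Rep_widx i) $ k * F (Rep_widx j) $ k"])
      also have "\<dots> = (if Rep_widx i = Rep_widx j then 1 else 0)"
        using TT[OF pS] TN[OF pS] NN[OF pS]
        by (auto simp: F_def inner_commute split: option.split)
      finally show ?thesis by (simp add: mat_def Rep_widx_inject)
    qed
    then have orth: "orthogonal_matrix A" by (simp add: orthogonal_matrix vec_eq_iff)
    \<comment> \<open>The coordinates of \<open>W\<close> in the frame. The Jacobian matrix is
      \<open>A\<close> with column \<open>n0\<close> replaced by \<open>A *v x\<close>, so Cramer's
      rule gives its determinant as \<open>x $ n0 * det A\<close>.\<close>
    define x where "x = transpose A *v \<psi> W"
    have Ax: "A *v x = \<psi> W"
      using orth unfolding x_def orthogonal_matrix_def by (simp only: matrix_vector_mul_assoc matrix_vector_mul_lid)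
    have "matrix (\<psi> \<circ> g' p \<circ> \<phi>) = (\<chi> i j. if j = n0 then (A *v x) $ i else A $ i $ j)"
    proof -
      have 1: "g' p (\<phi> (axis n0 1)) = W"
        by (simp add: \<phi>_def g'_def W_def su axis_def e)
      have 2: "g' p (\<phi> (axis (e k) 1)) = N k s" for k
        by (simp add: \<phi>_def g'_def su axis_def e if_distrib[of "\<lambda>c. c *\<^sub>R _"] cong: if_cong)
      have "(\<psi> \<circ> g' p \<circ> \<phi>) (axis j 1) $ i = (if j = n0 then (A *v x) $ i else A $ i $ j)" for i j
      proof -
        have "A $ i $ e k = N k s $ Rep_widx i" for k
          by (simp add: A_def F_def e_def widx)
        then show ?thesis using cases_widx[of j] by (auto simp: 1 2 e Ax \<psi>_def)
      qed
      then show ?thesis by (simp add: matrix_def vec_eq_iff)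
    qed
    then have "det (matrix (\<psi> \<circ> g' p \<circ> \<phi>)) = x $ n0 * det A"
      by (simp only: cramer_lemma)
    moreover have "x $ n0 = J p"
    proof -
      have "x $ n0 = (\<Sum>i\<in>UNIV. T s $ Rep_widx i * W $ Rep_widx i)"
        by (simp add: x_def matrix_vector_mult_def transpose_def A_def \<psi>_def F_def n0_def widx
            del: transpose_matrix_vector)
      also have "\<dots> = T s \<bullet> W" by (simp add: sum_widx[of "\<lambda>i. T s $ i * W $ i"] inner_vec_def)
      also have "\<dots> = J p"
        using TT[OF pS] J[OF pS] by (simp add: W_def su inner_add_right inner_sum_right)
      finally show ?thesis .
    qed
    moreover have "\<bar>det A\<bar> = 1" using det_orthogonal_matrix[OF orth] by auto
    ultimately show ?thesis using J_nonneg[OF p] by (simp add: abs_mult)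
  qed
  have m\<psi>': "\<psi>' \<in> borel_measurable borel"
    using \<open>bounded_linear \<psi>'\<close> by (intro borel_measurable_continuous_onI linear_continuous_on)
  have Sb: "S \<in> sets borel" using S by simp
  note cov = change_of_variables_reindexed[OF \<open>bounded_linear \<phi>\<close> d\<phi> \<phi>\<phi>' \<open>bounded_linear \<psi>\<close> d\<psi> \<psi>\<psi>' m\<psi>'
      Sb gS der inj det f meas]
  show "integrable lborel (\<lambda>y. indicator S y * (J y * f (g y)))"
    "(\<integral>y. indicator S y * (J y * f (g y)) \<partial>lborel) = (\<integral>x. indicator (g ` S) x * f x \<partial>lborel)"
    using cov by blast+
qed

section \<open>Curves with a normal frame\<close>

lemma continuous_on_Ck_on:
  assumes "Ck_on k S f"
  shows "continuous_on S f"
proof (cases k)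
  case (Suc j)
  then show ?thesis using assms
    by (auto simp: continuous_on_eq_continuous_within intro: has_derivative_continuous)
qed (use assms in simp)

text \<open>The first-order inequality is available only at points of \<open>S\<close>, and no
  segment from \<open>x0\<close> need lie in \<open>S\<close>. Its bound
  \<open>f' (x - x0) + e * norm (x - x0)\<close> is continuous in \<open>x\<close>, hence
  nonnegative on the closure of \<open>S\<close> near \<open>x0\<close>, which contains a ball.
  Constant functions are an admissible case, so identities on \<open>S\<close> can be
  differentiated.\<close>

lemma has_derivative_local_min_dense:
  fixes f :: "'a::real_normed_vector \<Rightarrow> real"
  assumes f: "(f has_derivative f') (at x0 within S)"
    and dense: "x0 \<in> interior (closure S)"
    and min: "\<And>x. x \<in> S \<Longrightarrow> f x0 \<le> f x"
  shows "f' h = 0"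
proof -
  have lin: "bounded_linear f'" using f by (rule has_derivative_bounded_linear)
  have nonneg: "0 \<le> f' h" for h
  proof (rule ccontr)
    assume neg: "\<not> 0 \<le> f' h"
    then have "h \<noteq> 0" using linear_0[OF bounded_linear.linear[OF lin]] by auto
    \<comment> \<open>Chosen so that \<open>f' h + e * norm h\<close> is half of \<open>f' h\<close>
      and therefore still negative.\<close>
    define e where "e = - f' h / (2 * norm h)"
    have e: "e > 0" using neg \<open>h \<noteq> 0\<close> by (simp add: e_def divide_neg_pos)
    obtain d where d: "d > 0" "\<And>x. x \<in> S \<Longrightarrow> norm (x - x0) < d \<Longrightarrow>
        norm (f x - f x0 - f' (x - x0)) \<le> e * norm (x - x0)"
      using f e unfolding has_derivative_within_alt by blast
    define P where "P = {x. 0 \<le> f' (x - x0) + e * norm (x - x0)}"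
    have "closed P"
      unfolding P_def by (intro closed_Collect_le continuous_intros
        bounded_linear.continuous_on[OF lin])
    moreover have "ball x0 d \<inter> S \<subseteq> P"
    proof
      fix x assume "x \<in> ball x0 d \<inter> S"
      then have "\<bar>f x - f x0 - f' (x - x0)\<bar> \<le> e * norm (x - x0)" "f x0 \<le> f x"
        using d(2)[of x] min[of x] by (auto simp: dist_norm norm_minus_commute)
      then show "x \<in> P" unfolding P_def by (simp add: abs_le_iff)
    qed
    ultimately have "closure (ball x0 d \<inter> S) \<subseteq> P" by (simp add: closure_minimal)
    then have P: "ball x0 d \<inter> closure S \<subseteq> P"
      using open_Int_closure_subset[of "ball x0 d" S] by auto
    obtain r where r: "r > 0" "ball x0 r \<subseteq> closure S"
      using dense by (meson interior_subset open_contains_ball open_interior order_trans)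
    \<comment> \<open>Gives the displacement \<open>t *\<^sub>R h\<close> half the length of the
      smaller radius, so it stays in both balls.\<close>
    define t where "t = min d r / (2 * norm h)"
    have t: "t > 0" using d(1) r(1) \<open>h \<noteq> 0\<close> by (simp add: t_def)
    have "norm (t *\<^sub>R h) = min d r / 2" using \<open>h \<noteq> 0\<close> d(1) r(1) by (simp add: t_def)
    then have "norm (t *\<^sub>R h) < d" "norm (t *\<^sub>R h) < r" using d(1) r(1) by linarith+
    then have "x0 + t *\<^sub>R h \<in> ball x0 d \<inter> ball x0 r" by (simp add: dist_norm)
    then have "x0 + t *\<^sub>R h \<in> P" using P r by blast
    then have "0 \<le> t * (f' h + e * norm h)"
      using t linear_cmul[OF bounded_linear.linear[OF lin], of t h] unfolding P_def by (simp add: algebra_simps)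
    then have "0 \<le> f' h + e * norm h" using t by (simp add: zero_le_mult_iff)
    then show False using neg \<open>h \<noteq> 0\<close> by (simp add: e_def)
  qed
  have "0 \<le> f' (- h)" by (rule nonneg)
  then show ?thesis using nonneg[of h] linear_neg[OF bounded_linear.linear[OF lin], of h] by simp
qed

text \<open>A nonempty open set is not negligible, so removing \<open>A\<close> cannot leave a hole
  in the interior.\<close>

lemma interior_subset_closure_Diff_negligible:
  fixes K A :: "'a::euclidean_space set"
  assumes "negligible A"
  shows "interior K \<subseteq> interior (closure (K - A))"
proof (rule interior_maximal)
  show "interior K \<subseteq> closure (K - A)"
  proof
    fix x assume x: "x \<in> interior K"
    show "x \<in> closure (K - A)"
    proof (rule ccontr)
      assume "x \<notin> closure (K - A)"
      define U where "U = interior K - closure (K - A)"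
      have "open U" "x \<in> U" using x \<open>x \<notin> _\<close> by (auto simp: U_def)
      moreover have "U \<subseteq> A" using interior_subset[of K] closure_subset[of "K - A"] unfolding U_def by blast
      ultimately show False
        using assms open_not_negligible negligible_subset by blast
    qed
  qed
qed simp

section \<open>The frame and the curvature along the curve\<close>

locale framed_curve_density =
  fixes p :: "real ^ ('n::{finite,linorder} option) \<Rightarrow> real"
    and K :: "(real ^ ('n option)) set"
    and \<Gamma> :: "real \<Rightarrow> real ^ ('n option)"
    and L :: real
    and \<zeta> :: "real \<Rightarrow> (real, 'n) vec"
  assumes p_nonneg: "\<And>x. 0 \<le> p x"
    and p_smooth: "smooth_on UNIV p"
    and p_support: "closure {x. p x \<noteq> 0} = K"
    and K_region: "compact_region K"
    and curve: "smooth_arclength_curve \<Gamma> L"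
    and curve_in: "\<Gamma> ` {0..L} \<subseteq> K"
    and diffeo: "normal_map_diffeo_on \<Gamma> L \<zeta> ((proj_index \<Gamma> L -` {0..L} \<inter> K) - ambiguity_set \<Gamma> L)"
    and \<zeta>_smooth: "smooth_on {0..L} \<zeta>"
    and \<zeta>_frame: "\<And>s. s \<in> {0..L} \<Longrightarrow> frame_angles (\<zeta> s)"
    and \<Gamma>_deriv: "\<And>s. s \<in> {0..L} \<Longrightarrow> (\<Gamma> has_vector_derivative sph (\<zeta> s)) (at s within {0..L})"
begin

abbreviation "T s \<equiv> sph (\<zeta> s)"
abbreviation "N i s \<equiv> sph_normal i (\<zeta> s)"
abbreviation "\<nu> \<equiv> normal_map \<Gamma> \<zeta>"
abbreviation "ix \<equiv> proj_index \<Gamma> L"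
abbreviation "amb \<equiv> ambiguity_set \<Gamma> L"

definition "\<zeta>' s = vector_derivative \<zeta> (at s within {0..L})"
text \<open>The vector \<open>D \<zeta>'\<close> of the differential equation. By the chain rule it
  holds the coordinates of the second derivative of \<Gamma> in the normal frame, which is why it
  also governs the Jacobian.\<close>

definition curvature :: "real \<Rightarrow> (real, 'n) vec" where
  "curvature s = (\<chi> i. norm (sph_partial i (\<zeta> s)) * \<zeta>' s $ i)"
definition "T' s = (\<Sum>i\<in>UNIV. curvature s $ i *\<^sub>R N i s)"
definition jac :: "real \<times> (real, 'n) vec \<Rightarrow> real" where "jac = (\<lambda>(s, u). 1 - u \<bullet> curvature s)"

lemma L_pos: "0 < L" and inj_\<Gamma>: "inj_on \<Gamma> {0..L}"
  using curve unfolding smooth_arclength_curve_def by auto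

lemma continuous_\<Gamma>: "continuous_on {0..L} \<Gamma>"
  unfolding continuous_on_eq_continuous_within
  by (blast intro: has_vector_derivative_continuous \<Gamma>_deriv)

lemma compact_trace: "compact (\<Gamma> ` {0..L})" and trace_nonempty: "\<Gamma> ` {0..L} \<noteq> {}"
  using continuous_\<Gamma> L_pos by (auto intro: compact_continuous_image)

lemma \<zeta>_deriv: "s \<in> {0..L} \<Longrightarrow> (\<zeta> has_vector_derivative \<zeta>' s) (at s within {0..L})"
  and continuous_\<zeta>': "continuous_on {0..L} \<zeta>'"
proof -
  have "Ck_on (Suc 0) {0..L} \<zeta>" using \<zeta>_smooth unfolding smooth_on_def by blast
  then obtain f' where "\<forall>x\<in>{0..L}. (\<zeta> has_derivative f' x) (at x within {0..L})"
    "\<forall>v. continuous_on {0..L} (\<lambda>x. f' x v)" unfolding Ck_on.simps by blast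
  then have f': "\<And>x. x \<in> {0..L} \<Longrightarrow> (\<zeta> has_derivative f' x) (at x within {0..L})"
    "\<And>v. continuous_on {0..L} (\<lambda>x. f' x v)" by (blast, blast)
  have D: "(\<zeta> has_vector_derivative f' s 1) (at s within {0..L})" if "s \<in> {0..L}" for s
  proof -
    have "f' s = (\<lambda>h. h *\<^sub>R f' s 1)"
      using linear_cmul[OF has_derivative_linear[OF f'(1)[OF that]], of _ 1, unfolded real_scaleR_def mult_1_right]
      by (rule ext)
    then show ?thesis using f'(1)[OF that] unfolding has_vector_derivative_def
      by (rule subst[where P = "\<lambda>g. (\<zeta> has_derivative g) (at s within {0..L})"])
  qed
  have eq: "\<zeta>' s = f' s 1" if "s \<in> {0..L}" for s
    using D[OF that] that L_pos unfolding \<zeta>'_def by (simp add: vector_derivative_within_closed_interval)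
  show "s \<in> {0..L} \<Longrightarrow> (\<zeta> has_vector_derivative \<zeta>' s) (at s within {0..L})"
    using D[of s] eq[of s] by simp
  show "continuous_on {0..L} \<zeta>'"
    using f'(2)[of 1] by (rule continuous_on_eq) (rule eq[symmetric])
qed

lemma continuous_\<zeta>: "continuous_on {0..L} \<zeta>"
  unfolding continuous_on_eq_continuous_within
  by (blast intro: has_vector_derivative_continuous \<zeta>_deriv)

lemma continuous_sph_partial_\<zeta>: "continuous_on {0..L} (\<lambda>s. sph_partial i (\<zeta> s))"
proof -
  have "continuous_on UNIV (sph_partial i)"
    using differentiable_sph_partial differentiable_imp_continuous_within
    by (fastforce simp: continuous_on_eq_continuous_within)
  then show ?thesis using continuous_\<zeta> by (rule continuous_on_compose2) auto
qed

lemma continuous_N: "continuous_on {0..L} (N i)"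
  unfolding sph_normal_def
  by (intro continuous_intros continuous_sph_partial_\<zeta> ballI)
    (simp add: sph_partial_nonzero \<zeta>_frame)

lemma continuous_curvature: "continuous_on {0..L} curvature"
  unfolding curvature_def
  by (intro continuous_on_vec_lambda continuous_intros continuous_sph_partial_\<zeta> continuous_\<zeta>')

lemma continuous_T': "continuous_on {0..L} T'"
  unfolding T'_def by (intro continuous_intros continuous_N continuous_curvature)

lemma T_deriv:
  assumes "s \<in> {0..L}"
  shows "(T has_vector_derivative T' s) (at s within {0..L})"
proof -
  have "(T has_derivative (\<lambda>h. \<Sum>i\<in>UNIV. ((h *\<^sub>R \<zeta>' s) $ i) *\<^sub>R sph_partial i (\<zeta> s))) (at s within {0..L})"
    using \<zeta>_deriv[OF assms] has_derivative_sph unfolding has_vector_derivative_def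
    by (rule has_derivative_compose)
  moreover have "(\<Sum>i\<in>UNIV. ((h *\<^sub>R \<zeta>' s) $ i) *\<^sub>R sph_partial i (\<zeta> s)) = h *\<^sub>R T' s" for h
    unfolding T'_def scaleR_right.sum
    using sph_partial_nonzero[OF \<zeta>_frame[OF assms]]
    by (intro sum.cong) (auto simp: curvature_def sph_normal_def)
  ultimately show ?thesis unfolding has_vector_derivative_def by simp
qed

text \<open>Only the tangential component of the derivative of \<open>N i\<close> enters the
  Jacobian, and differentiating \<open>T s \<bullet> N i s = 0\<close> expresses it by the
  curvature.\<close>

lemma N_differentiable:
  assumes "s \<in> {0<..<L}"
  obtains d where "(N i has_vector_derivative d) (at s)" "T s \<bullet> d = - curvature s $ i"
proof -
  have s: "s \<in> {0..L}" "at s within {0..L} = at s"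
    using assms at_within_interior[of s "{0..L}"] by auto
  have "(sph_normal i \<circ> \<zeta>) differentiable (at s)"
    using \<zeta>_deriv[OF s(1)] differentiable_sph_normal[OF \<zeta>_frame[OF s(1)]] s(2)
    by (intro differentiable_chain_at) (auto simp: differentiableI_vector)
  then obtain d where d: "(N i has_vector_derivative d) (at s)"
    unfolding o_def by (metis vector_derivative_works)
  have "((\<lambda>s. T s \<bullet> N i s) has_vector_derivative (T s \<bullet> d + T' s \<bullet> N i s)) (at s)"
    using T_deriv[OF s(1)] d unfolding s(2)
    by (rule bounded_bilinear.has_vector_derivative[OF bounded_bilinear_inner])
  then have "((\<lambda>s. 0::real) has_vector_derivative (T s \<bullet> d + T' s \<bullet> N i s)) (at s)"
    by (simp add: inner_sph_sph_normal)
  then have "T s \<bullet> d + T' s \<bullet> N i s = 0"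
    using has_vector_derivative_const by (rule vector_derivative_unique_at)
  moreover have "T' s \<bullet> N i s = curvature s $ i"
    unfolding T'_def inner_sum_left
    by (simp add: inner_sph_normal[OF \<zeta>_frame[OF s(1)]] if_distrib cong: if_cong)
  ultimately show thesis using that d by simp
qed

lemma normal_map_apply: "\<nu> (s, u) = \<Gamma> s + (\<Sum>i\<in>UNIV. (u $ i) *\<^sub>R N i s)"
  by (simp add: normal_map_def)

lemma normal_map_inner:
  assumes "s \<in> {0..L}"
  shows "(\<nu> (s, u) - \<Gamma> s) \<bullet> T s = 0"
    and "(\<nu> (s, u) - \<Gamma> s) \<bullet> N i s = u $ i"
    and "(\<nu> (s, u) - \<Gamma> s) \<bullet> T' s = u \<bullet> curvature s"
    and "norm (\<nu> (s, u) - \<Gamma> s) = norm u"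
proof -
  note NN = inner_sph_normal[OF \<zeta>_frame[OF assms]]
  show "(\<nu> (s, u) - \<Gamma> s) \<bullet> T s = 0"
    by (simp add: normal_map_apply inner_sum_left inner_sum_right inner_sph_sph_normal inner_commute[of _ "T s"])
  show N: "(\<nu> (s, u) - \<Gamma> s) \<bullet> N i s = u $ i" for i
    by (simp add: normal_map_apply inner_sum_left NN if_distrib cong: if_cong)
  show "(\<nu> (s, u) - \<Gamma> s) \<bullet> T' s = u \<bullet> curvature s"
  proof -
    have "(\<nu> (s, u) - \<Gamma> s) \<bullet> T' s = (\<Sum>i\<in>UNIV. curvature s $ i * u $ i)"
      by (simp add: T'_def inner_sum_right N)
    then show ?thesis by (simp add: inner_vec_def mult.commute)
  qed
  have "(\<nu> (s, u) - \<Gamma> s) \<bullet> (\<nu> (s, u) - \<Gamma> s) = (\<nu> (s, u) - \<Gamma> s) \<bullet> (\<Sum>i\<in>UNIV. (u $ i) *\<^sub>R N i s)"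
    by (simp add: normal_map_apply)
  also have "\<dots> = (\<Sum>i\<in>UNIV. u $ i * u $ i)" by (simp add: inner_sum_right N)
  also have "\<dots> = u \<bullet> u" by (simp add: inner_vec_def)
  finally show "norm (\<nu> (s, u) - \<Gamma> s) = norm u" by (simp add: norm_eq_sqrt_inner)
qed

lemma jac_eq: "s \<in> {0..L} \<Longrightarrow> jac (s, u) = 1 - (\<nu> (s, u) - \<Gamma> s) \<bullet> T' s"
  by (simp add: jac_def normal_map_inner)

subsection \<open>The projection index\<close>

definition "nearest x = {s\<in>{0..L}. dist x (\<Gamma> s) = infdist x (\<Gamma> ` {0..L})}"

text \<open>The minimizing parameters form a nonempty compact set, so their supremum is
  attained.\<close>

lemma ix_nearest: "ix x \<in> nearest x"
proof -
  have cl: "compact (nearest x)"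
  proof -
    have "closed (nearest x)"
      unfolding nearest_def
      by (intro continuous_closed_preimage_constant continuous_intros continuous_\<Gamma>)
    moreover have "bounded (nearest x)"
      by (rule bounded_subset[of "{0..L}"]) (auto simp: nearest_def)
    ultimately show ?thesis by (simp add: compact_eq_bounded_closed)
  qed
  obtain y where "y \<in> \<Gamma> ` {0..L}" "infdist x (\<Gamma> ` {0..L}) = dist x y"
    using infdist_attains_inf compact_trace compact_imp_closed trace_nonempty by metis
  then have "nearest x \<noteq> {}" by (auto simp: nearest_def)
  with cl show ?thesis
    unfolding proj_index_def nearest_def[symmetric]
    by (intro closed_contains_Sup compact_imp_closed) (auto simp: compact_imp_bounded bounded_imp_bdd_above)
qed

lemma ix_in: "ix x \<in> {0..L}" and dist_ix: "dist x (\<Gamma> (ix x)) = infdist x (\<Gamma> ` {0..L})"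
  using ix_nearest[of x] by (auto simp: nearest_def)

lemma dist_ix_le: "t \<in> {0..L} \<Longrightarrow> dist x (\<Gamma> (ix x)) \<le> dist x (\<Gamma> t)"
  unfolding dist_ix by (simp add: infdist_le)

text \<open>Since \<Gamma> is injective, several nearest points are the same as several nearest
  parameters.\<close>

lemma amb_iff: "x \<notin> amb \<longleftrightarrow> (\<forall>s\<in>nearest x. s = ix x)"
proof
  assume "x \<notin> amb"
  then show "\<forall>s\<in>nearest x. s = ix x"
    using ix_nearest[of x] inj_\<Gamma> unfolding ambiguity_set_def nearest_def inj_on_def by blast
next
  assume *: "\<forall>s\<in>nearest x. s = ix x"
  show "x \<notin> amb"
  proof
    assume "x \<in> amb"
    then obtain s t where "s \<in> nearest x" "t \<in> nearest x" "\<Gamma> s \<noteq> \<Gamma> t"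
      unfolding ambiguity_set_def nearest_def by auto
    then show False using * by metis
  qed
qed

lemma borel_amb: "amb \<in> sets borel" and negligible_amb: "negligible amb"
  using borel_two_nearest_points[OF compact_trace] negligible_two_nearest_points[OF compact_trace]
  unfolding ambiguity_set_def by blast+

text \<open>As \<open>ix x\<close> is the largest nearest parameter, it is at least \<open>a\<close>
  iff some nearest point has a parameter at least \<open>a\<close>. Superlevel sets are therefore
  closed.\<close>

lemma ix_measurable [measurable]: "ix \<in> borel_measurable borel"
proof (rule borel_measurable_iff_ge[THEN iffD2], rule allI)
  fix a
  have "{x. a \<le> ix x} = {x. \<exists>y\<in>\<Gamma> ` ({0..L} \<inter> {a..}). dist x y = infdist x (\<Gamma> ` {0..L})}" (is "_ = ?R")
  proof (intro equalityI subsetI)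
    fix x assume "x \<in> {x. a \<le> ix x}"
    then show "x \<in> ?R" using ix_in[of x] dist_ix[of x] by auto
  next
    fix x assume "x \<in> ?R"
    then obtain s where s: "s \<in> nearest x" "a \<le> s" by (auto simp: nearest_def)
    have "s \<le> ix x"
      unfolding proj_index_def nearest_def[symmetric]
      by (rule cSup_upper[OF s(1)]) (auto simp: nearest_def bdd_above_def)
    with s show "x \<in> {x. a \<le> ix x}" by simp
  qed
  moreover have "compact (\<Gamma> ` ({0..L} \<inter> {a..}))"
    by (intro compact_continuous_image continuous_on_subset[OF continuous_\<Gamma>] compact_Int_closed) auto
  then have "closed {x. \<exists>y\<in>\<Gamma> ` ({0..L} \<inter> {a..}). dist x y = infdist x (\<Gamma> ` {0..L})}"
    by (rule closed_nearest_in) blast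
  ultimately show "{w \<in> space borel. a \<le> ix w} \<in> sets borel"
    by (simp only: space_borel UNIV_I simp_thms borel_closed)
qed

lemma diffeo_dom: "(ix -` {0..L} \<inter> K) - amb = K - amb"
  using ix_in by auto

lemma normal_map_coords:
  assumes "x \<in> K" "x \<notin> amb"
  shows "\<nu> (ix x, snd (normal_coords \<Gamma> L \<zeta> x)) = x"
  using diffeo assms unfolding normal_map_diffeo_on_def diffeo_dom by (simp add: normal_coords_def)

lemma normal_coords_map:
  assumes "u \<in> transverse_set \<Gamma> L \<zeta> s"
  shows "snd (normal_coords \<Gamma> L \<zeta> (\<nu> (s, u))) = u"
proof -
  have "ix (\<nu> (s, u)) = s" using assms by (simp add: transverse_set_def)
  then show ?thesis
    using ix_in[of "\<nu> (s, u)"] by (simp add: normal_coords_def proj_curve_def vec_eq_iff normal_map_inner)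
qed

text \<open>At an end point of the curve minimality would give only an inequality. The identity
  \<open>\<nu> \<circ> \<mu> = id\<close> gives equality everywhere: it writes
  \<open>x - \<Gamma> (ix x)\<close> as a combination of the normals.\<close>

lemma ix_orthogonal:
  assumes "x \<in> K" "x \<notin> amb"
  shows "(x - \<Gamma> (ix x)) \<bullet> T (ix x) = 0"
  using normal_map_inner(1)[OF ix_in, of x] normal_map_coords[OF assms] by metis

subsection \<open>Points of the interior that are not ambiguous\<close>

text \<open>Differentiate the orthogonality relation
  \<open>(x - \<Gamma> (ix x)) \<bullet> T (ix x) = 0\<close> in the direction of the tangent. The
  resulting product equal to one bars both factors from vanishing: the first serves at end points,
  the second gives the nonzero Jacobian.\<close>

lemma ix_differentiable:
  assumes "x0 \<in> interior K" "x0 \<notin> amb"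
  obtains l where "(ix has_derivative l) (at x0 within K - amb)"
    "l (T (ix x0)) * (1 - (x0 - \<Gamma> (ix x0)) \<bullet> T' (ix x0)) = 1"
proof -
  let ?S = "K - amb"
  have x0: "x0 \<in> ?S" using assms interior_subset by blast
  obtain D where "(normal_coords \<Gamma> L \<zeta> has_derivative D) (at x0 within ?S)"
    using diffeo x0 unfolding normal_map_diffeo_on_def diffeo_dom differentiable_on_def differentiable_def by blast
  from has_derivative_fst[OF this] have l: "(ix has_derivative (\<lambda>h. fst (D h))) (at x0 within ?S)"
    by (simp add: normal_coords_def)
  define l where "l = (\<lambda>h. fst (D h))"
  note l = l[folded l_def]
  define s0 where "s0 = ix x0"
  have s0: "s0 \<in> {0..L}" unfolding s0_def by (rule ix_in)
  have sub: "ix ` ?S \<subseteq> {0..L}" using ix_in by blast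
  have G: "((\<lambda>x. \<Gamma> (ix x)) has_derivative (\<lambda>h. l h *\<^sub>R T s0)) (at x0 within ?S)"
    using has_derivative_in_compose[OF l has_derivative_subset[OF _ sub]] \<Gamma>_deriv[OF s0]
    unfolding has_vector_derivative_def s0_def by blast
  have Td: "((\<lambda>x. T (ix x)) has_derivative (\<lambda>h. l h *\<^sub>R T' s0)) (at x0 within ?S)"
    using has_derivative_in_compose[OF l has_derivative_subset[OF _ sub]] T_deriv[OF s0]
    unfolding has_vector_derivative_def s0_def by blast
  have "((\<lambda>x. (x - \<Gamma> (ix x)) \<bullet> T (ix x)) has_derivative
      (\<lambda>h. (x0 - \<Gamma> s0) \<bullet> (l h *\<^sub>R T' s0) + (h - l h *\<^sub>R T s0) \<bullet> T s0)) (at x0 within ?S)"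
    using has_derivative_inner[OF has_derivative_diff[OF has_derivative_ident G] Td] by (simp add: s0_def)
  \<comment> \<open>The function vanishes on \<open>K - amb\<close>, so every point is a minimum
    there; the derivative is evaluated at \<open>h = T s0\<close>.\<close>
  then have "(x0 - \<Gamma> s0) \<bullet> (l (T s0) *\<^sub>R T' s0) + (T s0 - l (T s0) *\<^sub>R T s0) \<bullet> T s0 = 0"
  proof (rule has_derivative_local_min_dense)
    show "x0 \<in> interior (closure ?S)"
      using assms(1) interior_subset_closure_Diff_negligible[OF negligible_amb] by blast
    show "(x0 - \<Gamma> (ix x0)) \<bullet> T (ix x0) \<le> (x - \<Gamma> (ix x)) \<bullet> T (ix x)" if "x \<in> ?S" for x
      using ix_orthogonal x0 that by simp
  qed
  then have "l (T s0) * (1 - (x0 - \<Gamma> s0) \<bullet> T' s0) = 1"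
    by (simp add: inner_diff_left inner_sph_self algebra_simps)
  with l show thesis using that by (simp add: s0_def)
qed

text \<open>At an end point \<open>ix\<close> would attain its extreme value \<open>0\<close> or
  \<open>L\<close>, so its derivative would vanish, against the product formula of
  \<open>ix_differentiable\<close>.\<close>

lemma ix_interior:
  assumes "x0 \<in> interior K" "x0 \<notin> amb"
  shows "ix x0 \<in> {0<..<L}"
proof (rule ccontr)
  assume "ix x0 \<notin> {0<..<L}"
  then have end_pt: "ix x0 = 0 \<or> ix x0 = L" using ix_in[of x0] by auto
  obtain l where l: "(ix has_derivative l) (at x0 within K - amb)"
    "l (T (ix x0)) * (1 - (x0 - \<Gamma> (ix x0)) \<bullet> T' (ix x0)) = 1"
    using ix_differentiable[OF assms] .
  have dense: "x0 \<in> interior (closure (K - amb))"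
    using assms(1) interior_subset_closure_Diff_negligible[OF negligible_amb] by blast
  have "l h = 0" for h
    using end_pt
  proof
    assume "ix x0 = 0"
    then show ?thesis
      using has_derivative_local_min_dense[OF l(1) dense] ix_in by simp
  next
    assume "ix x0 = L"
    then show ?thesis
      using has_derivative_local_min_dense[OF has_derivative_minus[OF l(1)] dense] ix_in by simp
  qed
  with l(2) show False by simp
qed

text \<open>Equality to one is excluded by \<open>ix_differentiable\<close>. A value above one would
  make the squared distance concave at its minimum: it would decrease to the right of the projection
  index.\<close>

lemma second_order_pos:
  assumes "x0 \<in> interior K" "x0 \<notin> amb"
  shows "(x0 - \<Gamma> (ix x0)) \<bullet> T' (ix x0) < 1"
proof (rule ccontr)
  assume neg: "\<not> (x0 - \<Gamma> (ix x0)) \<bullet> T' (ix x0) < 1"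
  define s0 where "s0 = ix x0"
  have s0: "s0 \<in> {0<..<L}" using ix_interior[OF assms] by (simp add: s0_def)
  obtain l where "l (T (ix x0)) * (1 - (x0 - \<Gamma> (ix x0)) \<bullet> T' (ix x0)) = 1"
    using ix_differentiable[OF assms] .
  then have gt: "(x0 - \<Gamma> s0) \<bullet> T' s0 > 1" using neg by (cases "(x0 - \<Gamma> s0) \<bullet> T' s0 = 1") (auto simp: s0_def)
  have at: "at t within {0..L} = at t" if "t \<in> {0<..<L}" for t
    using that at_within_interior[of t "{0..L}"] by auto
  have der1: "((\<lambda>t. (x0 - \<Gamma> t) \<bullet> (x0 - \<Gamma> t)) has_real_derivative - 2 * ((x0 - \<Gamma> t) \<bullet> T t)) (at t)"
    if t: "t \<in> {0<..<L}" for t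
  proof -
    have "(\<Gamma> has_derivative (\<lambda>h. h *\<^sub>R T t)) (at t)"
      using \<Gamma>_deriv[of t] t at[OF t] by (simp add: has_vector_derivative_def)
    note d = has_derivative_diff[OF has_derivative_const this, of x0]
    show ?thesis using has_derivative_inner[OF d d] unfolding has_field_derivative_def
      by (rule has_derivative_eq_rhs) (auto simp: inner_commute algebra_simps)
  qed
  have der2: "((\<lambda>t. (x0 - \<Gamma> t) \<bullet> T t) has_real_derivative (x0 - \<Gamma> s0) \<bullet> T' s0 - 1) (at s0)"
  proof -
    have "(\<Gamma> has_derivative (\<lambda>h. h *\<^sub>R T s0)) (at s0)" "(T has_derivative (\<lambda>h. h *\<^sub>R T' s0)) (at s0)"
      using \<Gamma>_deriv[of s0] T_deriv[of s0] s0 at[OF s0] by (auto simp: has_vector_derivative_def)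
    note d = has_derivative_inner[OF has_derivative_diff[OF has_derivative_const this(1), of x0] this(2)]
    show ?thesis using d unfolding has_field_derivative_def
      by (rule has_derivative_eq_rhs) (auto simp: inner_sph_self algebra_simps)
  qed
  obtain d where d: "d > 0" "\<And>h. 0 < h \<Longrightarrow> h < d \<Longrightarrow> (x0 - \<Gamma> s0) \<bullet> T s0 < (x0 - \<Gamma> (s0 + h)) \<bullet> T (s0 + h)"
    using DERIV_pos_inc_right[OF der2] gt by auto
  have orth: "(x0 - \<Gamma> s0) \<bullet> T s0 = 0"
    using ix_orthogonal[of x0] assms interior_subset s0_def by blast
  \<comment> \<open>Half of the admissible step, so that \<open>b\<close> stays in the range of
    \<open>d\<close> and below \<open>L\<close>.\<close>
  define b where "b = s0 + min d (L - s0) / 2"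
  have b: "s0 < b" "b < s0 + d" "b < L" using d(1) s0 by (auto simp: b_def min_def field_simps)
  have "(x0 - \<Gamma> b) \<bullet> (x0 - \<Gamma> b) < (x0 - \<Gamma> s0) \<bullet> (x0 - \<Gamma> s0)"
  proof (rule DERIV_neg_imp_decreasing_open[OF b(1)])
    fix t assume t: "s0 < t" "t < b"
    then have "0 < (x0 - \<Gamma> t) \<bullet> T t" using d(2)[of "t - s0"] b orth by simp
    then show "\<exists>y. ((\<lambda>t. (x0 - \<Gamma> t) \<bullet> (x0 - \<Gamma> t)) has_real_derivative y) (at t) \<and> y < 0"
      using der1[of t] t b s0 by fastforce
  next
    show "continuous_on {s0..b} (\<lambda>t. (x0 - \<Gamma> t) \<bullet> (x0 - \<Gamma> t))"
      using b s0 by (intro continuous_intros continuous_on_subset[OF continuous_\<Gamma>]) auto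
  qed
  moreover have "dist x0 (\<Gamma> s0) \<le> dist x0 (\<Gamma> b)"
    using dist_ix_le[of b x0] b s0 by (simp add: s0_def)
  ultimately show False by (simp add: dist_norm norm_le)
qed

text \<open>Near a non-ambiguous interior point the squared distance to the curve is strictly convex in
  the parameter, so its critical points are the projections.\<close>

lemma local_projection:
  assumes "x0 \<in> interior K" "x0 \<notin> amb"
  obtains U I where "open U" "x0 \<in> U" "open I" "ix x0 \<in> I" "I \<subseteq> {0<..<L}"
    "\<And>x s. x \<in> U \<Longrightarrow> s \<in> I \<Longrightarrow> (x - \<Gamma> s) \<bullet> T s = 0 \<Longrightarrow> ix x = s \<and> x \<notin> amb"
proof -
  define s0 where "s0 = ix x0"
  have s0: "s0 \<in> {0<..<L}" using ix_interior[OF assms] by (simp add: s0_def)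
  define G where "G = (\<lambda>q::(real ^ 'n option) \<times> real. (fst q - \<Gamma> (snd q)) \<bullet> T' (snd q))"
  have "continuous_on (UNIV \<times> {0..L}) G"
    unfolding G_def by (intro continuous_intros continuous_on_compose2[OF continuous_\<Gamma>]
      continuous_on_compose2[OF continuous_T']) auto
  then have "continuous_on (UNIV \<times> {0<..<L}) G" by (rule continuous_on_subset) auto
  then have "open ((UNIV \<times> {0<..<L}) \<inter> G -` {..<1})"
    by (intro continuous_open_preimage) (auto simp: open_Times)
  moreover have "(x0, s0) \<in> (UNIV \<times> {0<..<L}) \<inter> G -` {..<1}"
    using second_order_pos[OF assms] s0 by (auto simp: G_def s0_def)
  ultimately obtain U1 I1 where U1: "open U1" "open I1" "x0 \<in> U1" "s0 \<in> I1"
    "U1 \<times> I1 \<subseteq> (UNIV \<times> {0<..<L}) \<inter> G -` {..<1}"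
    unfolding open_prod_def by (metis mem_Sigma_iff)
  obtain r where r: "r > 0" "ball s0 r \<subseteq> I1" using U1 open_contains_ball by blast
  define I where "I = ball s0 r"
  have I_sub: "I \<subseteq> {0<..<L}" using r U1 unfolding I_def by auto
  have I_conv: "t \<in> I" if "a \<in> I" "b \<in> I" "a \<le> t" "t \<le> b" for a b t
    using that by (auto simp: I_def dist_real_def)
  have GI: "(x - \<Gamma> t) \<bullet> T' t < 1" if "x \<in> U1" "t \<in> I" for x t
  proof -
    have "(x, t) \<in> U1 \<times> I1" using that r(2) unfolding I_def by blast
    then have "G (x, t) < 1" using U1(5) by blast
    then show ?thesis by (simp add: G_def)
  qed
  define Z where "Z = {0..L} - I"
  have "compact Z" unfolding Z_def I_def by (intro compact_diff) auto
  \<comment> \<open>Compactness of \<open>Z\<close> turns uniqueness of the nearest parameter into a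
    uniform gap between the distance at \<open>s0\<close> and the distances at parameters outside
    \<open>I\<close>.\<close>
  obtain e where e: "e > 0" "\<And>t. t \<in> Z \<Longrightarrow> dist x0 (\<Gamma> t) \<ge> dist x0 (\<Gamma> s0) + e"
  proof (cases "Z = {}")
    case False
    have "continuous_on Z (\<lambda>t. dist x0 (\<Gamma> t))"
      by (intro continuous_intros continuous_on_subset[OF continuous_\<Gamma>]) (auto simp: Z_def)
    then obtain t0 where t0: "t0 \<in> Z" "\<And>t. t \<in> Z \<Longrightarrow> dist x0 (\<Gamma> t0) \<le> dist x0 (\<Gamma> t)"
      using continuous_attains_inf[OF \<open>compact Z\<close> False] by blast
    have "t0 \<noteq> s0" using t0(1) r(1) by (auto simp: Z_def I_def)
    then have "t0 \<notin> nearest x0" using assms(2) unfolding amb_iff s0_def by blast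
    then have "dist x0 (\<Gamma> s0) < dist x0 (\<Gamma> t0)"
      using t0(1) dist_ix_le[of t0 x0] dist_ix[of x0] unfolding nearest_def Z_def s0_def by fastforce
    then show thesis using t0(2) that[of "dist x0 (\<Gamma> t0) - dist x0 (\<Gamma> s0)"] by simp
  qed (use that[of 1] in simp)
  define U where "U = U1 \<inter> ball x0 (e / 2)"
  have near_I: "t \<in> I" if "x \<in> U" "t \<in> nearest x" for x t
  proof (rule ccontr)
    assume "t \<notin> I"
    then have "dist x0 (\<Gamma> s0) + e \<le> dist x0 (\<Gamma> t)" using e(2) that by (auto simp: Z_def nearest_def)
    moreover have "dist x (\<Gamma> t) \<le> dist x (\<Gamma> s0)"
      using that s0 by (auto simp: nearest_def infdist_le)
    moreover have "dist x0 (\<Gamma> t) \<le> dist x0 x + dist x (\<Gamma> t)" "dist x (\<Gamma> s0) \<le> dist x0 x + dist x0 (\<Gamma> s0)"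
      by (rule dist_triangle, metis dist_triangle dist_commute)
    moreover have "dist x0 x < e / 2" using that by (simp add: U_def)
    ultimately show False by linarith
  qed
  have uniq: "ix x = s \<and> x \<notin> amb" if x: "x \<in> U" and s: "s \<in> I" and orth: "(x - \<Gamma> s) \<bullet> T s = 0" for x s
  proof -
    have at: "at t within {0..L} = at t" if "t \<in> I" for t
      using that I_sub at_within_interior[of t "{0..L}"] by auto
    have der1: "((\<lambda>t. (x - \<Gamma> t) \<bullet> (x - \<Gamma> t)) has_real_derivative - 2 * ((x - \<Gamma> t) \<bullet> T t)) (at t)"
      if t: "t \<in> I" for t
    proof -
      have "(\<Gamma> has_derivative (\<lambda>h. h *\<^sub>R T t)) (at t)"
        using \<Gamma>_deriv[of t] t I_sub at[OF t] by (auto simp: has_vector_derivative_def)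
      note d = has_derivative_diff[OF has_derivative_const this, of x]
      show ?thesis using has_derivative_inner[OF d d] unfolding has_field_derivative_def
        by (rule has_derivative_eq_rhs) (auto simp: inner_commute algebra_simps)
    qed
    have der2: "((\<lambda>t. (x - \<Gamma> t) \<bullet> T t) has_real_derivative (x - \<Gamma> t) \<bullet> T' t - 1) (at t)"
      if t: "t \<in> I" for t
    proof -
      have "(\<Gamma> has_derivative (\<lambda>h. h *\<^sub>R T t)) (at t)" "(T has_derivative (\<lambda>h. h *\<^sub>R T' t)) (at t)"
        using \<Gamma>_deriv[of t] T_deriv[of t] t I_sub at[OF t] by (auto simp: has_vector_derivative_def)
      note d = has_derivative_inner[OF has_derivative_diff[OF has_derivative_const this(1), of x] this(2)]
      show ?thesis using d unfolding has_field_derivative_def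
        by (rule has_derivative_eq_rhs) (auto simp: inner_sph_self algebra_simps)
    qed
    \<comment> \<open>Up to the factor \<open>-2\<close> this function is the derivative of the
      squared distance. Being strictly decreasing on \<open>I\<close> with zero \<open>s\<close>, it
      makes the distance decrease before \<open>s\<close> and increase after it.\<close>
    have dec: "(x - \<Gamma> b) \<bullet> T b < (x - \<Gamma> a) \<bullet> T a" if "a \<in> I" "b \<in> I" "a < b" for a b
    proof (rule DERIV_neg_imp_decreasing[OF that(3)])
      fix t assume "a \<le> t" "t \<le> b"
      then have "t \<in> I" using I_conv that by blast
      then show "\<exists>y. ((\<lambda>t. (x - \<Gamma> t) \<bullet> T t) has_real_derivative y) (at t) \<and> y < 0"
        using der2[of t] GI[of x t] x by (auto simp: U_def)
    qed
    have cont: "continuous_on {a..b} (\<lambda>t. (x - \<Gamma> t) \<bullet> (x - \<Gamma> t))" if "a \<in> I" "b \<in> I" for a b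
      using that I_sub by (intro continuous_intros continuous_on_subset[OF continuous_\<Gamma>]) auto
    have "t = s" if t: "t \<in> nearest x" for t
    proof (rule ccontr)
      assume "t \<noteq> s"
      have tI: "t \<in> I" using near_I[OF x t] .
      have "(x - \<Gamma> s) \<bullet> (x - \<Gamma> s) < (x - \<Gamma> t) \<bullet> (x - \<Gamma> t)"
      proof (cases "s < t")
        case True
        show ?thesis
        proof (rule DERIV_pos_imp_increasing_open[OF True])
          fix a assume a: "s < a" "a < t"
          then have "a \<in> I" using I_conv s tI by (meson less_imp_le)
          then show "\<exists>y. ((\<lambda>t. (x - \<Gamma> t) \<bullet> (x - \<Gamma> t)) has_real_derivative y) (at a) \<and> 0 < y"
            using der1[of a] dec[OF s _ a(1)] orth by fastforce
        qed (use cont s tI in blast)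
      next
        case False
        then have ts: "t < s" using \<open>t \<noteq> s\<close> by simp
        show ?thesis
        proof (rule DERIV_neg_imp_decreasing_open[OF ts])
          fix a assume a: "t < a" "a < s"
          then have "a \<in> I" using I_conv s tI by (meson less_imp_le)
          then show "\<exists>y. ((\<lambda>t. (x - \<Gamma> t) \<bullet> (x - \<Gamma> t)) has_real_derivative y) (at a) \<and> y < 0"
            using der1[of a] dec[OF _ s a(2)] orth by fastforce
        qed (use cont s tI in blast)
      qed
      then have "dist x (\<Gamma> s) < dist x (\<Gamma> t)" by (simp add: dist_norm norm_lt)
      moreover have "dist x (\<Gamma> t) \<le> dist x (\<Gamma> s)"
        using t s I_sub by (auto simp: nearest_def infdist_le)
      ultimately show False by simp
    qed
    then show ?thesis using ix_nearest[of x] unfolding amb_iff by blast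
  qed
  show thesis
  proof (rule that)
    show "open U" "x0 \<in> U" using U1(1,3) e(1) by (auto simp: U_def)
    show "open I" "ix x0 \<in> I" using r(1) by (auto simp: I_def s0_def)
  qed (use I_sub uniq in blast)+
qed

subsection \<open>The range of the normal coordinates\<close>

text \<open>The normal coordinates of all non-ambiguous points of the interior of \<open>K\<close>.
  Restricting to the interior makes the set open, and no mass is lost because \<open>p\<close>
  vanishes elsewhere.\<close>

definition tube :: "(real \<times> (real, 'n) vec) set" where
  "tube = {(s, u). s \<in> {0<..<L} \<and> u \<in> transverse_set \<Gamma> L \<zeta> s \<and> \<nu> (s, u) \<in> interior K}"

lemma continuous_normal_map: "continuous_on ({0..L} \<times> UNIV) \<nu>"
proof -
  have "continuous_on ({0..L} \<times> UNIV) (\<lambda>q::real \<times> (real, 'n) vec. \<Gamma> (fst q) + (\<Sum>i\<in>UNIV. (snd q $ i) *\<^sub>R N i (fst q)))"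
    by (intro continuous_intros continuous_on_compose2[OF continuous_\<Gamma>] continuous_on_compose2[OF continuous_N]) auto
  then show ?thesis by (simp add: normal_map_def case_prod_unfold)
qed

lemma continuous_jac: "continuous_on ({0..L} \<times> UNIV) jac"
proof -
  have "continuous_on ({0..L} \<times> UNIV) (\<lambda>q::real \<times> (real, 'n) vec. 1 - snd q \<bullet> curvature (fst q))"
    by (intro continuous_intros continuous_on_compose2[OF continuous_curvature]) auto
  then show ?thesis by (simp add: jac_def case_prod_unfold)
qed

lemma transverse_set_iff: "u \<in> transverse_set \<Gamma> L \<zeta> s \<longleftrightarrow> ix (\<nu> (s, u)) = s \<and> \<nu> (s, u) \<notin> amb"
  by (simp add: transverse_set_def)

text \<open>Points \<open>\<nu> (s, u)\<close> satisfy the orthogonality relation at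
  \<open>s\<close> by construction, so \<open>local_projection\<close> makes every nearby pair the
  normal coordinates of its image.\<close>

lemma open_tube: "open tube"
proof (subst open_subopen, intro ballI)
  fix y assume "y \<in> tube"
  then obtain s0 u0 where y: "y = (s0, u0)" "s0 \<in> {0<..<L}" "ix (\<nu> (s0, u0)) = s0"
    "\<nu> (s0, u0) \<notin> amb" "\<nu> (s0, u0) \<in> interior K"
    by (auto simp: tube_def transverse_set_iff)
  obtain U I where UI: "open U" "\<nu> (s0, u0) \<in> U" "open I" "ix (\<nu> (s0, u0)) \<in> I" "I \<subseteq> {0<..<L}"
    "\<And>x s. x \<in> U \<Longrightarrow> s \<in> I \<Longrightarrow> (x - \<Gamma> s) \<bullet> T s = 0 \<Longrightarrow> ix x = s \<and> x \<notin> amb"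
    by (rule local_projection[OF y(5,4)], rule that)
  define V where "V = (I \<times> UNIV) \<inter> \<nu> -` (U \<inter> interior K)"
  have "I \<times> UNIV \<subseteq> {0..L} \<times> (UNIV :: (real, 'n) vec set)" using UI(5) by auto
  then have "open V"
    unfolding V_def using UI(1,3)
    by (intro continuous_open_preimage continuous_on_subset[OF continuous_normal_map] open_Times open_Int) auto
  moreover have "y \<in> V" using y UI(2,4) by (simp add: V_def)
  moreover have "V \<subseteq> tube"
  proof
    fix z assume "z \<in> V"
    then obtain s u where z: "z = (s, u)" "s \<in> I" "\<nu> (s, u) \<in> U" "\<nu> (s, u) \<in> interior K"
      by (cases z) (auto simp: V_def)
    have "s \<in> {0..L}" using z UI(5) by auto
    then show "z \<in> tube"
      using UI(6)[OF z(3,2)] normal_map_inner(1)[of s u] z UI(5) by (auto simp: tube_def transverse_set_iff)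
  qed
  ultimately show "\<exists>V. open V \<and> y \<in> V \<and> V \<subseteq> tube" by blast
qed

lemma tube_in: "(s, u) \<in> tube \<Longrightarrow> s \<in> {0<..<L}"
  by (simp add: tube_def)

lemma tube_ix: "(s, u) \<in> tube \<Longrightarrow> ix (\<nu> (s, u)) = s"
  by (simp add: tube_def transverse_set_iff)

lemma jac_pos:
  assumes "(s, u) \<in> tube"
  shows "0 < jac (s, u)"
  using assms second_order_pos[of "\<nu> (s, u)"]
  by (auto simp: tube_def transverse_set_iff jac_eq)

lemma normal_map_tube: "\<nu> ` tube = interior K - amb"
proof (intro equalityI subsetI)
  fix x assume "x \<in> \<nu> ` tube"
  then show "x \<in> interior K - amb" by (auto simp: tube_def transverse_set_iff)
next
  fix x assume x: "x \<in> interior K - amb"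
  then have "\<nu> (ix x, snd (normal_coords \<Gamma> L \<zeta> x)) = x"
    using normal_map_coords interior_subset by blast
  moreover from this have "(ix x, snd (normal_coords \<Gamma> L \<zeta> x)) \<in> tube"
    using x ix_interior[of x] by (simp add: tube_def transverse_set_iff)
  ultimately show "x \<in> \<nu> ` tube" by (metis imageI)
qed

text \<open>On \<open>tube\<close> the map \<open>normal_coords\<close> is a left inverse.\<close>

lemma inj_on_tube: "inj_on \<nu> tube"
proof (rule inj_onI)
  fix y z assume yz: "y \<in> tube" "z \<in> tube" "\<nu> y = \<nu> z"
  have "y = normal_coords \<Gamma> L \<zeta> (\<nu> y)" if "y \<in> tube" for y
  proof -
    obtain s u where y: "y = (s, u)" by (cases y)
    have "fst (normal_coords \<Gamma> L \<zeta> (\<nu> y)) = s"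
      using tube_ix[of s u] that y by (simp add: normal_coords_def)
    moreover have "snd (normal_coords \<Gamma> L \<zeta> (\<nu> y)) = u"
      using that normal_coords_map[of u s] y by (simp add: tube_def)
    ultimately show ?thesis using y by (metis prod.collapse)
  qed
  then show "y = z" using yz by metis
qed

section \<open>The density in normal coordinates\<close>

lemma continuous_p: "continuous_on UNIV p"
  by (rule continuous_on_Ck_on[of 0]) (use p_smooth in \<open>simp add: smooth_on_def\<close>)

text \<open>By continuity the set where \<open>p\<close> is nonzero is open, and it lies in
  \<open>K\<close>.\<close>

lemma p_zero_outside:
  assumes "x \<notin> interior K"
  shows "p x = 0"
proof -
  have "open {x. p x \<noteq> 0}"
    by (intro open_Collect_neq continuous_p continuous_on_const)
  moreover have "{x. p x \<noteq> 0} \<subseteq> K" using closure_subset[of "{x. p x \<noteq> 0}"] by (simp only: p_support)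
  ultimately have "{x. p x \<noteq> 0} \<subseteq> interior K" by (simp only: interior_maximal)
  then show ?thesis using assms by blast
qed

lemma bounds:
  obtains R P where "0 \<le> R" "0 \<le> P" "\<And>x s. x \<in> K \<Longrightarrow> s \<in> {0..L} \<Longrightarrow> norm (x - \<Gamma> s) \<le> R" "\<And>x. p x \<le> P"
proof -
  have cK: "compact K" using K_region by (simp add: compact_region_def)
  obtain R where R: "\<And>x y. x \<in> K \<Longrightarrow> y \<in> K \<Longrightarrow> dist x y \<le> R"
    using compact_imp_bounded[OF cK] bounded_any_center unfolding bounded_two_points by blast
  obtain P where P: "\<And>x. x \<in> K \<Longrightarrow> norm (p x) \<le> P"
    using compact_imp_bounded[OF compact_continuous_image[OF continuous_on_subset[OF continuous_p] cK]]
    unfolding bounded_iff by auto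
  have "norm (x - \<Gamma> s) \<le> \<bar>R\<bar>" if "x \<in> K" "s \<in> {0..L}" for x s
    using R[of x "\<Gamma> s"] that curve_in by (force simp: dist_norm)
  moreover have "p x \<le> \<bar>P\<bar>" for x
    using P[of x] p_zero_outside[of x] interior_subset[of K] by (cases "x \<in> K") force+
  ultimately show thesis using that[of "\<bar>R\<bar>" "\<bar>P\<bar>"] by simp
qed

text \<open>Extension by zero moves the dependence of the transverse region on \<open>s\<close> into
  the integrand, so that continuity in \<open>s\<close> becomes a pointwise question for fixed
  \<open>u\<close>.\<close>

definition weight :: "real \<times> (real, 'n) vec \<Rightarrow> real" where
  "weight y = indicator tube y * p (\<nu> y)"

lemma weight_nonneg: "0 \<le> weight y"
  by (simp add: weight_def p_nonneg)

lemma continuous_on_tube: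
  "continuous_on tube \<nu>" "continuous_on tube jac"
  by (rule continuous_on_subset[OF continuous_normal_map] continuous_on_subset[OF continuous_jac];
      auto simp: tube_def)+

lemma weight_measurable [measurable]: "weight \<in> borel_measurable borel"
proof -
  have "continuous_on tube (\<lambda>y. p (\<nu> y))"
    by (rule continuous_on_compose2[OF continuous_p continuous_on_tube(1)]) simp
  from borel_measurable_continuous_on_indicator[OF _ this] show ?thesis
    using open_tube by (simp add: weight_def[abs_def])
qed

lemma Pair_measurable [measurable]: "(\<lambda>u. (s, u)) \<in> borel_measurable (borel :: (real, 'n) vec measure)"
  by (intro borel_measurable_continuous_onI continuous_intros)

lemma weight_slice_measurable: "(\<lambda>u. weight (s, u)) \<in> borel_measurable borel"
  by (rule measurable_compose[OF Pair_measurable weight_measurable])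

text \<open>The frame is orthonormal, so \<open>norm u\<close> is the distance from
  \<open>\<nu> (s, u)\<close> to \<open>\<Gamma> s\<close>, which compactness of \<open>K\<close>
  bounds uniformly in \<open>s\<close>.\<close>

lemma weight_support:
  obtains R P where "0 \<le> R" "0 \<le> P" "\<And>s u. weight (s, u) \<noteq> 0 \<Longrightarrow> norm u \<le> R" "\<And>y. weight y \<le> P"
proof -
  obtain R P where RP: "0 \<le> R" "0 \<le> P" "\<And>x s. x \<in> K \<Longrightarrow> s \<in> {0..L} \<Longrightarrow> norm (x - \<Gamma> s) \<le> R" "\<And>x. p x \<le> P"
    by (rule bounds) blast
  have "norm u \<le> R" if "weight (s, u) \<noteq> 0" for s u
  proof -
    have "(s, u) \<in> tube" using that by (auto simp: weight_def split: split_indicator_asm)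
    then have "s \<in> {0..L}" "\<nu> (s, u) \<in> K" using interior_subset by (auto simp: tube_def)
    then show ?thesis using RP(3)[of "\<nu> (s, u)" s] normal_map_inner(4)[of s u] by simp
  qed
  moreover have "weight y \<le> P" for y using RP(2,4) by (simp add: weight_def split: split_indicator)
  ultimately show thesis using that RP(1,2) by blast
qed

lemma integrable_weight:
  assumes g: "continuous_on UNIV g"
  shows "integrable lborel (\<lambda>u. g u * weight (s, u) :: real)"
proof -
  obtain R P where RP: "0 \<le> R" "0 \<le> P" "\<And>s u. weight (s, u) \<noteq> 0 \<Longrightarrow> norm u \<le> R" "\<And>y. weight y \<le> P"
    by (rule weight_support) blast
  have "bounded (g ` cball 0 R)"
    by (intro compact_imp_bounded compact_continuous_image continuous_on_subset[OF g] compact_cball) simp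
  then obtain G where "\<forall>y\<in>g ` cball 0 R. norm y \<le> G" unfolding bounded_iff by blast
  then have G: "norm (g u) \<le> G" if "u \<in> cball 0 R" for u using that by blast
  show ?thesis
  proof (rule Bochner_Integration.integrable_bound)
    show "integrable lborel (\<lambda>u. indicator (cball (0::(real, 'n) vec) R) u * (G * P))"
      by (intro integrable_mult_left integrable_real_indicator) (auto intro: emeasure_lborel_cball_finite[unfolded infinity_ennreal_def])
    show "(\<lambda>u. g u * weight (s, u)) \<in> borel_measurable lborel"
      using borel_measurable_continuous_onI[OF g] weight_slice_measurable by simp
    show "AE u in lborel. norm (g u * weight (s, u)) \<le> norm (indicator (cball (0::(real, 'n) vec) R) u * (G * P))"
    proof (rule AE_I2)
      fix u
      show "norm (g u * weight (s, u)) \<le> norm (indicator (cball (0::(real, 'n) vec) R) u * (G * P))"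
      proof (cases "weight (s, u) = 0")
        case False
        then have u: "u \<in> cball 0 R" using RP(3) by simp
        have "norm (g u * weight (s, u)) \<le> G * P"
          using G[OF u] RP(4) weight_nonneg by (auto simp: abs_mult intro: mult_mono order_trans[OF _ G[OF u]])
        then show ?thesis using u by simp
      qed simp
    qed
  qed
qed

text \<open>The transverse set and the slice of \<open>tube\<close> at \<open>s\<close> differ only
  in parameters whose image lies outside the interior of \<open>K\<close>, where the density is
  zero.\<close>

lemma transverse_moment_eq:
  assumes "s \<in> {0<..<L}"
  shows "transverse_moment p \<Gamma> L \<zeta> j s = (\<integral>u. (\<Prod>i\<in>UNIV. (u $ i) ^ j i) * weight (s, u) \<partial>lborel)"
proof -
  have "indicator (transverse_set \<Gamma> L \<zeta> s) u * p (\<nu> (s, u)) = weight (s, u)" for u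
    using assms p_zero_outside[of "\<nu> (s, u)"]
    by (cases "\<nu> (s, u) \<in> interior K") (auto simp: weight_def tube_def split: split_indicator)
  then have eq: "indicator (transverse_set \<Gamma> L \<zeta> s) u *\<^sub>R ((\<Prod>i\<in>UNIV. (u $ i) ^ j i) * p (\<nu> (s, u)))
      = (\<Prod>i\<in>UNIV. (u $ i) ^ j i) * weight (s, u)" for u
    by (simp add: mult.left_commute)
  show ?thesis unfolding transverse_moment_def set_lebesgue_integral_def by (simp only: eq)
qed

lemma transverse_moment_end:
  assumes "s \<in> {0..L}" "s \<notin> {0<..<L}"
  shows "transverse_moment p \<Gamma> L \<zeta> j s = 0"
proof -
  have eq0: "indicator (transverse_set \<Gamma> L \<zeta> s) u * p (\<nu> (s, u)) = 0" for u
    using assms(2) p_zero_outside[of "\<nu> (s, u)"] ix_interior[of "\<nu> (s, u)"]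
    by (cases "\<nu> (s, u) \<in> interior K") (auto simp: transverse_set_iff split: split_indicator)
  have eq: "indicator (transverse_set \<Gamma> L \<zeta> s) u *\<^sub>R ((\<Prod>i\<in>UNIV. (u $ i) ^ j i) * p (\<nu> (s, u))) = 0" for u
    using eq0[of u] by auto
  show ?thesis unfolding transverse_moment_def set_lebesgue_integral_def by (simp only: eq) simp
qed

section \<open>Transverse moments and flux\<close>

definition mass :: "real \<Rightarrow> real" where "mass s = (\<integral>u. weight (s, u) \<partial>lborel)"
definition moment1 :: "'n \<Rightarrow> real \<Rightarrow> real" where "moment1 i s = (\<integral>u. u $ i * weight (s, u) \<partial>lborel)"
definition moment2 :: "'n \<Rightarrow> 'n \<Rightarrow> real \<Rightarrow> real" where
  "moment2 i j s = (\<integral>u. u $ i * u $ j * weight (s, u) \<partial>lborel)"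

text \<open>\<open>jac\<close> is the Jacobian of the normal coordinates, so \<open>flux i s\<close> is the unnormalized conditional
  mean of the \<open>i\<close>-th normal coordinate given the projection index \<open>s\<close>.\<close>

definition flux :: "'n \<Rightarrow> real \<Rightarrow> real" where
  "flux i s = (\<integral>u. u $ i * jac (s, u) * weight (s, u) \<partial>lborel)"

lemma prod_unit_index:
  "(\<Prod>k\<in>UNIV. (u $ k) ^ unit_index i k) = (u $ i :: real)"
  "(\<Prod>k\<in>UNIV. (u $ k) ^ (unit_index i k + unit_index j k)) = (u $ i * u $ j :: real)"
proof -
  show *: "(\<Prod>k\<in>UNIV. (u $ k) ^ unit_index i k) = (u $ i :: real)" for i
  proof -
    have "(u $ k) ^ unit_index i k = (if k = i then u $ k else 1)" for k by (simp add: unit_index_def)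
    then show ?thesis by simp
  qed
  show "(\<Prod>k\<in>UNIV. (u $ k) ^ (unit_index i k + unit_index j k)) = (u $ i * u $ j :: real)"
    by (simp add: power_add prod.distrib *)
qed

lemma transverse_moments:
  assumes "s \<in> {0<..<L}"
  shows "transverse_moment p \<Gamma> L \<zeta> (\<lambda>_. 0) s = mass s"
    and "transverse_moment p \<Gamma> L \<zeta> (unit_index i) s = moment1 i s"
    and "transverse_moment p \<Gamma> L \<zeta> (\<lambda>k. unit_index i k + unit_index j k) s = moment2 i j s"
  by (simp_all add: transverse_moment_eq[OF assms] mass_def moment1_def moment2_def prod_unit_index)

text \<open>\<open>jac\<close> is affine in \<open>u\<close>. Vanishing of all fluxes is thus the
  linear system that sends the curvature to the first moments under the second-moment matrix, before
  division by the mass.\<close>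

lemma flux_eq: "flux i s = moment1 i s - (\<Sum>j\<in>UNIV. moment2 i j s * curvature s $ j)"
proof -
  have int1: "integrable lborel (\<lambda>u. u $ i * weight (s, u))"
    and int2: "integrable lborel (\<lambda>u. u $ i * u $ j * weight (s, u))" for j
    by (intro integrable_weight continuous_intros)+
  have "u $ i * jac (s, u) * weight (s, u) =
      u $ i * weight (s, u) - (\<Sum>j\<in>UNIV. u $ i * u $ j * weight (s, u) * curvature s $ j)" for u
    by (simp add: jac_def inner_vec_def algebra_simps sum_distrib_left sum_distrib_right)
  then show ?thesis
    unfolding flux_def moment1_def moment2_def using int1 int2
    by (simp add: Bochner_Integration.integral_diff Bochner_Integration.integral_sum)
qed

subsection \<open>Continuity along the curve\<close>

text \<open>For fixed \<open>s\<close> the parameters \<open>u\<close> for which \<open>\<Gamma> s\<close> is a nearest point form a closed convex set,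
  and only its frontier can contain ambiguity points.\<close>

lemma weight_tendsto:
  assumes s0: "s0 \<in> {0<..<L}"
  shows "AE u in lborel. \<forall>S. (\<forall>n. S n \<in> {0<..<L}) \<longrightarrow> S \<longlonglongrightarrow> s0 \<longrightarrow> (\<lambda>n. weight (S n, u)) \<longlonglongrightarrow> weight (s0, u)"
proof -
  have s0': "s0 \<in> {0..L}" using s0 by simp
  \<comment> \<open>Coefficients of the halfspaces: after squaring the distances the quadratic terms
    in \<open>u\<close> cancel, and \<open>\<Gamma> s0\<close> is at least as near as
    \<open>\<Gamma> t\<close> iff \<open>a t \<bullet> u \<le> b t\<close>.\<close>
  define a where "a t = (\<chi> i. N i s0 \<bullet> (\<Gamma> t - \<Gamma> s0))" for t
  define b where "b t = (\<Gamma> t - \<Gamma> s0) \<bullet> (\<Gamma> t - \<Gamma> s0) / 2" for t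
  define C where "C = (\<Inter>t\<in>{0..L}. {u. a t \<bullet> u \<le> b t})"
  have closest: "dist (\<nu> (s0, u)) (\<Gamma> s0) \<le> dist (\<nu> (s0, u)) (\<Gamma> t) \<longleftrightarrow> a t \<bullet> u \<le> b t"
    and closest': "dist (\<nu> (s0, u)) (\<Gamma> t) \<le> dist (\<nu> (s0, u)) (\<Gamma> s0) \<longleftrightarrow> b t \<le> a t \<bullet> u" for u t
  proof -
    define v where "v = \<nu> (s0, u) - \<Gamma> s0"
    define d where "d = \<Gamma> t - \<Gamma> s0"
    have vd: "v \<bullet> d = a t \<bullet> u" "b t = d \<bullet> d / 2"
      by (simp_all add: v_def d_def a_def b_def normal_map_apply inner_sum_left inner_vec_def[of _ u] mult.commute)
    have diff: "\<nu> (s0, u) - \<Gamma> t = v - d" by (simp add: v_def d_def)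
    have vd': "(v - d) \<bullet> (v - d) = v \<bullet> v - 2 * (v \<bullet> d) + d \<bullet> d"
      by (simp add: inner_diff_left inner_diff_right inner_commute)
    show "dist (\<nu> (s0, u)) (\<Gamma> s0) \<le> dist (\<nu> (s0, u)) (\<Gamma> t) \<longleftrightarrow> a t \<bullet> u \<le> b t"
      "dist (\<nu> (s0, u)) (\<Gamma> t) \<le> dist (\<nu> (s0, u)) (\<Gamma> s0) \<longleftrightarrow> b t \<le> a t \<bullet> u"
      unfolding dist_norm norm_le diff v_def[symmetric] vd' vd by linarith+
  qed
  have clC: "closed C" and "convex C"
    unfolding C_def by (auto intro!: closed_INT closed_halfspace_le convex_INT convex_halfspace_le)
  have C_trans: "u \<in> transverse_set \<Gamma> L \<zeta> s0" if u: "u \<in> C" "u \<notin> frontier C" for u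
  proof -
    have "u \<in> interior C" using u clC by (simp add: frontier_def closure_closed)
    then obtain r where r: "r > 0" "ball u r \<subseteq> C" using mem_interior by blast
    \<comment> \<open>Keeps \<open>u + e *\<^sub>R u\<close> inside the ball; the summand
      \<open>1\<close> covers \<open>u = 0\<close>. If another parameter \<open>t\<close> were also
      nearest, then \<open>a t \<bullet> u \<ge> b t > 0\<close>, and this move away from the origin
      would leave the halfspace of \<open>t\<close>.\<close>
    define e where "e = r / (2 * (norm u + 1))"
    have e: "e > 0" using r(1) by (simp add: e_def add_nonneg_pos)
    have "norm (e *\<^sub>R u) < r"
    proof -
      have "e * norm u \<le> e * (norm u + 1)" using e by simp
      also have "\<dots> = r / 2" by (simp add: e_def add_nonneg_eq_0_iff field_simps)
      also have "\<dots> < r" using r(1) by simp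
      finally show ?thesis using e by simp
    qed
    then have "u + e *\<^sub>R u \<in> C" using r(2) by (auto simp: dist_norm)
    have only: "t = s0" if t: "t \<in> nearest (\<nu> (s0, u))" for t
    proof (rule ccontr)
      assume "t \<noteq> s0"
      have tL: "t \<in> {0..L}" using t by (simp add: nearest_def)
      then have "\<Gamma> t - \<Gamma> s0 \<noteq> 0" using inj_\<Gamma> s0' \<open>t \<noteq> s0\<close> by (auto dest: inj_onD)
      then have "b t > 0" by (simp add: b_def)
      have "dist (\<nu> (s0, u)) (\<Gamma> t) \<le> dist (\<nu> (s0, u)) (\<Gamma> s0)"
        using t s0' by (auto simp: nearest_def infdist_le)
      then have "b t \<le> a t \<bullet> u" unfolding closest' .
      moreover have "a t \<bullet> (u + e *\<^sub>R u) \<le> b t" using \<open>u + e *\<^sub>R u \<in> C\<close> tL by (simp add: C_def)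
      ultimately have "e * (a t \<bullet> u) \<le> 0" by (simp add: inner_add_right)
      moreover have "e * (a t \<bullet> u) > 0" using e \<open>b t > 0\<close> \<open>b t \<le> a t \<bullet> u\<close> by simp
      ultimately show False by simp
    qed
    have "ix (\<nu> (s0, u)) = s0" by (rule only[OF ix_nearest])
    with only show ?thesis unfolding transverse_set_iff amb_iff by simp
  qed
  have main: "(\<lambda>n. weight (S n, u)) \<longlonglongrightarrow> weight (s0, u)"
    if u: "u \<notin> frontier C" and S: "\<forall>n. S n \<in> {0<..<L}" "S \<longlonglongrightarrow> s0" for u S
  proof -
    have lim: "(\<lambda>n. f (S n, u)) \<longlonglongrightarrow> f (s0, u)" if "continuous_on ({0..L} \<times> UNIV) f"
      for f :: "real \<times> (real, 'n) vec \<Rightarrow> 'c::topological_space"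
      using S s0 by (intro continuous_on_tendsto_compose[OF that] tendsto_intros) (auto intro!: always_eventually less_imp_le)
    have lim_p: "(\<lambda>n. p (\<nu> (S n, u))) \<longlonglongrightarrow> p (\<nu> (s0, u))"
      using lim[OF continuous_on_compose2[OF continuous_p continuous_normal_map]] by simp
    consider "\<nu> (s0, u) \<notin> interior K" | "u \<in> C" "\<nu> (s0, u) \<in> interior K" | "u \<notin> C" by blast
    then show ?thesis
    proof cases
      case 1
      then have 0: "weight (s0, u) = 0" "p (\<nu> (s0, u)) = 0"
        by (auto simp: p_zero_outside weight_def)
      \<comment> \<open>Here the pairs may enter and leave \<open>tube\<close> at will, but
        \<open>weight\<close> is squeezed between zero and a continuous function that vanishes in
        the limit.\<close>
      have "(\<lambda>n. weight (S n, u)) \<longlonglongrightarrow> 0"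
        by (rule tendsto_sandwich[OF _ _ tendsto_const lim_p[unfolded 0(2)]])
          (auto intro!: always_eventually weight_nonneg simp: weight_def p_nonneg split: split_indicator)
      then show ?thesis using 0 by simp
    next
      case 2
      have "(s0, u) \<in> tube" using 2 C_trans[OF _ u] s0 by (simp add: tube_def)
      moreover have "(\<lambda>n. (S n, u)) \<longlonglongrightarrow> (s0, u)" using S by (intro tendsto_intros)
      ultimately have "\<forall>\<^sub>F n in sequentially. (S n, u) \<in> tube"
        using open_tube topological_tendstoD by blast
      then have "\<forall>\<^sub>F n in sequentially. p (\<nu> (S n, u)) = weight (S n, u)"
        by eventually_elim (simp add: weight_def)
      moreover have "weight (s0, u) = p (\<nu> (s0, u))" using \<open>(s0, u) \<in> tube\<close> by (simp add: weight_def)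
      ultimately show ?thesis using lim_p tendsto_cong by fastforce
    next
      case 3
      \<comment> \<open>Outside \<open>C\<close> some \<open>\<Gamma> t\<close> is strictly closer
        than \<open>\<Gamma> s0\<close>. The strict inequality persists for \<open>S n\<close> near
        \<open>s0\<close>, so these pairs are not in \<open>tube\<close>.\<close>
      then obtain t where t: "t \<in> {0..L}" "\<not> a t \<bullet> u \<le> b t" by (auto simp: C_def)
      have not_tube: "(s, u) \<notin> tube" if "dist (\<nu> (s, u)) (\<Gamma> t) < dist (\<nu> (s, u)) (\<Gamma> s)" for s
        using that dist_ix_le[OF t(1), of "\<nu> (s, u)"] tube_ix[of s u] by force
      have less: "dist (\<nu> (s0, u)) (\<Gamma> t) < dist (\<nu> (s0, u)) (\<Gamma> s0)"
        using t(2) unfolding closest[symmetric] by simp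
      have "(\<lambda>n. dist (\<nu> (S n, u)) (\<Gamma> (S n)) - dist (\<nu> (S n, u)) (\<Gamma> t)) \<longlonglongrightarrow>
          dist (\<nu> (s0, u)) (\<Gamma> s0) - dist (\<nu> (s0, u)) (\<Gamma> t)"
      proof (intro tendsto_intros lim[OF continuous_normal_map])
        show "(\<lambda>n. \<Gamma> (S n)) \<longlonglongrightarrow> \<Gamma> s0"
          using S(1) by (intro continuous_on_tendsto_compose[OF continuous_\<Gamma> S(2) s0'] always_eventually)
            (auto intro: less_imp_le)
      qed
      then have "\<forall>\<^sub>F n in sequentially. 0 < dist (\<nu> (S n, u)) (\<Gamma> (S n)) - dist (\<nu> (S n, u)) (\<Gamma> t)"
        by (rule order_tendstoD(1)) (use less in simp)
      then have "\<forall>\<^sub>F n in sequentially. weight (S n, u) = 0"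
        by eventually_elim (simp add: weight_def not_tube)
      moreover have "weight (s0, u) = 0"
        using not_tube[OF less] by (simp add: weight_def)
      ultimately show ?thesis by (simp add: tendsto_eventually)
    qed
  qed
  have "negligible (frontier C)" using \<open>convex C\<close> by (rule negligible_convex_frontier)
  then have "frontier C \<in> null_sets lborel"
    by (simp add: negligible_iff_null_sets null_sets_completion_iff)
  from AE_not_in[OF this] show ?thesis
    by eventually_elim (use main in blast)
qed

text \<open>Dominated convergence, with the pointwise limit from \<open>weight_tendsto\<close>. It
  allows the angle equation to be recovered at every parameter from a dense set of them.\<close>

lemma flux_zero_limit:
  assumes s0: "s0 \<in> {0<..<L}" and S: "\<And>n. S n \<in> {0<..<L}" "S \<longlonglongrightarrow> s0" "\<And>n. flux i (S n) = 0"
  shows "flux i s0 = 0"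
proof -
  obtain R P where RP: "0 \<le> R" "0 \<le> P" "\<And>s u. weight (s, u) \<noteq> 0 \<Longrightarrow> norm u \<le> R" "\<And>y. weight y \<le> P"
    by (rule weight_support) blast
  have "compact (curvature ` {0..L})" by (rule compact_continuous_image[OF continuous_curvature]) simp
  then obtain M where M: "\<And>s. s \<in> {0..L} \<Longrightarrow> norm (curvature s) \<le> M"
    using compact_imp_bounded bounded_iff by (metis imageI)
  have "(\<lambda>n. flux i (S n)) \<longlonglongrightarrow> flux i s0"
    unfolding flux_def
  proof (rule integral_dominated_convergence)
    have "continuous_on UNIV (\<lambda>u. jac (s, u))" for s
      unfolding jac_def by (auto intro!: continuous_intros)
    then have [measurable]: "(\<lambda>u. jac (s, u)) \<in> borel_measurable borel" for s
      by (rule borel_measurable_continuous_onI)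
    note [measurable] = weight_slice_measurable
    show "(\<lambda>u. u $ i * jac (s0, u) * weight (s0, u)) \<in> borel_measurable lborel"
      "(\<lambda>u. u $ i * jac (S n, u) * weight (S n, u)) \<in> borel_measurable lborel" for n
      by simp_all
    \<comment> \<open>On the support an entry of \<open>u\<close> is at most \<open>R\<close>, the
      Jacobian at most \<open>1 + R * M\<close> by Cauchy-Schwarz, and the weight at most
      \<open>P\<close>.\<close>
    show "integrable lborel (\<lambda>u. indicator (cball (0::(real, 'n) vec) R) u * (R * (1 + R * M) * P))"
      by (intro integrable_mult_left integrable_real_indicator) (auto intro: emeasure_lborel_cball_finite[unfolded infinity_ennreal_def])
    show "AE u in lborel. norm (u $ i * jac (S n, u) * weight (S n, u))
        \<le> indicator (cball (0::(real, 'n) vec) R) u * (R * (1 + R * M) * P)" for n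
    proof (rule AE_I2)
      fix u
      show "norm (u $ i * jac (S n, u) * weight (S n, u))
        \<le> indicator (cball (0::(real, 'n) vec) R) u * (R * (1 + R * M) * P)"
      proof (cases "weight (S n, u) = 0")
        case True
        have "norm (curvature 0) \<le> M" using M[of 0] L_pos by simp
        then have "0 \<le> M" by (rule order_trans[OF norm_ge_zero])
        then show ?thesis using True RP(1,2) by (simp split: split_indicator)
      next
        case False
        then have u: "norm u \<le> R" by (rule RP(3))
        have M': "norm (curvature (S n)) \<le> M" using M[of "S n"] S(1)[of n] by simp
        have "\<bar>u $ i\<bar> \<le> R" using u component_le_norm_cart[of u i] by linarith
        moreover have "\<bar>jac (S n, u)\<bar> \<le> 1 + R * M"
        proof -
          have "\<bar>u \<bullet> curvature (S n)\<bar> \<le> norm u * norm (curvature (S n))" by (rule Cauchy_Schwarz_ineq2)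
          also have "\<dots> \<le> R * M" using u M' RP(1) by (intro mult_mono) auto
          finally show ?thesis unfolding jac_def by simp
        qed
        moreover have "\<bar>weight (S n, u)\<bar> \<le> P" using RP(4) weight_nonneg by simp
        ultimately have "\<bar>u $ i\<bar> * \<bar>jac (S n, u)\<bar> * \<bar>weight (S n, u)\<bar> \<le> R * (1 + R * M) * P"
          using RP(1) by (intro mult_mono) auto
        then show ?thesis using u by (simp add: abs_mult)
      qed
    qed
    show "AE u in lborel. (\<lambda>n. u $ i * jac (S n, u) * weight (S n, u)) \<longlonglongrightarrow> u $ i * jac (s0, u) * weight (s0, u)"
      using weight_tendsto[OF s0]
    proof eventually_elim
      case (elim u)
      have "(\<lambda>n. jac (S n, u)) \<longlonglongrightarrow> jac (s0, u)"
        using S(1,2) s0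
        by (intro continuous_on_tendsto_compose[OF continuous_jac] tendsto_intros) (auto intro!: always_eventually less_imp_le)
      then show ?case using elim S(1,2) by (intro tendsto_intros) auto
    qed
  qed
  then show ?thesis using S(3) LIMSEQ_unique[OF _ tendsto_const] by simp
qed

end

section \<open>Self-consistency and the differential equations\<close>

text \<open>Tested on the sets where \<open>G\<close> is nonnegative and where it is nonpositive,
  the integrand has constant sign, and a zero integral forces it to vanish almost
  everywhere.\<close>

lemma AE_zero_of_integrals_zero:
  fixes G :: "'a \<Rightarrow> real"
  assumes G: "integrable M G"
    and zero: "\<And>B. B \<in> sets M \<Longrightarrow> (\<integral>s. indicator B s * G s \<partial>M) = 0"
  shows "AE s in M. G s = 0"
proof -
  have [measurable]: "G \<in> borel_measurable M" using G by simp
  have *: "AE s in M. indicator B s * H s = 0"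
    if B: "B = {s \<in> space M. 0 \<le> H s}" and H: "H = G \<or> H = (\<lambda>s. - G s)" for B H
  proof -
    have [measurable]: "H \<in> borel_measurable M" using H by auto
    have "B \<in> sets M" unfolding B by measurable
    moreover have "integrable M H" using H G by auto
    ultimately have "integrable M (\<lambda>s. indicator B s * H s)"
      using integrable_mult_indicator[of B M H] by simp
    moreover have "AE s in M. 0 \<le> indicator B s * H s"
      by (rule AE_I2) (simp add: B split: split_indicator)
    moreover have "(\<integral>s. indicator B s * H s \<partial>M) = 0"
      using zero[OF \<open>B \<in> sets M\<close>] H by auto
    ultimately show ?thesis by (simp add: integral_nonneg_eq_0_iff_AE)
  qed
  have "AE s in M. indicator {s \<in> space M. 0 \<le> G s} s * G s = 0"
    "AE s in M. indicator {s \<in> space M. 0 \<le> - G s} s * - G s = 0"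
    by (rule *; simp)+
  with AE_space show ?thesis
    by eventually_elim (auto split: split_indicator_asm)
qed

context framed_curve_density
begin

text \<open>Outside \<open>{0..L}\<close> nothing is known about \<Gamma>. Clamping the parameter
  gives a continuous function on the line that agrees with \<Gamma> at all projection
  indices.\<close>

lemma continuous_clamped_\<Gamma>: "continuous_on UNIV (\<lambda>s. \<Gamma> (max 0 (min L s)))"
  using L_pos by (intro continuous_on_compose2[OF continuous_\<Gamma>] continuous_intros) auto

lemma clamped_ix: "\<Gamma> (max 0 (min L (ix x))) = \<Gamma> (ix x)"
  using ix_in[of x] by simp

lemma \<Gamma>_ix_measurable [measurable]: "(\<lambda>x. \<Gamma> (ix x)) \<in> borel_measurable borel"
  using measurable_compose[OF ix_measurable borel_measurable_continuous_onI[OF continuous_clamped_\<Gamma>]]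
  by (simp add: clamped_ix)

lemma p_measurable [measurable]: "p \<in> borel_measurable borel"
  using continuous_p by (rule borel_measurable_continuous_onI)

section \<open>Integrals of the deviation from the projection\<close>

lemma integrable_bounded_on_K:
  fixes g :: "real ^ 'n option \<Rightarrow> real"
  assumes [measurable]: "g \<in> borel_measurable borel" and R: "\<And>x. x \<in> K \<Longrightarrow> \<bar>g x\<bar> \<le> R"
  shows "integrable lborel (\<lambda>x. g x * p x)"
proof -
  obtain R' P where P: "0 \<le> P" "\<And>x. p x \<le> P" by (rule bounds) blast
  have cK: "compact K" using K_region by (simp add: compact_region_def)
  have "0 \<le> R" using R K_region by (force simp: compact_region_def intro: order_trans[OF abs_ge_zero])
  show ?thesis
  proof (rule Bochner_Integration.integrable_bound)
    show "integrable lborel (\<lambda>x. indicator K x * (R * P))"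
      using emeasure_bounded_finite[OF compact_imp_bounded[OF cK]] borel_compact[OF cK]
      by (intro integrable_mult_left integrable_real_indicator) auto
    show "(\<lambda>x. g x * p x) \<in> borel_measurable lborel" by simp
    show "AE x in lborel. norm (g x * p x) \<le> norm (indicator K x * (R * P))"
    proof (rule AE_I2)
      fix x
      show "norm (g x * p x) \<le> norm (indicator K x * (R * P))"
      proof (cases "x \<in> K")
        case True
        have "\<bar>g x\<bar> * p x \<le> R * P" using R[OF True] P p_nonneg \<open>0 \<le> R\<close> by (intro mult_mono) auto
        then show ?thesis using True P(1) \<open>0 \<le> R\<close> p_nonneg by (simp add: abs_mult)
      next
        case False
        then have "p x = 0" using p_zero_outside interior_subset by blast
        then show ?thesis by simp
      qed
    qed
  qed
qed

text \<open>Integrated against \<open>p\<close>, this is the expectation of the \<open>k\<close>-th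
  entry of \<open>X - \<Gamma> Z\<close> on the event that the projection index \<open>Z\<close> of
  \<open>X\<close> lies in \<open>B\<close>.\<close>

definition deviation :: "'n option \<Rightarrow> real set \<Rightarrow> real ^ 'n option \<Rightarrow> real" where
  "deviation k B x = indicator B (ix x) * (x - \<Gamma> (ix x)) $ k"

lemma deviation_measurable: "B \<in> sets borel \<Longrightarrow> deviation k B \<in> borel_measurable borel"
proof -
  assume "B \<in> sets borel"
  then have "(\<lambda>x. indicator B (ix x) :: real) \<in> borel_measurable borel"
    by (intro measurable_compose[OF ix_measurable] borel_measurable_indicator)
  moreover have "(\<lambda>v. v $ k) \<in> borel_measurable (borel :: (real ^ 'n option) measure)"
    by (intro borel_measurable_continuous_onI continuous_intros)
  then have "(\<lambda>x. (x - \<Gamma> (ix x)) $ k) \<in> borel_measurable borel"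
    by (rule measurable_compose[rotated]) simp
  ultimately show ?thesis unfolding deviation_def[abs_def] by (rule borel_measurable_times)
qed

lemma integrable_deviation:
  assumes "B \<in> sets borel"
  shows "integrable lborel (\<lambda>x. deviation k B x * p x)"
proof -
  obtain R P where R: "\<And>x s. x \<in> K \<Longrightarrow> s \<in> {0..L} \<Longrightarrow> norm (x - \<Gamma> s) \<le> R" by (rule bounds) blast
  show ?thesis
  proof (rule integrable_bounded_on_K[OF deviation_measurable[OF assms]])
    fix x assume "x \<in> K"
    then have "\<bar>(x - \<Gamma> (ix x)) $ k\<bar> \<le> R"
      by (intro order_trans[OF component_le_norm_cart R[OF _ ix_in]])
    moreover from this have "0 \<le> R" by linarith
    ultimately show "\<bar>deviation k B x\<bar> \<le> R"
      by (simp add: deviation_def abs_mult split: split_indicator)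
  qed
qed

lemma deviation_tube:
  assumes "(s, u) \<in> tube"
  shows "deviation k B (\<nu> (s, u)) = indicator B s * (\<Sum>i\<in>UNIV. N i s $ k * u $ i)"
proof -
  have "(\<nu> (s, u) - \<Gamma> s) $ k = (\<Sum>i\<in>UNIV. N i s $ k * u $ i)"
    by (simp add: normal_map_apply mult.commute)
  then show ?thesis by (simp only: deviation_def tube_ix[OF assms])
qed

text \<open>The flux vector in ambient instead of normal coordinates. It is the density in
  \<open>s\<close> of the deviation integrals.\<close>

definition drift :: "'n option \<Rightarrow> real \<Rightarrow> real" where
  "drift k s = (\<Sum>i\<in>UNIV. N i s $ k * flux i s)"

lemma drift_outside: "s \<notin> {0<..<L} \<Longrightarrow> drift k s = 0"
proof -
  assume "s \<notin> {0<..<L}"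
  then have "weight (s, u) = 0" for u using tube_in[of s u] by (auto simp: weight_def split: split_indicator)
  then show ?thesis by (simp add: drift_def flux_def)
qed

text \<open>Substitute \<open>x = \<nu> (s, u)\<close> and integrate over \<open>u\<close> first:
  the indicator and the normals depend on \<open>s\<close> alone, and the inner integrals of the
  normal coordinates against \<open>jac\<close> and \<open>weight\<close> are the fluxes.\<close>

lemma integral_deviation:
  assumes B: "B \<in> sets borel"
  shows "integrable lborel (\<lambda>s. indicator B s * drift k s)"
    and "(\<integral>x. deviation k B x * p x \<partial>lborel) = (\<integral>s. indicator B s * drift k s \<partial>lborel)"
proof -
  note [measurable] = B
  define f where "f x = deviation k B x * p x" for x
  have f: "f \<in> borel_measurable borel" "integrable lborel f"
    unfolding f_def using integrable_deviation[OF B] deviation_measurable[OF B] by simp_all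
  define N' where "N' i s = vector_derivative (\<lambda>s. N i s) (at s)" for i s
  have N': "((\<lambda>s. N i s) has_vector_derivative N' i s) (at s)" "T s \<bullet> N' i s = - curvature s $ i"
    if s: "s \<in> {0<..<L}" for s i
  proof -
    obtain d where d: "((\<lambda>s. N i s) has_vector_derivative d) (at s)" "T s \<bullet> d = - curvature s $ i"
      by (rule N_differentiable[OF s, of i])
    then have "N' i s = d" unfolding N'_def by (intro vector_derivative_at)
    with d show "((\<lambda>s. N i s) has_vector_derivative N' i s) (at s)" "T s \<bullet> N' i s = - curvature s $ i"
      by simp_all
  qed
  have eq: "indicator tube y * (jac y * f (\<nu> y)) =
      indicator B (fst y) * (\<Sum>i\<in>UNIV. N i (fst y) $ k * (snd y $ i * jac y * weight y))" for y
  proof (cases "y \<in> tube")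
    case True
    obtain s u where y: "y = (s, u)" by (cases y)
    have "(\<Sum>i\<in>UNIV. N i s $ k * (u $ i * jac y * weight y)) = (\<Sum>i\<in>UNIV. N i s $ k * u $ i) * (jac y * weight y)"
      by (simp only: sum_distrib_right mult.assoc)
    then show ?thesis using True by (simp add: f_def y deviation_tube weight_def)
  qed (simp add: weight_def)
  have meas: "(\<lambda>y. indicator tube y * (jac y * f (\<nu> y))) \<in> borel_measurable borel"
  proof -
    have "continuous_on tube (\<lambda>y. jac y * (\<nu> y - \<Gamma> (fst y)) $ k * p (\<nu> y))"
      by (intro continuous_intros continuous_on_tube continuous_on_compose2[OF continuous_p]
          continuous_on_compose2[OF continuous_\<Gamma>]) (auto simp: tube_def less_imp_le)
    from borel_measurable_continuous_on_indicator[OF _ this]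
    have [measurable]: "(\<lambda>y. indicator tube y *\<^sub>R (jac y * (\<nu> y - \<Gamma> (fst y)) $ k * p (\<nu> y))) \<in> borel_measurable borel"
      using open_tube by simp
    \<comment> \<open>On \<open>tube\<close> the projection index of \<open>\<nu> y\<close> is
      \<open>fst y\<close>, so the discontinuous indicator of \<open>B\<close> depends on the first
      coordinate only and the other factor is continuous on the open set.\<close>
    have "(\<lambda>y. indicator tube y * (jac y * f (\<nu> y))) =
        (\<lambda>y. indicator B (fst y) * (indicator tube y *\<^sub>R (jac y * (\<nu> y - \<Gamma> (fst y)) $ k * p (\<nu> y))))"
      by (auto simp: f_def deviation_def tube_ix fun_eq_iff split: split_indicator)
    also have "\<dots> \<in> borel_measurable borel"
    proof -
      have "fst \<in> borel_measurable (borel :: (real \<times> (real, 'n) vec) measure)"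
        by (intro borel_measurable_continuous_onI continuous_intros)
      then have [measurable]: "(\<lambda>y. indicator B (fst y) :: real) \<in> borel_measurable (borel :: (real \<times> (real, 'n) vec) measure)"
        using B by (intro measurable_compose[of fst borel borel "indicator B"]) auto
      show ?thesis by measurable
    qed
    finally show ?thesis .
  qed
  have amb0: "amb \<in> null_sets lborel"
    using negligible_amb borel_amb by (simp add: negligible_iff_null_sets null_sets_completion_iff)
  \<comment> \<open>The image of \<open>tube\<close> misses only a null set of ambiguity points and
    the complement of the interior of \<open>K\<close>, where \<open>p\<close> vanishes.\<close>
  have AE_eq: "AE x in lborel. indicator (\<nu> ` tube) x * f x = f x"
    using AE_not_in[OF amb0]
    by eventually_elim (auto simp: normal_map_tube f_def p_zero_outside split: split_indicator)
  have tube_borel: "\<nu> ` tube \<in> sets borel"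
    unfolding normal_map_tube using borel_amb by (intro sets.Diff) auto
  have if': "integrable lborel (\<lambda>x. indicator (\<nu> ` tube) x * f x)"
    using integrable_mult_indicator[of "\<nu> ` tube" lborel f] tube_borel f(2) by simp
  have cov: "integrable lborel (\<lambda>y. indicator tube y * (jac y * f (\<nu> y)))"
    "(\<integral>y. indicator tube y * (jac y * f (\<nu> y)) \<partial>lborel) = (\<integral>x. indicator (\<nu> ` tube) x * f x \<partial>lborel)"
  proof -
    note c = change_of_variables_frame[where S = tube and c = \<Gamma> and N = "\<lambda>i s. N i s" and T = T and N' = N'
        and J = jac and f = f, folded normal_map_def]
    have at: "at s within {0..L} = at s" if "s \<in> {0<..<L}" for s
      using that at_within_interior[of s "{0..L}"] by auto
    have sI: "s \<in> {0<..<L}" "s \<in> {0..L}" if "(s, u) \<in> tube" for s u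
      using tube_in[OF that] by auto
    have dG: "(\<Gamma> has_vector_derivative T s) (at s)" if "(s, u) \<in> tube" for s u
      using \<Gamma>_deriv[of s] sI[OF that] at by simp
    have j: "jac (s, u) = 1 + (\<Sum>i\<in>UNIV. u $ i * (T s \<bullet> N' i s))" if "(s, u) \<in> tube" for s u
      using sI[OF that] by (simp add: jac_def N'(2) inner_vec_def[of u] sum_negf)
    have jp: "0 \<le> jac y" if "y \<in> tube" for y
      using jac_pos that by (cases y) (auto intro: less_imp_le)
    note c' = c[OF open_tube tube_borel inj_on_tube dG N'(1)[OF sI(1)] inner_sph_self inner_sph_sph_normal
        inner_sph_normal[OF \<zeta>_frame[OF sI(2)]] j jp f(1) if' meas]
    show "integrable lborel (\<lambda>y. indicator tube y * (jac y * f (\<nu> y)))"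
      "(\<integral>y. indicator tube y * (jac y * f (\<nu> y)) \<partial>lborel) = (\<integral>x. indicator (\<nu> ` tube) x * f x \<partial>lborel)"
      using c' by - assumption+
  qed
  have slice: "(\<integral>u. indicator tube (s, u) * (jac (s, u) * f (\<nu> (s, u))) \<partial>lborel) = indicator B s * drift k s" for s
  proof -
    have "continuous_on UNIV (\<lambda>u. u $ i * jac (s, u))" for i
      unfolding jac_def by (auto intro!: continuous_intros)
    then have int: "integrable lborel (\<lambda>u. N i s $ k * (u $ i * jac (s, u) * weight (s, u)))" for i
      by (intro integrable_mult_right integrable_weight)
    show ?thesis
      by (simp only: eq fst_conv snd_conv drift_def flux_def integral_mult_right_zero
          Bochner_Integration.integral_sum[OF int])
  qed
  have int: "integrable (lborel \<Otimes>\<^sub>M lborel) (\<lambda>y. indicator tube y * (jac y * f (\<nu> y)))"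
    using cov(1) by (simp add: lborel_prod)
  show "integrable lborel (\<lambda>s. indicator B s * drift k s)"
    using lborel_pair.integrable_fst'[OF int] by (simp add: slice)
  have "(\<integral>x. deviation k B x * p x \<partial>lborel) = (\<integral>x. indicator (\<nu> ` tube) x * f x \<partial>lborel)"
    unfolding f_def[symmetric] using AE_eq f(1) borel_measurable_integrable[OF if']
    by (intro integral_cong_AE) (auto elim: AE_mp)
  also have "\<dots> = (\<integral>y. indicator tube y * (jac y * f (\<nu> y)) \<partial>(lborel \<Otimes>\<^sub>M lborel))"
    using cov(2) by (simp add: lborel_prod)
  also have "\<dots> = (\<integral>s. indicator B s * drift k s \<partial>lborel)"
    using lborel_pair.integral_fst'[OF int] by (simp add: slice)
  finally show "(\<integral>x. deviation k B x * p x \<partial>lborel) = (\<integral>s. indicator B s * drift k s \<partial>lborel)" .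
qed

lemma flux_zero_of_drift:
  assumes "s \<in> {0<..<L}" "\<And>k. drift k s = 0"
  shows "flux i s = 0"
proof -
  have s: "s \<in> {0..L}" using assms by simp
  have "(\<Sum>j\<in>UNIV. flux j s *\<^sub>R N j s) = 0"
    using assms(2) by (simp add: vec_eq_iff drift_def mult.commute)
  then have "(\<Sum>j\<in>UNIV. flux j s *\<^sub>R N j s) \<bullet> N i s = 0" by simp
  then show ?thesis
    by (simp add: inner_sum_left inner_sph_normal[OF \<zeta>_frame[OF s]] if_distrib cong: if_cong)
qed

text \<open>Zero integrals over all Borel sets give zero drift for almost every \<open>s\<close>,
  hence on a dense set of parameters. Orthonormality of the normals passes this on to the flux, and
  \<open>flux_zero_limit\<close> fills in the remaining parameters.\<close>

lemma integrals_zero_iff_flux: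
  "(\<forall>B\<in>sets borel. \<forall>k. (\<integral>x. deviation k B x * p x \<partial>lborel) = 0) \<longleftrightarrow>
   (\<forall>s\<in>{0<..<L}. \<forall>i. flux i s = 0)"
proof
  assume "\<forall>s\<in>{0<..<L}. \<forall>i. flux i s = 0"
  then have "drift k s = 0" for k s
    using drift_outside[of s k] by (cases "s \<in> {0<..<L}") (auto simp: drift_def)
  then show "\<forall>B\<in>sets borel. \<forall>k. (\<integral>x. deviation k B x * p x \<partial>lborel) = 0"
    by (simp add: integral_deviation)
next
  assume zero: "\<forall>B\<in>sets borel. \<forall>k. (\<integral>x. deviation k B x * p x \<partial>lborel) = 0"
  have "AE s in lborel. drift k s = 0" for k
  proof (rule AE_zero_of_integrals_zero)
    show "integrable lborel (drift k)" using integral_deviation(1)[of UNIV k] by simp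
    show "(\<integral>s. indicator B s * drift k s \<partial>lborel) = 0" if "B \<in> sets lborel" for B
      using zero integral_deviation(2)[of B k] that by simp
  qed
  then have ae: "AE s in lborel. \<forall>k. drift k s = 0" by (simp add: AE_all_countable)
  show "\<forall>s\<in>{0<..<L}. \<forall>i. flux i s = 0"
  proof (intro ballI allI)
    fix s0 i assume s0: "s0 \<in> {0<..<L}"
    \<comment> \<open>Otherwise the exceptional null set would contain a nonempty open
      interval.\<close>
    have "\<exists>s. s \<in> {0<..<L} \<and> dist s s0 < e \<and> (\<forall>k. drift k s = 0)" if "e > 0" for e
    proof (rule ccontr)
      assume *: "\<not> ?thesis"
      define U where "U = {0<..<L} \<inter> ball s0 e"
      have "open U" "s0 \<in> U" using s0 that by (auto simp: U_def)
      then have "\<not> negligible U" using open_not_negligible by blast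
      moreover have "AE s in lborel. s \<notin> U"
        using ae by eventually_elim (use * in \<open>auto simp: U_def dist_commute\<close>)
      then have "U \<in> null_sets lborel"
        using \<open>open U\<close> by (subst AE_iff_null_sets) auto
      then have "negligible U" by (simp add: negligible_iff_null_sets null_sets_completionI)
      ultimately show False by blast
    qed
    then have "\<forall>n. \<exists>s. s \<in> {0<..<L} \<and> dist s s0 < inverse (real (Suc n)) \<and> (\<forall>k. drift k s = 0)" by simp
    then obtain S where S: "\<And>n. S n \<in> {0<..<L}" "\<And>n. dist (S n) s0 < inverse (real (Suc n))"
      "\<And>n k. drift k (S n) = 0" by metis
    have "\<forall>\<^sub>F n in sequentially. norm (dist (S n) s0) \<le> inverse (real (Suc n))"
      by (rule always_eventually) (simp only: real_norm_def abs_of_nonneg zero_le_dist less_imp_le[OF S(2)] simp_thms)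
    then have "S \<longlonglongrightarrow> s0"
      unfolding tendsto_dist_iff[of S] by (rule Lim_null_comparison[OF _ LIMSEQ_inverse_real_of_nat])
    then show "flux i s0 = 0"
      by (rule flux_zero_limit[OF s0 S(1)]) (rule flux_zero_of_drift[OF S(1) S(3)])
  qed
qed

end

text \<open>Removes the inverses from the differential equation, so that only trivial kernels have
  to be checked.\<close>

lemma matrix_inv_vec_iff:
  fixes A :: "real ^ 'm ^ 'm"
  assumes "\<And>x. A *v x = 0 \<Longrightarrow> x = 0"
  shows "matrix_inv A *v x = y \<longleftrightarrow> x = A *v y"
proof -
  obtain B where B: "B ** A = mat 1" using assms matrix_left_invertible_ker by blast
  then have "A ** B = mat 1" using matrix_left_right_inverse by blast
  \<comment> \<open>\<open>matrix_inv\<close> is defined by choice, so a two-sided inverse has to be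
    exhibited first.\<close>
  with B have "\<exists>B. A ** B = mat 1 \<and> B ** A = mat 1" by blast
  then have inv: "A ** matrix_inv A = mat 1" "matrix_inv A ** A = mat 1"
    unfolding matrix_inv_def by (rule someI2_ex; blast)+
  show ?thesis
  proof
    assume "matrix_inv A *v x = y"
    then have "A *v y = (A ** matrix_inv A) *v x" by (simp only: matrix_vector_mul_assoc[symmetric])
    then show "x = A *v y" by (simp only: inv matrix_vector_mul_lid)
  next
    assume "x = A *v y"
    then show "matrix_inv A *v x = y" by (simp only: matrix_vector_mul_assoc inv matrix_vector_mul_lid)
  qed
qed

context framed_curve_density
begin

section \<open>Nondegeneracy of the second moments and the angle equation\<close>

lemma integral_quadratic:
  "(\<integral>u. (u \<bullet> a)\<^sup>2 * weight (s, u) \<partial>lborel) = (\<Sum>i\<in>UNIV. \<Sum>j\<in>UNIV. a $ i * a $ j * moment2 i j s)"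
proof -
  have int: "integrable lborel (\<lambda>u. a $ i * a $ j * (u $ i * u $ j * weight (s, u)))" for i j
    by (intro integrable_mult_right integrable_weight continuous_intros)
  have "(u \<bullet> a)\<^sup>2 * weight (s, u) = (\<Sum>i\<in>UNIV. \<Sum>j\<in>UNIV. a $ i * a $ j * (u $ i * u $ j * weight (s, u)))" for u
  proof -
    have "(u \<bullet> a)\<^sup>2 = (\<Sum>i\<in>UNIV. \<Sum>j\<in>UNIV. u $ i * a $ i * (u $ j * a $ j))"
      by (simp only: power2_eq_square inner_vec_def inner_real_def sum_product)
    then show ?thesis by (simp only: sum_distrib_right) (simp only: mult_ac)
  qed
  then show ?thesis
    unfolding moment2_def
    by (simp only: Bochner_Integration.integral_sum[OF int] Bochner_Integration.integral_sum[OF Bochner_Integration.integrable_sum[OF int]]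
        integral_mult_right_zero)
qed

lemma weight_AE_zero:
  assumes "mass s = 0"
  shows "AE u in lborel. weight (s, u) = 0"
proof -
  have "integrable lborel (\<lambda>u. weight (s, u))" using integrable_weight[of "\<lambda>_. 1" s] by simp
  then show ?thesis
    using assms integral_nonneg_eq_0_iff_AE[of lborel "\<lambda>u. weight (s, u)"] weight_nonneg by (simp add: mass_def)
qed

text \<open>Closes the gap at parameters without transverse density: the system demands nothing
  there, and the flux condition holds automatically.\<close>

lemma flux_mass_zero:
  assumes "mass s = 0"
  shows "flux i s = 0"
proof -
  have "AE u in lborel. u $ i * jac (s, u) * weight (s, u) = 0"
    using weight_AE_zero[OF assms] by eventually_elim simp
  then show ?thesis unfolding flux_def by (rule integral_eq_zero_AE)
qed

text \<open>For \<open>a\<close> in the kernel the quadratic form, which is the integral of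
  \<open>(u \<bullet> a)\<^sup>2\<close> against the weight, is zero. For nonzero \<open>a\<close>
  the weight would then vanish off a hyperplane, hence almost everywhere, and the mass would be
  zero.\<close>

lemma second_moment_kernel:
  assumes mass: "mass s \<noteq> 0" and ker: "(\<chi> i j. moment2 i j s / mass s) *v a = 0"
  shows "a = 0"
proof (rule ccontr)
  assume "a \<noteq> 0"
  have "(\<Sum>j\<in>UNIV. moment2 i j s * a $ j) = 0" for i
  proof -
    have "((\<chi> i j. moment2 i j s / mass s) *v a) $ i = 0" using ker by simp
    then have "(\<Sum>j\<in>UNIV. moment2 i j s * a $ j / mass s) = 0"
      by (simp add: matrix_vector_mult_def)
    then show ?thesis using mass by (simp add: sum_divide_distrib[symmetric])
  qed
  moreover have "(\<Sum>j\<in>UNIV. a $ i * a $ j * moment2 i j s) = a $ i * (\<Sum>j\<in>UNIV. moment2 i j s * a $ j)" for i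
    by (simp add: sum_distrib_left mult_ac)
  ultimately have "(\<integral>u. (u \<bullet> a)\<^sup>2 * weight (s, u) \<partial>lborel) = 0"
    by (simp add: integral_quadratic)
  moreover have "integrable lborel (\<lambda>u. (u \<bullet> a)\<^sup>2 * weight (s, u))"
    by (intro integrable_weight continuous_intros)
  ultimately have "AE u in lborel. (u \<bullet> a)\<^sup>2 * weight (s, u) = 0"
    using integral_nonneg_eq_0_iff_AE[of lborel "\<lambda>u. (u \<bullet> a)\<^sup>2 * weight (s, u)"] weight_nonneg by simp
  moreover have "AE u in lborel. u \<bullet> a \<noteq> 0"
  proof -
    have "closed {u. a \<bullet> u = 0}" by (rule closed_hyperplane)
    then have "{u. a \<bullet> u = 0} \<in> null_sets lborel"
      using negligible_hyperplane[of a 0] \<open>a \<noteq> 0\<close>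
      by (simp add: negligible_iff_null_sets null_sets_completion_iff)
    from AE_not_in[OF this] show ?thesis by eventually_elim (simp add: inner_commute)
  qed
  ultimately have "AE u in lborel. weight (s, u) = 0" by eventually_elim simp
  then have "mass s = 0" unfolding mass_def by (rule integral_eq_zero_AE)
  with mass show False by simp
qed

lemma frame_diag_mult: "frame_diag (\<zeta> s) *v x = (\<chi> i. norm (sph_partial i (\<zeta> s)) * x $ i)"
  by (simp add: frame_diag_def matrix_vector_mult_def vec_eq_iff if_distrib[of "\<lambda>c. c * _"] cong: if_cong)

text \<open>Clearing both inverses leaves \<open>v = S *v curvature s\<close>, which multiplied by
  the mass says that all fluxes vanish.\<close>

lemma angle_equation_iff:
  assumes s: "s \<in> {0<..<L}" and mass: "mass s \<noteq> 0"
  shows "(let v = transverse_mean p \<Gamma> L \<zeta> s; C = transverse_cov p \<Gamma> L \<zeta> s in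
      (\<zeta> has_vector_derivative matrix_inv (frame_diag (\<zeta> s)) *v (matrix_inv (C + outer v v) *v v))
        (at s within {0..L})) \<longleftrightarrow> (\<forall>i. flux i s = 0)"
proof -
  define v where "v = transverse_mean p \<Gamma> L \<zeta> s"
  define S where "S = transverse_cov p \<Gamma> L \<zeta> s + outer v v"
  have sL: "s \<in> {0..L}" using s by simp
  have v: "v = (\<chi> i. moment1 i s / mass s)"
    by (simp add: v_def transverse_mean_def transverse_moments[OF s])
  \<comment> \<open>Adding \<open>outer v v\<close> undoes the centering in the covariance, so
    \<open>S\<close> is the matrix of raw second moments.\<close>
  have S: "S = (\<chi> i j. moment2 i j s / mass s)"
    by (simp add: S_def v_def transverse_cov_def transverse_moments[OF s])
  have der: "(\<zeta> has_vector_derivative w) (at s within {0..L}) \<longleftrightarrow> w = \<zeta>' s" for w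
    using \<zeta>_deriv[OF sL] vector_derivative_within_closed_interval[OF L_pos sL, of \<zeta> w] \<zeta>'_def by auto
  have D: "x = 0" if "frame_diag (\<zeta> s) *v x = 0" for x
  proof -
    have "norm (sph_partial i (\<zeta> s)) * x $ i = 0" for i
      using arg_cong[OF that, of "\<lambda>v. v $ i"] by (simp add: frame_diag_mult)
    then have "x $ i = 0" for i
      using sph_partial_nonzero[OF \<zeta>_frame[OF sL]] by (metis mult_eq_0_iff norm_eq_zero)
    then show ?thesis by (simp add: vec_eq_iff)
  qed
  have curv: "frame_diag (\<zeta> s) *v \<zeta>' s = curvature s"
    by (simp add: frame_diag_mult curvature_def)
  have "(\<zeta> has_vector_derivative matrix_inv (frame_diag (\<zeta> s)) *v (matrix_inv S *v v)) (at s within {0..L})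
      \<longleftrightarrow> v = S *v curvature s"
  proof -
    have "matrix_inv (frame_diag (\<zeta> s)) *v (matrix_inv S *v v) = \<zeta>' s
        \<longleftrightarrow> matrix_inv S *v v = frame_diag (\<zeta> s) *v \<zeta>' s"
      by (rule matrix_inv_vec_iff) (rule D)
    moreover have "matrix_inv S *v v = curvature s \<longleftrightarrow> v = S *v curvature s"
      by (rule matrix_inv_vec_iff) (use second_moment_kernel[OF mass] in \<open>simp add: S\<close>)
    ultimately show ?thesis by (simp only: der curv)
  qed
  also have "\<dots> \<longleftrightarrow> (\<forall>i. moment1 i s / mass s = (\<Sum>j\<in>UNIV. moment2 i j s * curvature s $ j) / mass s)"
    by (simp add: v S vec_eq_iff matrix_vector_mult_def sum_divide_distrib)
  also have "\<dots> \<longleftrightarrow> (\<forall>i. flux i s = 0)"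
    using mass by (simp add: flux_eq)
  finally show ?thesis by (simp add: Let_def v_def S_def)
qed

text \<open>The tangent equation is part of the setting, end points drop out because their moments
  are zero, and interior parameters of zero mass are covered by
  \<open>flux_mass_zero\<close>.\<close>

lemma solves_system_iff: "solves_system p L \<Gamma> \<zeta> \<longleftrightarrow> (\<forall>s\<in>{0<..<L}. \<forall>i. flux i s = 0)"
proof -
  have "solves_system p L \<Gamma> \<zeta> \<longleftrightarrow> (\<forall>s\<in>{0<..<L}. mass s \<noteq> 0 \<longrightarrow>
     (let v = transverse_mean p \<Gamma> L \<zeta> s; C = transverse_cov p \<Gamma> L \<zeta> s in
      (\<zeta> has_vector_derivative matrix_inv (frame_diag (\<zeta> s)) *v (matrix_inv (C + outer v v) *v v))
        (at s within {0..L})))"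
    unfolding solves_system_def
    using \<Gamma>_deriv transverse_moment_end transverse_moments(1)
    by (metis atLeastAtMost_iff greaterThanLessThan_iff less_imp_le)
  then show ?thesis using angle_equation_iff flux_mass_zero by metis
qed

text \<open>The sigma-algebra generated by the projection index \<open>Z\<close> consists of the
  preimages of Borel sets \<open>B\<close>. Testing the conditional expectation on these events
  compares the integrals of \<open>X\<close> and \<open>\<Gamma> Z\<close>, whose difference is a
  deviation integral.\<close>

lemma self_consistent_iff:
  fixes M :: "'w measure" and X :: "'w \<Rightarrow> real ^ ('n option)"
  assumes M: "prob_space M" and X: "distributed M lborel X (\<lambda>x. ennreal (p x))"
  shows "self_consistent M X \<Gamma> L \<longleftrightarrow>
    (\<forall>B\<in>sets borel. \<forall>k. (\<integral>x. deviation k B x * p x \<partial>lborel) = 0)"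
proof -
  interpret prob_space M by fact
  define Z where "Z \<omega> = ix (X \<omega>)" for \<omega>
  define F where "F = vimage_algebra (space M) Z borel"
  have [measurable]: "X \<in> borel_measurable M"
    using distributed_measurable[OF X] by simp
  have Z_meas [measurable]: "Z \<in> borel_measurable M" unfolding Z_def by measurable
  have Z_F: "Z \<in> measurable F borel"
    unfolding F_def by (rule measurable_vimage_algebra1) simp
  have sets_F: "sets F = {Z -` B \<inter> space M | B. B \<in> sets borel}"
    unfolding F_def by (rule sets_vimage_algebra2) simp
  have subalg: "subalgebra M F"
    unfolding subalgebra_def sets_F using measurable_sets[OF Z_meas] by (auto simp: F_def)
  interpret F: finite_measure_subalgebra M F
    by unfold_locales (rule subalg)
  have nth [measurable]: "(\<lambda>v. v $ k) \<in> borel_measurable (borel :: (real ^ 'n option) measure)" for k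
    by (intro borel_measurable_continuous_onI continuous_intros)
  have transfer: "integrable M (\<lambda>\<omega>. g (X \<omega>))" "(\<integral>\<omega>. g (X \<omega>) \<partial>M) = (\<integral>x. g x * p x \<partial>lborel)"
    if "g \<in> borel_measurable borel" "integrable lborel (\<lambda>x. g x * p x)" for g :: "real ^ 'n option \<Rightarrow> real"
    using distributed_integrable[OF X, of g] distributed_integral[OF X, of g] that p_nonneg
    by (simp_all add: mult.commute)
  have "bounded K" using K_region by (simp add: compact_region_def compact_imp_bounded)
  then obtain R where "\<forall>x\<in>K. norm x \<le> R" unfolding bounded_iff by blast
  then have R: "norm x \<le> R" if "x \<in> K" for x using that by blast
  have int_X: "integrable M (\<lambda>\<omega>. X \<omega> $ k)" for k
    by (intro transfer(1)[of "\<lambda>x. x $ k"] integrable_bounded_on_K[of _ R] nth)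
      (rule order_trans[OF component_le_norm_cart R])
  have \<Gamma>_nth: "(\<lambda>x. \<Gamma> (ix x) $ k) \<in> borel_measurable borel" for k
    by (rule measurable_compose[OF \<Gamma>_ix_measurable nth])
  have int_\<Gamma>: "integrable M (\<lambda>\<omega>. \<Gamma> (Z \<omega>) $ k)" for k
    unfolding Z_def
    by (intro transfer(1)[of "\<lambda>x. \<Gamma> (ix x) $ k"] integrable_bounded_on_K[of _ R] \<Gamma>_nth
        order_trans[OF component_le_norm_cart R] subsetD[OF curve_in] imageI ix_in)
  have diff: "(\<integral>\<omega>\<in>Z -` B \<inter> space M. X \<omega> $ k \<partial>M) - (\<integral>\<omega>\<in>Z -` B \<inter> space M. \<Gamma> (Z \<omega>) $ k \<partial>M)
      = (\<integral>x. deviation k B x * p x \<partial>lborel)" if B: "B \<in> sets borel" for B k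
  proof -
    have A: "Z -` B \<inter> space M \<in> sets M" using measurable_sets[OF Z_meas B] .
    have "(\<integral>\<omega>\<in>Z -` B \<inter> space M. X \<omega> $ k \<partial>M) - (\<integral>\<omega>\<in>Z -` B \<inter> space M. \<Gamma> (Z \<omega>) $ k \<partial>M)
      = (\<integral>\<omega>. indicator (Z -` B \<inter> space M) \<omega> *\<^sub>R X \<omega> $ k - indicator (Z -` B \<inter> space M) \<omega> *\<^sub>R \<Gamma> (Z \<omega>) $ k \<partial>M)"
      unfolding set_lebesgue_integral_def
      by (intro Bochner_Integration.integral_diff[symmetric] integrable_mult_indicator A int_X int_\<Gamma>)
    also have "\<dots> = (\<integral>\<omega>. deviation k B (X \<omega>) \<partial>M)"
      by (intro Bochner_Integration.integral_cong) (auto simp: deviation_def Z_def split: split_indicator)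
    also have "\<dots> = (\<integral>x. deviation k B x * p x \<partial>lborel)"
      by (intro transfer(2) deviation_measurable integrable_deviation B)
    finally show ?thesis .
  qed
  show ?thesis
  proof
    assume "self_consistent M X \<Gamma> L"
    then obtain g where g: "\<And>k. AE \<omega> in M. real_cond_exp M F (\<lambda>\<omega>. X \<omega> $ k) \<omega> = g (Z \<omega>) $ k"
      and g\<Gamma>: "AE s in distr M borel Z. g s = \<Gamma> s"
      unfolding self_consistent_def cond_exp_given_def F_def Z_def by blast
    have "AE \<omega> in M. g (Z \<omega>) = \<Gamma> (Z \<omega>)" by (rule AE_distrD[OF Z_meas g\<Gamma>])
    then have ae: "AE \<omega> in M. real_cond_exp M F (\<lambda>\<omega>. X \<omega> $ k) \<omega> = \<Gamma> (Z \<omega>) $ k" for k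
      using g[of k] by eventually_elim simp
    show "\<forall>B\<in>sets borel. \<forall>k. (\<integral>x. deviation k B x * p x \<partial>lborel) = 0"
    proof (intro ballI allI)
      fix B :: "real set" and k assume B: "B \<in> sets borel"
      define A where "A = Z -` B \<inter> space M"
      have A: "A \<in> sets F" "A \<in> sets M" using B measurable_sets[OF Z_meas B] by (auto simp: sets_F A_def)
      have "(\<integral>\<omega>\<in>A. X \<omega> $ k \<partial>M) = (\<integral>\<omega>\<in>A. real_cond_exp M F (\<lambda>\<omega>. X \<omega> $ k) \<omega> \<partial>M)"
        by (rule F.real_cond_exp_intA[OF int_X A(1)])
      also have "\<dots> = (\<integral>\<omega>\<in>A. \<Gamma> (Z \<omega>) $ k \<partial>M)"
        unfolding set_lebesgue_integral_def
      proof (rule integral_cong_AE)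
        show "(\<lambda>\<omega>. indicator A \<omega> *\<^sub>R real_cond_exp M F (\<lambda>\<omega>. X \<omega> $ k) \<omega>) \<in> borel_measurable M"
          using A(2) by (intro borel_measurable_scaleR borel_measurable_indicator) auto
        show "(\<lambda>\<omega>. indicator A \<omega> *\<^sub>R \<Gamma> (Z \<omega>) $ k) \<in> borel_measurable M"
          using A(2) borel_measurable_integrable[OF int_\<Gamma>[of k]]
          by (intro borel_measurable_scaleR borel_measurable_indicator)
        show "AE \<omega> in M. indicator A \<omega> *\<^sub>R real_cond_exp M F (\<lambda>\<omega>. X \<omega> $ k) \<omega> = indicator A \<omega> *\<^sub>R \<Gamma> (Z \<omega>) $ k"
          using ae[of k] by eventually_elim simp
      qed
      finally show "(\<integral>x. deviation k B x * p x \<partial>lborel) = 0"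
        using diff[OF B, of k] by (simp add: A_def)
    qed
  next
    assume zero: "\<forall>B\<in>sets borel. \<forall>k. (\<integral>x. deviation k B x * p x \<partial>lborel) = 0"
    \<comment> \<open>A version of the conditional expectation must be Borel on the whole line,
      hence the clamped curve; the distribution of \<open>Z\<close> is carried by
      \<open>{0..L}\<close>, where it equals \<Gamma>.\<close>
    define g where "g s = \<Gamma> (max 0 (min L s))" for s
    have g_meas: "g \<in> borel_measurable borel"
      unfolding g_def by (rule borel_measurable_continuous_onI[OF continuous_clamped_\<Gamma>])
    have gZ: "g (Z \<omega>) = \<Gamma> (Z \<omega>)" for \<omega> unfolding g_def Z_def by (rule clamped_ix)
    have "AE \<omega> in M. real_cond_exp M F (\<lambda>\<omega>. X \<omega> $ k) \<omega> = g (Z \<omega>) $ k" for k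
    proof (rule F.real_cond_exp_charact[OF _ int_X])
      show "integrable M (\<lambda>\<omega>. g (Z \<omega>) $ k)" using int_\<Gamma> by (simp add: gZ)
      show "(\<lambda>\<omega>. g (Z \<omega>) $ k) \<in> borel_measurable F"
        by (rule measurable_compose[OF measurable_compose[OF Z_F g_meas] nth])
      fix A assume "A \<in> sets F"
      then obtain B where "B \<in> sets borel" "A = Z -` B \<inter> space M" by (auto simp: sets_F)
      then show "(\<integral>\<omega>\<in>A. X \<omega> $ k \<partial>M) = (\<integral>\<omega>\<in>A. g (Z \<omega>) $ k \<partial>M)"
        using diff[of B k] zero by (simp add: gZ)
    qed
    moreover have "AE s in distr M borel Z. g s = \<Gamma> s"
    proof -
      have "AE s in distr M borel Z. s \<in> {0..L}"
        by (rule AE_distr_iff[THEN iffD2, OF Z_meas _ AE_I2]) (simp_all only: Z_def ix_in, simp)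
      then show ?thesis by eventually_elim (simp add: g_def)
    qed
    ultimately show "self_consistent M X \<Gamma> L"
      unfolding self_consistent_def cond_exp_given_def F_def Z_def using g_meas by blast
  qed
qed

end

theorem theorem4p2:
  fixes M :: "'w measure"
    and X :: "'w \<Rightarrow> real ^ ('n::{finite,linorder} option)"
    and p :: "real ^ ('n option) \<Rightarrow> real"
    and K :: "(real ^ ('n option)) set"
    and \<Gamma> :: "real \<Rightarrow> real ^ ('n option)"
    and L :: real
    and \<zeta> :: "real \<Rightarrow> (real, 'n) vec"
  assumes "prob_space M"
    and "distributed M lborel X (\<lambda>x. ennreal (p x))"
    and "\<And>x. 0 \<le> p x"
    and "smooth_on UNIV p"
    and "closure {x. p x \<noteq> 0} = K"
    and "compact_region K"
    and "\<And>x. x \<in> interior K \<Longrightarrow> 0 < p x"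
    and "smooth_arclength_curve \<Gamma> L"
    and "\<Gamma> ` {0..L} \<subseteq> K"
    and "normal_map_diffeo_on \<Gamma> L \<zeta> ((proj_index \<Gamma> L -` {0..L} \<inter> K) - ambiguity_set \<Gamma> L)"
    and "smooth_on {0..L} \<zeta>"
    and "\<And>s. s \<in> {0..L} \<Longrightarrow> frame_angles (\<zeta> s)"
    and "\<And>s. s \<in> {0..L} \<Longrightarrow> (\<Gamma> has_vector_derivative sph (\<zeta> s)) (at s within {0..L})"
  shows "self_consistent M X \<Gamma> L \<longleftrightarrow> solves_system p L \<Gamma> \<zeta>"
proof -
  interpret framed_curve_density p K \<Gamma> L \<zeta>
    by unfold_locales (fact assms)+
  show ?thesis
    unfolding self_consistent_iff[OF assms(1,2)] integrals_zero_iff_flux solves_system_iff ..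
qed

end
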